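(* Let $(Y,0)\subset(\mathbb C^2,0)$ be a plane branch singularity, $F\in\mathbb C\{x,y\}$ an (irreducible) equation defining $(Y,0)$, and let $n\ge3$ and $b\ge2$ be integers. There is a bijective map $$\epsilon:\ \mathcal G^n_{(Y,0),b}/\!\sim\ \longrightarrow\ \operatorname{MatRep}_{F,b}/Gl_b(\mathbb C\{x,y\})^2,\qquad (X,0)\mapsto\overline{(d,h)},$$ where $(d,h)$ is a matrix factorization of $F$ inducing a minimal free resolution $$0\longrightarrow\mathbb C\{x,y\}^b\stackrel{d}{\longrightarrow}\mathbb C\{x,y\}^b\longrightarrow\mathcal O_{(X,0)}\longrightarrow0 .$$
   Context: A curve singularity $(X,0)\subset(\mathbb C^n,0)$ is a germ of reduced irreducible complex analytic curve with local ring $\mathcal O_{(X,0)}$; $x_i=f_i(t)$, $i=1,\dots,n$, with $f_i\in\mathbb C\{t\}$, denotes a parametrization of it. $\mathcal O_{(Y,0)}=\mathbb C\{x,y\}/(F)$, with normalization $\overline{\mathcal O_{(Y,0)}}\cong\mathbb C\{t\}$. For a finitely generated module $M$ over a local ring $A$, $\beta_A(M)$ is its minimal number of generators. Whitney's cone $C_5(X,0)\subset\mathbb C^n$ is the set of $w\in\mathbb C^n$ for which there are analytic functions $\alpha(u),\beta(u)\in\mathbb C\{u\}$ vanishing at $0$ and scalars $\lambda(u)\in\mathbb C$ with $w=\lim_{u\to0}\lambda(u)(f_i(\alpha(u))-f_i(\beta(u)))_{i=1,\dots,n}$. $W_{(X,0)}$ is the set of pairs $L=(L_1,L_2)$ of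 linear forms on $\mathbb C^n$ whose zero set $\{L_1=L_2=0\}$ has dimension $n-2$ and meets $C_5(X,0)$ only at $0$. For $L\in W_{(X,0)}$ let $\pi_L=(L_1,L_2):\mathbb C^n\to\mathbb C^2$; the plane curve singularities $\pi_L(X,0)$, $L\in W_{(X,0)}$, are the generic plane projections of $(X,0)$. $\mathcal G^n_{(Y,0),b}$, $n\ge3$, is the set of curve singularities $(X,0)\subset(\mathbb C^n,0)$ such that $(Y,0)$ is a generic plane projection of $(X,0)$ and $b=\beta_{\mathcal O_{(Y,0)}}(\mathcal O_{(X,0)})$. For each such curve singularity $(X,0)$ one chooses a projection $\pi_L:(X,0)\to(Y,0)$, $L\in W_{(X,0)}$, equivalently an immersion $\pi_L^*:\mathcal O_{(Y,0)}\to\mathcal O_{(X,0)}$, through which $\mathcal O_{(X,0)}$ is an $\mathcal O_{(Y,0)}$-algebra. For $(X_1,0),(X_2,0)\in\mathcal G^n_{(Y,0),b}$ one writes $(X_1,0)\sim(X_2,0)$ if and only if $\mathcal O_{(X_1,0)}\cong\mathcal O_{(X_2,0)}$ as $\mathcal O_{(Y,0)}$-algebras. A matrix factorization of $F$ is a pair $(d,h)$ of square matrices of the same size over $\mathbb C\{x,y\}$ with $dh=hd=F\cdot\mathrm{Id}$. For $b\ge2$, $\operatorname{MatRep}_{F,b}$ is the set of pairs $(d,h)$ of $b\times b$ matrices with entries in $(x,y)\mathbb C\{x,y\}$ such that $hd=dh=F\,\mathrm{Id}_{\mathbb C\{x,y\}^b}$ and $\operatorname{coker}(d)$ is isomorphic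 as an $\mathcal O_{(Y,0)}$-module to an $\mathcal O_{(Y,0)}$-algebra $B$ with $\mathcal O_{(Y,0)}\subset B\subset\mathbb C\{t\}$ that is the local ring of a curve singularity having $(Y,0)$ as generic plane projection; i.e. $\operatorname{coker}(d)$ is isomorphic to $\mathcal O_{(X,0)}$ as an $\mathcal O_{(Y,0)}$-module, where $(X,0)$ is a curve singularity with $F$ as the equation defining a generic plane projection $(Y,0)$ of $(X,0)$. $Gl_b(\mathbb C\{x,y\})$ is the group of invertible $b\times b$ matrices with entries in $\mathbb C\{x,y\}$; $Gl_b(\mathbb C\{x,y\})^2$ acts on $\operatorname{MatRep}_{F,b}$ by $(\phi,\psi)\circ(d,h)=(\phi d\psi^{-1},\psi h\phi^{-1})$, and $\overline{(d,h)}$ denotes the orbit of $(d,h)$.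
   Formalization: Elements of G^n are pairs (X,L) of a curve with a chosen generic projection onto Y, not curves with one fixed choice each, and MatRep uses only curves in the same C^n; otherwise surjectivity can fail. *)

theory Defs
  imports "HOL-Analysis.Analysis" "HOL-Algebra.QuotRing" "HOL-Algebra.Module"
    "HOL-Library.Extended_Nat"
begin

section \<open>Convergent power series in finitely many variables\<close>

text \<open>
  Variables are indexed by a finite type \<open>'n\<close>, multi-indices are vectors \<open>nat ^ 'n\<close>;
  \<open>'n cps\<close> is the ring of convergent power series in \<open>CARD('n)\<close> variables, so \<open>2 cps\<close>
  is the ring of convergent power series in \<open>x, y\<close>.  For one variable \<open>t\<close> the library
  type \<open>complex fps\<close> with \<^const>\<open>fps_conv_radius\<close> is used.
\<close>

definition mdeg :: "nat ^ 'n \<Rightarrow> nat" where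
  "mdeg \<alpha> = (\<Sum>i\<in>UNIV. \<alpha> $ i)"

definition conv_coeffs :: "(nat ^ 'n \<Rightarrow> complex) \<Rightarrow> bool" where
  "conv_coeffs a \<longleftrightarrow> (\<exists>r>0. (\<lambda>\<alpha>. norm (a \<alpha>) * r ^ mdeg \<alpha>) summable_on UNIV)"

lemma mdeg_0 [simp]: "mdeg 0 = 0"
  by (simp add: mdeg_def)

lemma mdeg_add: "mdeg (\<alpha> + \<beta>) = mdeg \<alpha> + mdeg \<beta>"
  by (simp add: mdeg_def sum.distrib)

lemma mdeg_eq_0_iff: "mdeg \<alpha> = 0 \<longleftrightarrow> \<alpha> = 0"
  by (simp add: mdeg_def vec_eq_iff)

lemma finite_mdeg_le [simp]: "finite {\<alpha> :: nat ^ 'n. mdeg \<alpha> \<le> k}"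
proof -
  have "{\<alpha> :: nat ^ 'n. mdeg \<alpha> \<le> k} \<subseteq> vec_lambda ` (\<Pi>\<^sub>E i\<in>UNIV. {..k})"
  proof
    fix \<alpha> :: "nat ^ 'n" assume "\<alpha> \<in> {\<alpha>. mdeg \<alpha> \<le> k}"
    moreover have "\<alpha> $ i \<le> mdeg \<alpha>" for i
      unfolding mdeg_def by (rule member_le_sum) auto
    ultimately have "vec_nth \<alpha> \<in> (\<Pi>\<^sub>E i\<in>UNIV. {..k})"
      by (auto intro: order_trans)
    then show "\<alpha> \<in> vec_lambda ` (\<Pi>\<^sub>E i\<in>UNIV. {..k})"
      by (metis image_eqI vec_nth_inverse)
  qed
  then show ?thesis
    by (rule finite_subset) (auto intro!: finite_imageI finite_PiE)
qed

lemma finite_splits [simp]: "finite {(\<beta>, \<gamma>). \<beta> + \<gamma> = (\<alpha> :: nat ^ 'n)}"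
  by (rule finite_subset[of _ "{\<beta>. mdeg \<beta> \<le> mdeg \<alpha>} \<times> {\<beta>. mdeg \<beta> \<le> mdeg \<alpha>}"])
     (auto simp: mdeg_add)

definition trunc_norm :: "real \<Rightarrow> nat \<Rightarrow> (nat ^ 'n \<Rightarrow> complex) \<Rightarrow> real" where
  "trunc_norm r N a = (\<Sum>\<alpha> | mdeg \<alpha> \<le> N. norm (a \<alpha>) * r ^ mdeg \<alpha>)"

lemma trunc_norm_nonneg: "r \<ge> 0 \<Longrightarrow> trunc_norm r N a \<ge> 0"
  by (simp add: trunc_norm_def sum_nonneg)

lemma trunc_norm_mono: "0 \<le> s \<Longrightarrow> s \<le> r \<Longrightarrow> trunc_norm s N a \<le> trunc_norm r N a"
  unfolding trunc_norm_def by (intro sum_mono mult_left_mono power_mono) auto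

lemma conv_coeffs_iff:
  fixes a :: "nat ^ 'n \<Rightarrow> complex"
  shows
  "conv_coeffs a \<longleftrightarrow> (\<exists>r>0. \<exists>C. \<forall>N. trunc_norm r N a \<le> C)"
proof -
  have "(\<lambda>\<alpha>. norm (a \<alpha>) * r ^ mdeg \<alpha>) summable_on UNIV \<longleftrightarrow> (\<exists>C. \<forall>N. trunc_norm r N a \<le> C)"
    (is "?f summable_on UNIV \<longleftrightarrow> _") if "r > 0" for r :: real
  proof
    assume s: "?f summable_on UNIV"
    have "trunc_norm r N a \<le> infsum ?f UNIV" for N
      unfolding trunc_norm_def using s that by (intro finite_sum_le_infsum) auto
    then show "\<exists>C. \<forall>N. trunc_norm r N a \<le> C" by blast
  next
    assume "\<exists>C. \<forall>N. trunc_norm r N a \<le> C"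
    then obtain C where C: "\<And>N. trunc_norm r N a \<le> C" by blast
    have "sum ?f A \<le> C" if "finite A" for A
    proof -
      have "A \<subseteq> {\<alpha>. mdeg \<alpha> \<le> (\<Sum>\<alpha>\<in>A. mdeg \<alpha>)}"
        using that by (auto intro: member_le_sum)
      then have "sum ?f A \<le> trunc_norm r (\<Sum>\<alpha>\<in>A. mdeg \<alpha>) a"
        unfolding trunc_norm_def using \<open>r > 0\<close> by (intro sum_mono2) auto
      with C show ?thesis by (rule order_trans[rotated])
    qed
    then show "?f summable_on UNIV"
      using that
      by (intro nonneg_bounded_partial_sums_imp_summable_on[where C = C])
         (auto intro!: eventually_finite_subsets_at_top_weakI)
  qed
  then show ?thesis unfolding conv_coeffs_def by blast
qed

lemma conv_coeffs_obtain:
  fixes a :: "nat ^ 'n \<Rightarrow> complex"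
  assumes "conv_coeffs a"
  obtains r C where "r > 0" "C \<ge> 0" "\<And>s N. 0 \<le> s \<Longrightarrow> s \<le> r \<Longrightarrow> trunc_norm s N a \<le> C"
proof -
  obtain r C where r: "r > 0" and C: "\<And>N. trunc_norm r N a \<le> C"
    using assms unfolding conv_coeffs_iff by blast
  have "C \<ge> 0" using trunc_norm_nonneg[of r 0 a] C[of 0] r by linarith
  with r C show ?thesis
    by (intro that[of r C]) (auto intro: order_trans[OF trunc_norm_mono])
qed

definition conv_mult :: "(nat ^ 'n \<Rightarrow> complex) \<Rightarrow> (nat ^ 'n \<Rightarrow> complex) \<Rightarrow> nat ^ 'n \<Rightarrow> complex" where
  "conv_mult a b \<alpha> = (\<Sum>(\<beta>, \<gamma>) | \<beta> + \<gamma> = \<alpha>. a \<beta> * b \<gamma>)"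

lemma trunc_norm_mult:
  fixes a b :: "nat ^ 'n \<Rightarrow> complex"
  assumes "r \<ge> 0"
  shows "trunc_norm r N (conv_mult a b) \<le> trunc_norm r N a * trunc_norm r N b"
proof -
  let ?B = "{\<alpha> :: nat ^ 'n. mdeg \<alpha> \<le> N}"
  let ?P = "\<lambda>\<alpha> :: nat ^ 'n. {(\<beta>, \<gamma>). \<beta> + \<gamma> = \<alpha>}"
  let ?g = "\<lambda>(\<beta>, \<gamma>). (norm (a \<beta>) * r ^ mdeg \<beta>) * (norm (b \<gamma>) * r ^ mdeg \<gamma>)"
  have "trunc_norm r N (conv_mult a b) \<le> (\<Sum>\<alpha>\<in>?B. \<Sum>p\<in>?P \<alpha>. ?g p)"
    unfolding trunc_norm_def
  proof (rule sum_mono)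
    fix \<alpha> :: "nat ^ 'n"
    have "norm (conv_mult a b \<alpha>) * r ^ mdeg \<alpha>
        \<le> (\<Sum>(\<beta>, \<gamma>)\<in>?P \<alpha>. norm (a \<beta> * b \<gamma>)) * r ^ mdeg \<alpha>"
      unfolding conv_mult_def using assms
      by (intro mult_right_mono order_trans[OF norm_sum]) (auto simp: case_prod_unfold)
    also have "\<dots> = (\<Sum>p\<in>?P \<alpha>. ?g p)"
      by (auto simp: sum_distrib_right norm_mult mdeg_add power_add intro!: sum.cong)
    finally show "norm (conv_mult a b \<alpha>) * r ^ mdeg \<alpha> \<le> (\<Sum>p\<in>?P \<alpha>. ?g p)" .
  qed
  also have "\<dots> = sum ?g (\<Union>\<alpha>\<in>?B. ?P \<alpha>)"
    by (rule sum.UNION_disjoint[symmetric]) auto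
  also have "\<dots> \<le> sum ?g (?B \<times> ?B)"
    using assms by (intro sum_mono2) (auto simp: mdeg_add)
  also have "\<dots> = trunc_norm r N a * trunc_norm r N b"
    unfolding trunc_norm_def by (simp add: sum_product sum.cartesian_product)
  finally show ?thesis .
qed

lemma conv_coeffs_mult:
  assumes "conv_coeffs a" "conv_coeffs b"
  shows "conv_coeffs (conv_mult a b)"
proof -
  obtain r C where a: "r > 0" "C \<ge> 0" "\<And>s N. 0 \<le> s \<Longrightarrow> s \<le> r \<Longrightarrow> trunc_norm s N a \<le> C"
    using conv_coeffs_obtain[OF assms(1)] by metis
  obtain r' C' where b: "r' > 0" "C' \<ge> 0" "\<And>s N. 0 \<le> s \<Longrightarrow> s \<le> r' \<Longrightarrow> trunc_norm s N b \<le> C'"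
    using conv_coeffs_obtain[OF assms(2)] by metis
  let ?s = "min r r'"
  have "trunc_norm ?s N (conv_mult a b) \<le> C * C'" for N
    using a b by (intro order_trans[OF trunc_norm_mult] mult_mono trunc_norm_nonneg) auto
  then show ?thesis
    unfolding conv_coeffs_iff using a(1) b(1) by (intro exI[of _ ?s]) auto
qed

lemma conv_coeffs_add:
  assumes "conv_coeffs a" "conv_coeffs b"
  shows "conv_coeffs (\<lambda>\<alpha>. a \<alpha> + b \<alpha>)"
proof -
  obtain r C where a: "r > 0" "\<And>s N. 0 \<le> s \<Longrightarrow> s \<le> r \<Longrightarrow> trunc_norm s N a \<le> C"
    using conv_coeffs_obtain[OF assms(1)] by metis
  obtain r' C' where b: "r' > 0" "\<And>s N. 0 \<le> s \<Longrightarrow> s \<le> r' \<Longrightarrow> trunc_norm s N b \<le> C'"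
    using conv_coeffs_obtain[OF assms(2)] by metis
  let ?s = "min r r'"
  have "trunc_norm ?s N (\<lambda>\<alpha>. a \<alpha> + b \<alpha>) \<le> C + C'" for N
  proof -
    have "trunc_norm ?s N (\<lambda>\<alpha>. a \<alpha> + b \<alpha>) \<le> trunc_norm ?s N a + trunc_norm ?s N b"
      unfolding trunc_norm_def sum.distrib[symmetric] using a(1) b(1)
      by (intro sum_mono) (auto simp flip: distrib_right intro!: mult_right_mono norm_triangle_ineq)
    also have "\<dots> \<le> C + C'" using a b by (intro add_mono) auto
    finally show ?thesis .
  qed
  then show ?thesis
    unfolding conv_coeffs_iff using a(1) b(1) by (intro exI[of _ ?s]) auto
qed

lemma conv_coeffs_finite:
  assumes "\<And>\<alpha>. mdeg \<alpha> > k \<Longrightarrow> a \<alpha> = 0"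
  shows "conv_coeffs a"
proof -
  have "trunc_norm 1 N a \<le> (\<Sum>\<alpha> | mdeg \<alpha> \<le> k. norm (a \<alpha>))" for N
  proof -
    have "trunc_norm 1 N a = (\<Sum>\<alpha> | mdeg \<alpha> \<le> N \<and> mdeg \<alpha> \<le> k. norm (a \<alpha>))"
      unfolding trunc_norm_def using assms
      by (intro sum.mono_neutral_cong_right) (auto intro: leI)
    also have "\<dots> \<le> (\<Sum>\<alpha> | mdeg \<alpha> \<le> k. norm (a \<alpha>))" by (rule sum_mono2) auto
    finally show ?thesis .
  qed
  then show ?thesis unfolding conv_coeffs_iff by (intro exI[of _ 1]) auto
qed

typedef ('n :: finite) cps = "{a :: nat ^ 'n \<Rightarrow> complex. conv_coeffs a}"
  morphisms cps_coeff Abs_cps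
  by (rule exI[of _ "\<lambda>_. 0"]) (auto intro: conv_coeffs_finite)

setup_lifting type_definition_cps

lemma cps_eqI: "(\<And>\<alpha>. cps_coeff a \<alpha> = cps_coeff b \<alpha>) \<Longrightarrow> a = b"
  by (simp add: cps_coeff_inject[symmetric] ext)

lemma conv_coeffs_cps_coeff: "conv_coeffs (cps_coeff a)"
  using cps_coeff by simp

lemma splits_0: "{(\<beta>, \<gamma>). \<beta> + \<gamma> = (0 :: nat ^ 'n)} = {(0, 0)}"
  by (auto simp: vec_eq_iff)

lemma conv_mult_commute: "conv_mult a b = conv_mult b a"
proof
  fix \<alpha>
  show "conv_mult a b \<alpha> = conv_mult b a \<alpha>"
    unfolding conv_mult_def
    by (rule sum.reindex_bij_witness[where i = prod.swap and j = prod.swap])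
       (auto simp: add.commute)
qed

lemma conv_mult_assoc:
  fixes a b c :: "nat ^ 'n \<Rightarrow> complex"
  shows "conv_mult (conv_mult a b) c = conv_mult a (conv_mult b c)"
proof
  fix \<alpha> :: "nat ^ 'n"
  let ?P = "\<lambda>\<alpha> :: nat ^ 'n. {(\<beta>, \<gamma>). \<beta> + \<gamma> = \<alpha>}"
  have "conv_mult (conv_mult a b) c \<alpha>
      = (\<Sum>p\<in>?P \<alpha>. \<Sum>q\<in>?P (fst p). a (fst q) * b (snd q) * c (snd p))"
    unfolding conv_mult_def by (simp add: case_prod_unfold sum_distrib_right)
  also have "\<dots> = (\<Sum>(p, q)\<in>(SIGMA p:?P \<alpha>. ?P (fst p)). a (fst q) * b (snd q) * c (snd p))"
    by (rule sum.Sigma) auto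
  also have "\<dots> = (\<Sum>(p, q)\<in>(SIGMA p:?P \<alpha>. ?P (snd p)). a (fst p) * (b (fst q) * c (snd q)))"
    by (rule sum.reindex_bij_witness[where
          i = "\<lambda>((\<beta>, _), (\<gamma>, \<delta>)). ((\<beta> + \<gamma>, \<delta>), (\<beta>, \<gamma>))" and
          j = "\<lambda>((_, \<delta>), (\<beta>, \<gamma>)). ((\<beta>, \<gamma> + \<delta>), (\<gamma>, \<delta>))"])
       (auto simp: algebra_simps)
  also have "\<dots> = (\<Sum>p\<in>?P \<alpha>. \<Sum>q\<in>?P (snd p). a (fst p) * (b (fst q) * c (snd q)))"
    by (rule sum.Sigma[symmetric]) auto
  also have "\<dots> = conv_mult a (conv_mult b c) \<alpha>"
    unfolding conv_mult_def by (simp add: case_prod_unfold sum_distrib_left)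
  finally show "conv_mult (conv_mult a b) c \<alpha> = conv_mult a (conv_mult b c) \<alpha>" .
qed

lemma conv_mult_const:
  fixes \<alpha> :: "nat ^ 'n"
  shows "conv_mult (\<lambda>\<alpha>. if \<alpha> = 0 then c else 0) a \<alpha> = c * a \<alpha>"
proof -
  have "conv_mult (\<lambda>\<alpha>. if \<alpha> = 0 then c else 0) a \<alpha>
      = (\<Sum>(\<beta>, \<gamma>)\<in>{(0 :: nat ^ 'n, \<alpha>)}. (if \<beta> = 0 then c else 0) * a \<gamma>)"
    unfolding conv_mult_def
    by (rule sum.mono_neutral_right[OF finite_splits]) (auto split: if_splits)
  then show ?thesis by simp
qed

instantiation cps :: (finite) comm_ring_1
begin

lift_definition zero_cps :: "'a cps" is "\<lambda>_. 0"
  by (auto intro: conv_coeffs_finite)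

lift_definition one_cps :: "'a cps" is "\<lambda>\<alpha>. if \<alpha> = 0 then 1 else 0"
  by (rule conv_coeffs_finite[of 0]) auto

lift_definition plus_cps :: "'a cps \<Rightarrow> 'a cps \<Rightarrow> 'a cps" is "\<lambda>a b \<alpha>. a \<alpha> + b \<alpha>"
  by (rule conv_coeffs_add)

lift_definition uminus_cps :: "'a cps \<Rightarrow> 'a cps" is "\<lambda>a \<alpha>. - a \<alpha>"
  by (simp add: conv_coeffs_def)

lift_definition minus_cps :: "'a cps \<Rightarrow> 'a cps \<Rightarrow> 'a cps" is "\<lambda>a b \<alpha>. a \<alpha> - b \<alpha>"
proof -
  fix a b :: "nat ^ 'a \<Rightarrow> complex"
  assume "conv_coeffs a" "conv_coeffs b"
  then have "conv_coeffs (\<lambda>\<alpha>. a \<alpha> + - b \<alpha>)"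
    by (intro conv_coeffs_add) (auto simp: conv_coeffs_def)
  then show "conv_coeffs (\<lambda>\<alpha>. a \<alpha> - b \<alpha>)" by simp
qed

lift_definition times_cps :: "'a cps \<Rightarrow> 'a cps \<Rightarrow> 'a cps" is
  "\<lambda>a b \<alpha>. \<Sum>(\<beta>, \<gamma>) | \<beta> + \<gamma> = \<alpha>. a \<beta> * b \<gamma>"
  using conv_coeffs_mult by (simp add: conv_mult_def[abs_def])

instance
proof
  fix a b c :: "'a cps"
  show "a * b * c = a * (b * c)"
    by transfer (use conv_mult_assoc in \<open>simp add: conv_mult_def[abs_def]\<close>)
  show "a * b = b * a"
    by transfer (use conv_mult_commute in \<open>simp add: conv_mult_def[abs_def]\<close>)
  show "1 * a = a"
    by (rule cps_eqI)
       (simp add: times_cps.rep_eq one_cps.rep_eq conv_mult_const[unfolded conv_mult_def])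
  show "(a + b) * c = a * c + b * c"
    by transfer (simp add: case_prod_unfold distrib_right sum.distrib)
  show "(0 :: 'a cps) \<noteq> 1"
    by transfer (metis zero_neq_one)
qed (transfer; simp add: algebra_simps)+

end

lift_definition cps_const :: "complex \<Rightarrow> ('n :: finite) cps" is
  "\<lambda>c \<alpha>. if \<alpha> = 0 then c else 0"
  by (rule conv_coeffs_finite[of 0]) auto

lift_definition cps_var :: "'n :: finite \<Rightarrow> 'n cps" is
  "\<lambda>i \<alpha>. if \<alpha> = axis i 1 then 1 else 0"
proof -
  fix i :: 'n
  have "mdeg (axis i 1 :: nat ^ 'n) = 1" by (simp add: mdeg_def axis_def)
  then show "conv_coeffs (\<lambda>\<alpha> :: nat ^ 'n. if \<alpha> = axis i 1 then 1 else 0)"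
    by (intro conv_coeffs_finite[of 1]) auto
qed

text \<open>
  Substitution of the series \<open>g i\<close> for the variables.  It is only used when all \<open>g i\<close>
  have constant term 0; then only multi-indices of degree at most \<open>mdeg \<gamma>\<close> contribute to
  the coefficient at \<open>\<gamma>\<close>, and the result converges (\<open>cps_coeff_subst\<close> below), so that
  \<^const>\<open>Abs_cps\<close> is applied inside its domain.
\<close>

definition cps_subst :: "('m :: finite \<Rightarrow> ('n :: finite) cps) \<Rightarrow> 'm cps \<Rightarrow> 'n cps" where
  "cps_subst g a = Abs_cps (\<lambda>\<gamma>.
     \<Sum>\<alpha> | mdeg \<alpha> \<le> mdeg \<gamma>. cps_coeff a \<alpha> * cps_coeff (\<Prod>i\<in>UNIV. g i ^ (\<alpha> $ i)) \<gamma>)"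

lemma cps_coeff_times: "cps_coeff (a * b) = conv_mult (cps_coeff a) (cps_coeff b)"
  by transfer (simp add: conv_mult_def[abs_def])

lemma trunc_norm_one: "trunc_norm r N (cps_coeff (1 :: 'n :: finite cps)) = 1"
proof -
  have "trunc_norm r N (cps_coeff (1 :: 'n cps))
      = (\<Sum>\<alpha>\<in>{0}. norm (cps_coeff (1 :: 'n cps) \<alpha>) * r ^ mdeg \<alpha>)"
    unfolding trunc_norm_def by (rule sum.mono_neutral_right) (auto simp: one_cps.rep_eq)
  then show ?thesis by (simp add: one_cps.rep_eq)
qed

lemma trunc_norm_power:
  "r \<ge> 0 \<Longrightarrow> trunc_norm r N (cps_coeff (a ^ k)) \<le> trunc_norm r N (cps_coeff a) ^ k"
proof (induction k)
  case (Suc k)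
  then have "trunc_norm r N (cps_coeff (a * a ^ k))
      \<le> trunc_norm r N (cps_coeff a) * trunc_norm r N (cps_coeff a) ^ k"
    unfolding cps_coeff_times
    by (intro order_trans[OF trunc_norm_mult] mult_left_mono trunc_norm_nonneg) auto
  then show ?case by simp
qed (simp add: trunc_norm_one)

lemma trunc_norm_prod:
  assumes "finite A" "r \<ge> 0"
  shows "trunc_norm r N (cps_coeff (\<Prod>i\<in>A. g i)) \<le> (\<Prod>i\<in>A. trunc_norm r N (cps_coeff (g i)))"
  using assms(1)
proof (induction A rule: finite_induct)
  case (insert x A)
  then show ?case
    using assms(2)
    by (auto simp: cps_coeff_times
        intro!: order_trans[OF trunc_norm_mult] mult_left_mono trunc_norm_nonneg)
qed (simp add: trunc_norm_one)

lemma trunc_norm_small: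
  fixes g :: "'m :: finite \<Rightarrow> ('n :: finite) cps"
  assumes "\<And>i. cps_coeff (g i) 0 = 0" "R > 0"
  obtains r where "r > 0" "\<And>i N. trunc_norm r N (cps_coeff (g i)) \<le> R"
proof -
  have "\<exists>r>0. \<forall>s N. 0 \<le> s \<longrightarrow> s \<le> r \<longrightarrow> trunc_norm s N (cps_coeff (g i)) \<le> R" for i
  proof -
    obtain r C where r: "r > 0" "C \<ge> 0"
      and C: "\<And>s N. 0 \<le> s \<Longrightarrow> s \<le> r \<Longrightarrow> trunc_norm s N (cps_coeff (g i)) \<le> C"
      using conv_coeffs_obtain[OF conv_coeffs_cps_coeff] by metis
    define q where "q = min 1 (R / (C + 1))"
    have q: "0 < q" "q \<le> 1" "q * C \<le> R"
    proof -
      show "0 < q" "q \<le> 1" using r assms(2) by (auto simp: q_def)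
      have "q * C \<le> R / (C + 1) * C" using r by (intro mult_right_mono) (auto simp: q_def)
      also have "\<dots> \<le> R" using r assms(2) by (simp add: divide_simps)
      finally show "q * C \<le> R" .
    qed
    have "trunc_norm (q * r) N (cps_coeff (g i)) \<le> R" for N
    proof -
      have "trunc_norm (q * r) N (cps_coeff (g i)) \<le> q * trunc_norm r N (cps_coeff (g i))"
        unfolding trunc_norm_def sum_distrib_left
      proof (rule sum_mono)
        fix \<alpha> :: "nat ^ 'n"
        show "norm (cps_coeff (g i) \<alpha>) * (q * r) ^ mdeg \<alpha>
            \<le> q * (norm (cps_coeff (g i) \<alpha>) * r ^ mdeg \<alpha>)"
        proof (cases "\<alpha> = 0")
          case False
          then have "q ^ mdeg \<alpha> \<le> q ^ 1"
            using q by (intro power_decreasing) (auto simp: mdeg_eq_0_iff Suc_le_eq simp flip: neq0_conv)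
          then have "norm (cps_coeff (g i) \<alpha>) * r ^ mdeg \<alpha> * q ^ mdeg \<alpha>
              \<le> norm (cps_coeff (g i) \<alpha>) * r ^ mdeg \<alpha> * q"
            using r by (intro mult_left_mono) auto
          then show ?thesis by (simp add: power_mult_distrib mult_ac)
        qed (simp add: assms)
      qed
      also have "\<dots> \<le> q * C" using q r by (intro mult_left_mono C) auto
      finally show ?thesis using q by linarith
    qed
    then show ?thesis
      using q r by (intro exI[of _ "q * r"]) (auto intro: order_trans[OF trunc_norm_mono])
  qed
  then obtain \<rho> where \<rho>: "\<And>i. \<rho> i > 0"
    "\<And>i s N. 0 \<le> s \<Longrightarrow> s \<le> \<rho> i \<Longrightarrow> trunc_norm s N (cps_coeff (g i)) \<le> R"
    by metis
  show ?thesis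
  proof (rule that)
    show "Min (range \<rho>) > 0" using \<rho>(1) by (simp add: Min_gr_iff)
    show "trunc_norm (Min (range \<rho>)) N (cps_coeff (g i)) \<le> R" for i N
      using less_imp_le[OF \<open>Min (range \<rho>) > 0\<close>] by (intro \<rho>(2)) auto
  qed
qed

lemma cps_coeff_subst:
  fixes g :: "'m :: finite \<Rightarrow> ('n :: finite) cps"
  assumes "\<And>i. cps_coeff (g i) 0 = 0"
  shows "cps_coeff (cps_subst g a) \<gamma> =
    (\<Sum>\<alpha> | mdeg \<alpha> \<le> mdeg \<gamma>. cps_coeff a \<alpha> * cps_coeff (\<Prod>i\<in>UNIV. g i ^ (\<alpha> $ i)) \<gamma>)"
proof -
  let ?p = "\<lambda>\<alpha>. \<Prod>i\<in>UNIV. g i ^ (\<alpha> $ i)"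
  let ?s = "\<lambda>\<gamma>. \<Sum>\<alpha> | mdeg \<alpha> \<le> mdeg \<gamma>. cps_coeff a \<alpha> * cps_coeff (?p \<alpha>) \<gamma>"
  obtain R C where R: "R > 0" and C: "\<And>s N. 0 \<le> s \<Longrightarrow> s \<le> R \<Longrightarrow> trunc_norm s N (cps_coeff a) \<le> C"
    using conv_coeffs_obtain[OF conv_coeffs_cps_coeff] by metis
  obtain r where r: "r > 0" "\<And>i N. trunc_norm r N (cps_coeff (g i)) \<le> R"
    by (rule trunc_norm_small[of g, OF assms R]) blast
  have "trunc_norm r N ?s \<le> C" for N
  proof -
    let ?B = "{\<gamma> :: nat ^ 'n. mdeg \<gamma> \<le> N}" and ?A = "{\<alpha> :: nat ^ 'm. mdeg \<alpha> \<le> N}"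
    have p: "trunc_norm r N (cps_coeff (?p \<alpha>)) \<le> R ^ mdeg \<alpha>" for \<alpha>
    proof -
      have "trunc_norm r N (cps_coeff (?p \<alpha>)) \<le> (\<Prod>i\<in>UNIV. trunc_norm r N (cps_coeff (g i ^ (\<alpha> $ i))))"
        using r by (intro trunc_norm_prod) auto
      also have "\<dots> \<le> (\<Prod>i\<in>UNIV. R ^ (\<alpha> $ i))"
        using r by (intro prod_mono conjI trunc_norm_nonneg order_trans[OF trunc_norm_power] power_mono) auto
      also have "\<dots> = R ^ mdeg \<alpha>" by (simp add: mdeg_def power_sum)
      finally show ?thesis .
    qed
    have "trunc_norm r N ?s
        \<le> (\<Sum>\<gamma>\<in>?B. \<Sum>\<alpha>\<in>?A. norm (cps_coeff a \<alpha>) * (norm (cps_coeff (?p \<alpha>) \<gamma>) * r ^ mdeg \<gamma>))"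
      unfolding trunc_norm_def
    proof (rule sum_mono)
      fix \<gamma> :: "nat ^ 'n" assume "\<gamma> \<in> ?B"
      have "norm (?s \<gamma>) * r ^ mdeg \<gamma>
          \<le> (\<Sum>\<alpha> | mdeg \<alpha> \<le> mdeg \<gamma>. norm (cps_coeff a \<alpha> * cps_coeff (?p \<alpha>) \<gamma>)) * r ^ mdeg \<gamma>"
        using r by (intro mult_right_mono norm_sum) auto
      also have "\<dots> = (\<Sum>\<alpha> | mdeg \<alpha> \<le> mdeg \<gamma>. norm (cps_coeff a \<alpha>) * (norm (cps_coeff (?p \<alpha>) \<gamma>) * r ^ mdeg \<gamma>))"
        by (simp add: sum_distrib_right norm_mult mult.assoc)
      also have "\<dots> \<le> (\<Sum>\<alpha>\<in>?A. norm (cps_coeff a \<alpha>) * (norm (cps_coeff (?p \<alpha>) \<gamma>) * r ^ mdeg \<gamma>))"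
        using r \<open>\<gamma> \<in> ?B\<close> by (intro sum_mono2) auto
      finally show "norm (?s \<gamma>) * r ^ mdeg \<gamma> \<le> \<dots>" .
    qed
    also have "\<dots> = (\<Sum>\<alpha>\<in>?A. norm (cps_coeff a \<alpha>) * trunc_norm r N (cps_coeff (?p \<alpha>)))"
      unfolding trunc_norm_def by (subst sum.swap) (simp add: sum_distrib_left)
    also have "\<dots> \<le> trunc_norm R N (cps_coeff a)"
      unfolding trunc_norm_def[of R] by (intro sum_mono mult_left_mono p) auto
    also have "\<dots> \<le> C" using R by (intro C) auto
    finally show ?thesis .
  qed
  then have "conv_coeffs ?s" unfolding conv_coeffs_iff using r by blast
  then show ?thesis unfolding cps_subst_def by (subst Abs_cps_inverse) auto
qed

text \<open>The same substitution for one-variable series.\<close>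

definition cps_subst_fps :: "('m :: finite \<Rightarrow> complex fps) \<Rightarrow> 'm cps \<Rightarrow> complex fps" where
  "cps_subst_fps f a = Abs_fps (\<lambda>k.
     \<Sum>\<alpha> | mdeg \<alpha> \<le> k. cps_coeff a \<alpha> * fps_nth (\<Prod>i\<in>UNIV. f i ^ (\<alpha> $ i)) k)"

definition cps_ring :: "('n :: finite) cps ring" where
  "cps_ring = \<lparr>carrier = UNIV, mult = (*), one = 1, zero = 0, add = (+)\<rparr>"

lemma cring_cps_ring: "cring (cps_ring :: ('n :: finite) cps ring)"
proof (rule cringI)
  show "abelian_group (cps_ring :: 'n cps ring)"
  proof (rule abelian_groupI)
    fix a :: "'n cps"
    show "\<exists>b\<in>carrier cps_ring. b \<oplus>\<^bsub>cps_ring\<^esub> a = \<zero>\<^bsub>cps_ring\<^esub>"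
      by (rule bexI[of _ "- a"]) (auto simp: cps_ring_def)
  qed (auto simp: cps_ring_def algebra_simps)
  show "comm_monoid (cps_ring :: 'n cps ring)"
    by (rule comm_monoidI) (auto simp: cps_ring_def algebra_simps)
qed (auto simp: cps_ring_def algebra_simps)


section \<open>Curve singularities and their generic plane projections\<close>

text \<open>
  A reduced irreducible analytic germ in affine \<open>n\<close>-space is given by its (prime) ideal \<open>X\<close>
  of convergent power series vanishing on it; its local ring is the quotient by \<open>X\<close>.  The
  last two conditions say that this quotient has Krull dimension 1: as \<open>X\<close> is prime,
  every chain of primes containing \<open>X\<close> can be extended to start at \<open>X\<close>.
\<close>

definition curve_singularity :: "('n :: finite) cps set \<Rightarrow> bool" where
  "curve_singularity X \<longleftrightarrow>
     primeideal X cps_ring \<and>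
     (\<exists>P. primeideal P cps_ring \<and> X \<subset> P) \<and>
     \<not> (\<exists>P Q. primeideal P cps_ring \<and> primeideal Q cps_ring \<and> X \<subset> P \<and> P \<subset> Q)"

definition local_ring :: "('n :: finite) cps set \<Rightarrow> 'n cps set ring" where
  "local_ring X = cps_ring Quot X"

text \<open>
  \<open>f\<close> parametrizes \<open>X\<close>: \<open>X\<close> is the ideal of the image germ of \<open>t \<mapsto> (f i (t))\<close>, and this
  map is injective near 0, i.e. \<open>t\<close> is a coordinate on the normalization.
\<close>

definition parametrizes :: "('n :: finite \<Rightarrow> complex fps) \<Rightarrow> 'n cps set \<Rightarrow> bool" where
  "parametrizes f X \<longleftrightarrow>
     (\<forall>i. fps_conv_radius (f i) > 0 \<and> fps_nth (f i) 0 = 0) \<and>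
     X = {a. cps_subst_fps f a = 0} \<and>
     (\<exists>\<epsilon>>0. inj_on (\<lambda>t. \<chi> i. eval_fps (f i) t) (ball 0 \<epsilon>))"

text \<open>Whitney's cone \<open>C5\<close>; it does not depend on the parametrization \<open>f\<close>.\<close>

definition whitney_C5 :: "('n :: finite) cps set \<Rightarrow> (complex ^ 'n) set" where
  "whitney_C5 X = {w. \<exists>f \<alpha> \<beta> (l :: complex \<Rightarrow> complex).
     parametrizes f X \<and>
     fps_conv_radius \<alpha> > 0 \<and> fps_nth \<alpha> 0 = 0 \<and>
     fps_conv_radius \<beta> > 0 \<and> fps_nth \<beta> 0 = 0 \<and>
     ((\<lambda>u. \<chi> i. l u * (eval_fps (f i) (eval_fps \<alpha> u) - eval_fps (f i) (eval_fps \<beta> u)))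
        \<longlongrightarrow> w) (at 0)}"

text \<open>
  A pair of linear forms is a \<open>2 \<times> n\<close> matrix \<open>L\<close> whose rows are the coefficient vectors;
  the projection is \<open>z \<mapsto> L *v z\<close>, and \<open>pullback L\<close> is composition with it.
\<close>

definition generic_forms :: "('n :: finite) cps set \<Rightarrow> (complex ^ 'n ^ 2) set" where
  "generic_forms X = {L. vec.dim {z. L *v z = 0} + 2 = CARD('n) \<and>
     {z. L *v z = 0} \<inter> whitney_C5 X = {0}}"

definition pullback :: "complex ^ ('n :: finite) ^ 2 \<Rightarrow> 2 cps \<Rightarrow> 'n cps" where
  "pullback L = cps_subst (\<lambda>k. \<Sum>j\<in>UNIV. cps_const (L $ k $ j) * cps_var j)"

text \<open>A series vanishes on the image germ of \<open>X\<close> iff its pullback vanishes on \<open>X\<close>.\<close>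

definition projection_germ :: "complex ^ ('n :: finite) ^ 2 \<Rightarrow> 'n cps set \<Rightarrow> 2 cps set" where
  "projection_germ L X = {a. pullback L a \<in> X}"

text \<open>
  Curve singularities \<open>X\<close> together with a projection \<open>L\<close> realizing \<open>Y\<close> as a generic plane
  projection of \<open>X\<close>.  The projection is part of the data, because the algebra structure of the
  local ring of \<open>X\<close> over that of \<open>Y\<close> depends on it: different \<open>L\<close> with the same image
  germ may differ by an automorphism of \<open>Y\<close> that does not lift to \<open>X\<close>.
\<close>

definition projected_curves :: "2 cps set \<Rightarrow> (('n :: finite) cps set \<times> (complex ^ 'n ^ 2)) set" where
  "projected_curves Y = {(X, L). curve_singularity X \<and> L \<in> generic_forms X \<and>
     projection_germ L X = Y}"

text \<open>
  The local ring of \<open>X\<close> as an algebra over the local ring of \<open>Y = projection_germ L X\<close>: the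
  class of \<open>a\<close> acts as multiplication by the class of \<open>pullback L a\<close>.
\<close>

definition local_algebra :: "('n :: finite) cps set \<Rightarrow> complex ^ 'n ^ 2 \<Rightarrow> (2 cps set, 'n cps set) module" where
  "local_algebra X L =
     \<lparr>carrier = carrier (local_ring X), mult = mult (local_ring X), one = one (local_ring X),
      zero = zero (local_ring X), add = add (local_ring X),
      smult = (\<lambda>A C. \<Union>a\<in>A. \<Union>c\<in>C. X +>\<^bsub>cps_ring\<^esub> (pullback L a * c))\<rparr>"

definition module_iso ::
  "('r, 'k) ring_scheme \<Rightarrow> ('r, 'a, 'm) module_scheme \<Rightarrow> ('r, 'b, 'l) module_scheme \<Rightarrow> ('a \<Rightarrow> 'b) set" where
  "module_iso R M N = {f. bij_betw f (carrier M) (carrier N) \<and>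
     (\<forall>x\<in>carrier M. \<forall>y\<in>carrier M. f (x \<oplus>\<^bsub>M\<^esub> y) = f x \<oplus>\<^bsub>N\<^esub> f y) \<and>
     (\<forall>a\<in>carrier R. \<forall>x\<in>carrier M. f (a \<odot>\<^bsub>M\<^esub> x) = a \<odot>\<^bsub>N\<^esub> f x)}"

definition algebra_iso ::
  "('r, 'k) ring_scheme \<Rightarrow> ('r, 'a, 'm) module_scheme \<Rightarrow> ('r, 'b, 'l) module_scheme \<Rightarrow> ('a \<Rightarrow> 'b) set" where
  "algebra_iso R M N = ring_iso M N \<inter> module_iso R M N"

text \<open>
  The minimal number of generators of a module, which is \<open>\<infinity>\<close> if it is not finitely generated.
\<close>

definition min_generators :: "('r, 'k) ring_scheme \<Rightarrow> ('r, 'a, 'm) module_scheme \<Rightarrow> enat" where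
  "min_generators R M = (INF S \<in> {S. finite S \<and> S \<subseteq> carrier M \<and>
     \<Inter> {N. submodule N R M \<and> S \<subseteq> N} = carrier M}. enat (card S))"

definition G_set :: "2 cps set \<Rightarrow> nat \<Rightarrow> (('n :: finite) cps set \<times> (complex ^ 'n ^ 2)) set" where
  "G_set Y b = {(X, L) \<in> projected_curves Y.
     min_generators (local_ring Y) (local_algebra X L) = enat b}"

definition G_equiv ::
  "2 cps set \<Rightarrow> nat \<Rightarrow> ((('n :: finite) cps set \<times> (complex ^ 'n ^ 2)) \<times> ('n cps set \<times> (complex ^ 'n ^ 2))) set" where
  "G_equiv Y b = {((X1, L1), (X2, L2)). (X1, L1) \<in> G_set Y b \<and> (X2, L2) \<in> G_set Y b \<and>
     algebra_iso (local_ring Y) (local_algebra X1 L1) (local_algebra X2 L2) \<noteq> {}}"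


section \<open>Matrix factorizations\<close>

type_synonym 'b mat_pair = "(2 cps ^ 'b ^ 'b) \<times> (2 cps ^ 'b ^ 'b)"

definition matrix_factorization :: "2 cps \<Rightarrow> ('b :: finite) mat_pair \<Rightarrow> bool" where
  "matrix_factorization F = (\<lambda>(d, h). d ** h = mat F \<and> h ** d = mat F)"

definition xy_ideal :: "2 cps set" where
  "xy_ideal = genideal cps_ring (range cps_var)"

definition free_module :: "(2 cps, 2 cps ^ ('b :: finite)) module" where
  "free_module = \<lparr>carrier = UNIV, mult = undefined, one = undefined, zero = 0, add = (+), smult = (*s)\<rparr>"

text \<open>
  The cokernel of \<open>d\<close>, as a module over the quotient of \<open>2 cps\<close> by an ideal annihilating it.
  The ring-only fields of the record (also in \<open>free_module\<close>) are irrelevant.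
\<close>

definition coker :: "2 cps ^ ('b :: finite) ^ 'b \<Rightarrow> (2 cps set, (2 cps ^ 'b) set) module" where
  "coker d =
     \<lparr>carrier = a_rcosets\<^bsub>free_module\<^esub> (range ((*v) d)), mult = undefined, one = undefined,
      zero = range ((*v) d), add = set_add free_module,
      smult = (\<lambda>A C. \<Union>a\<in>A. \<Union>v\<in>C. range ((*v) d) +>\<^bsub>free_module\<^esub> (a *s v))\<rparr>"

text \<open>
  The ambient dimension \<open>CARD('n)\<close> of the curve singularities \<open>X\<close> is fixed, and is
  passed as a type argument.
\<close>

definition MatRep :: "('n :: finite) itself \<Rightarrow> 2 cps \<Rightarrow> ('b :: finite) mat_pair set" where
  "MatRep _ F = {(d, h). matrix_factorization F (d, h) \<and>
     (\<forall>i j. d $ i $ j \<in> xy_ideal \<and> h $ i $ j \<in> xy_ideal) \<and>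
     (\<exists>(X :: 'n cps set, L) \<in> projected_curves (cgenideal cps_ring F).
        module_iso (local_ring (cgenideal cps_ring F)) (coker d) (local_algebra X L) \<noteq> {})}"

definition gl_act ::
  "(2 cps ^ ('b :: finite) ^ 'b) \<times> (2 cps ^ 'b ^ 'b) \<Rightarrow> 'b mat_pair \<Rightarrow> 'b mat_pair" where
  "gl_act = (\<lambda>(\<phi>, \<psi>) (d, h). (\<phi> ** d ** matrix_inv \<psi>, \<psi> ** h ** matrix_inv \<phi>))"

definition gl_orbit :: "('b :: finite) mat_pair \<Rightarrow> 'b mat_pair set" where
  "gl_orbit m = {gl_act (\<phi>, \<psi>) m | \<phi> \<psi>. invertible \<phi> \<and> invertible \<psi>}"

text \<open>
  \<open>0 \<rightarrow> R\<^sup>b \<rightarrow> R\<^sup>b \<rightarrow> O \<rightarrow> 0\<close> with maps \<open>d\<close> and \<open>p\<close> is a minimal free resolution of the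
  local ring of \<open>X\<close> as a module over \<open>R = 2 cps\<close>, where \<open>a \<in> R\<close> acts through its class
  in the local ring of \<open>Y\<close>.
\<close>

definition minimal_free_resolution ::
  "2 cps set \<Rightarrow> ('n :: finite) cps set \<Rightarrow> complex ^ 'n ^ 2 \<Rightarrow> 2 cps ^ ('b :: finite) ^ 'b \<Rightarrow>
    (2 cps ^ 'b \<Rightarrow> 'n cps set) \<Rightarrow> bool" where
  "minimal_free_resolution Y X L d p \<longleftrightarrow>
     (\<forall>v w. p (v + w) = p v \<oplus>\<^bsub>local_algebra X L\<^esub> p w) \<and>
     (\<forall>a v. p (a *s v) = (Y +>\<^bsub>cps_ring\<^esub> a) \<odot>\<^bsub>local_algebra X L\<^esub> p v) \<and>
     range p = carrier (local_algebra X L) \<and>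
     range ((*v) d) = {v. p v = \<zero>\<^bsub>local_algebra X L\<^esub>} \<and>
     inj ((*v) d) \<and>
     (\<forall>i j. d $ i $ j \<in> xy_ideal)"

end

(*
  Composing the parametrization of X with an m-th root coordinate makes one coordinate of the
  generic projection equal to s^m. Whitney's cone condition then forces the conjugates of the other
  coordinate under s -> zs (z^m = 1) to be distinct, and Lagrange interpolation at these conjugates
  gives a common denominator: the local ring O_X, seen inside C{s}, lies in the fraction field of
  O_Y. As O_X is torsion-free over C{x_i}, the relations between b generators are generated, modulo
  x_i, by b elements, so by Nakayama's lemma O_X = coker d with d h = F for square matrices d, h of
  size b. Lifting module isomorphisms to the minimal resolutions gives invertible matrices, so the
  orbit of (d, h) depends only on the O_Y-module O_X. Conversely a linear isomorphism f of two such
  algebras becomes an algebra isomorphism after division by the unit f 1.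
*)

theory Submission
  imports Defs "HOL-Complex_Analysis.Complex_Analysis"
begin

unbundle no Formal_Power_Series.fps_syntax

section \<open>Substitution into convergent power series\<close>

text \<open>Classes in O_X and O_Y are rarely handled as cosets: a parametrization turns them into
  series in one parameter. O_X becomes a subring \<open>B\<close> of series, scalars act by
  multiplication, and torsion-freeness is the absence of zero divisors among series. Once a
  coordinate of the projection is s^m, the conjugations over C{s^m} are plain substitutions and C{s}
  is free over C{s^m} with explicit coordinates; this stands in for general finiteness theorems on
  analytic rings. The common denominator acts twice. It makes a linear map of O_X determined by its
  value at 1, and it makes any two elements of O_X dependent over O_Y, which keeps units out of
  \<open>h\<close> when O_X is not cyclic; b \<ge> 2 is what excludes the cyclic case. Minimality of
  b keeps units out of \<open>d\<close>. Parameters of different curves are never compared: what the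
  curves share is the kernel of the evaluation of plane series, generated by
  \<open>F\<close>.\<close>

abbreviation cps_monom_subst :: "('m :: finite \<Rightarrow> 'a :: comm_monoid_mult) \<Rightarrow> nat ^ 'm \<Rightarrow> 'a" where
  "cps_monom_subst f \<alpha> \<equiv> \<Prod>i\<in>UNIV. f i ^ (\<alpha> $ i)"

text \<open>Each \<open>f i\<close> is divisible by \<open>fps_X\<close>, so the monomial has order
  at least \<open>mdeg \<alpha>\<close>. This makes the finite cutoff in
  \<open>cps_subst_fps\<close> harmless.\<close>

lemma fps_nth_monom_subst_eq_0:
  fixes f :: "'m :: finite \<Rightarrow> complex fps"
  assumes "\<And>i. fps_nth (f i) 0 = 0" "k < mdeg \<alpha>"
  shows "fps_nth (cps_monom_subst f \<alpha>) k = 0"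
proof -
  have "f i = fps_X * fps_shift 1 (f i)" for i
    using assms(1)[of i] by (intro fps_ext) (auto simp: fps_X_mult_nth)
  then have "cps_monom_subst f \<alpha> = cps_monom_subst (\<lambda>i. fps_X * fps_shift 1 (f i)) \<alpha>"
    by simp
  also have "\<dots> = fps_X ^ mdeg \<alpha> * cps_monom_subst (\<lambda>i. fps_shift 1 (f i)) \<alpha>"
    by (simp add: power_mult_distrib prod.distrib mdeg_def power_sum)
  finally show ?thesis
    using assms(2) by (simp add: fps_X_power_mult_nth)
qed

lemma monom_subst_add:
  fixes f :: "'m :: finite \<Rightarrow> 'a :: comm_monoid_mult"
  shows "cps_monom_subst f (\<alpha> + \<beta>) = cps_monom_subst f \<alpha> * cps_monom_subst f \<beta>"
  by (simp add: power_add prod.distrib)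

text \<open>Terms beyond the cutoff vanish at \<open>k\<close>, so any \<open>N \<ge> k\<close> will
  do and sums for several coefficients can share one index set.\<close>

lemma fps_nth_cps_subst_fps:
  assumes "\<And>i. fps_nth (f i) 0 = 0" "k \<le> N"
  shows "fps_nth (cps_subst_fps f a) k
       = (\<Sum>\<alpha> | mdeg \<alpha> \<le> N. cps_coeff a \<alpha> * fps_nth (cps_monom_subst f \<alpha>) k)"
  unfolding cps_subst_fps_def fps_nth_Abs_fps
  using assms by (intro sum.mono_neutral_left) (auto simp: fps_nth_monom_subst_eq_0 not_le)

lemma cps_subst_fps_add: "cps_subst_fps f (a + b) = cps_subst_fps f a + cps_subst_fps f b"
  by (intro fps_ext) (simp add: cps_subst_fps_def plus_cps.rep_eq distrib_right sum.distrib)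

lemma cps_subst_fps_0 [simp]: "cps_subst_fps f 0 = 0"
  by (intro fps_ext) (simp add: cps_subst_fps_def zero_cps.rep_eq)

lemma cps_subst_fps_uminus: "cps_subst_fps f (- a) = - cps_subst_fps f a"
  using cps_subst_fps_add[of f a "- a"] by (simp add: eq_neg_iff_add_eq_0 add.commute)

lemma cps_subst_fps_diff: "cps_subst_fps f (a - b) = cps_subst_fps f a - cps_subst_fps f b"
  using cps_subst_fps_add[of f a "- b"] by (simp add: cps_subst_fps_uminus)

lemma cps_subst_fps_sum: "cps_subst_fps f (sum h A) = (\<Sum>i\<in>A. cps_subst_fps f (h i))"
  by (induction A rule: infinite_finite_induct) (auto simp: cps_subst_fps_add)

lemma cps_subst_fps_const:
  assumes "\<And>i. fps_nth (f i) 0 = 0"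
  shows "cps_subst_fps f (cps_const c) = fps_const c"
proof (rule fps_ext)
  fix k
  have "fps_nth (cps_subst_fps f (cps_const c)) k =
      (\<Sum>\<alpha>\<in>{0}. cps_coeff (cps_const c) \<alpha> * fps_nth (cps_monom_subst f \<alpha>) k)"
    unfolding fps_nth_cps_subst_fps[OF assms order_refl]
    by (rule sum.mono_neutral_right) (auto simp: cps_const.rep_eq)
  then show "fps_nth (cps_subst_fps f (cps_const c)) k = fps_nth (fps_const c) k"
    by (simp add: cps_const.rep_eq)
qed

lemma cps_const_1: "cps_const 1 = 1"
  by (rule cps_eqI) (simp add: cps_const.rep_eq one_cps.rep_eq)

lemma cps_subst_fps_1:
  assumes "\<And>i. fps_nth (f i) 0 = 0"
  shows "cps_subst_fps f 1 = 1"
  using cps_subst_fps_const[of f 1, OF assms] by (simp add: cps_const_1)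

lemma mdeg_axis [simp]: "mdeg (axis i n) = n"
  by (simp add: mdeg_def axis_def)

lemma monom_subst_axis: "cps_monom_subst f (axis i (Suc 0)) = f i"
proof -
  have "cps_monom_subst f (axis i (Suc 0)) = (\<Prod>j\<in>UNIV. if j = i then f j else 1)"
    by (intro prod.cong) (auto simp: axis_def)
  then show ?thesis by simp
qed

lemma cps_subst_fps_var:
  assumes "\<And>i. fps_nth (f i) 0 = 0"
  shows "cps_subst_fps f (cps_var i) = f i"
proof (rule fps_ext)
  fix k
  have "fps_nth (cps_subst_fps f (cps_var i)) k =
      (\<Sum>\<alpha>\<in>{axis i 1}. cps_coeff (cps_var i) \<alpha> * fps_nth (cps_monom_subst f \<alpha>) k)"
    unfolding fps_nth_cps_subst_fps[where N = "max 1 k", OF assms max.cobounded2]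
    by (rule sum.mono_neutral_right) (auto simp: cps_var.rep_eq)
  then show "fps_nth (cps_subst_fps f (cps_var i)) k = fps_nth (f i) k"
    by (simp add: cps_var.rep_eq monom_subst_axis)
qed

lemma cps_subst_fps_mult:
  fixes f :: "'m :: finite \<Rightarrow> complex fps"
  assumes "\<And>i. fps_nth (f i) 0 = 0"
  shows "cps_subst_fps f (a * b) = cps_subst_fps f a * cps_subst_fps f b"
proof (rule fps_ext)
  fix k
  let ?B = "{\<alpha> :: nat ^ 'm. mdeg \<alpha> \<le> k}"
  let ?P = "\<lambda>\<alpha> :: nat ^ 'm. {(\<beta>, \<gamma>). \<beta> + \<gamma> = \<alpha>}"
  let ?m = "cps_monom_subst f"
  let ?t = "\<lambda>(\<beta>, \<gamma>). cps_coeff a \<beta> * cps_coeff b \<gamma> * fps_nth (?m \<beta> * ?m \<gamma>) k"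
  have "fps_nth (cps_subst_fps f (a * b)) k
      = (\<Sum>\<alpha>\<in>?B. \<Sum>p\<in>?P \<alpha>. ?t p)"
    unfolding cps_subst_fps_def fps_nth_Abs_fps cps_coeff_times conv_mult_def sum_distrib_right
    by (intro sum.cong) (auto simp flip: monom_subst_add)
  also have "\<dots> = sum ?t (\<Union>\<alpha>\<in>?B. ?P \<alpha>)"
    by (rule sum.UNION_disjoint[symmetric]) auto
  \<comment> \<open>Pairs of total degree above \<open>k\<close> may be added: their product
    monomial has no coefficient at \<open>k\<close>.\<close>
  also have "\<dots> = sum ?t (?B \<times> ?B)"
  proof (rule sum.mono_neutral_left)
    show "\<forall>p\<in>?B \<times> ?B - (\<Union>\<alpha>\<in>?B. ?P \<alpha>). ?t p = 0"
    proof
      fix p assume p: "p \<in> ?B \<times> ?B - (\<Union>\<alpha>\<in>?B. ?P \<alpha>)"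
      then have "fps_nth (?m (fst p + snd p)) k = 0"
        by (intro fps_nth_monom_subst_eq_0 assms) (auto simp: not_le)
      then show "?t p = 0"
        unfolding monom_subst_add by (simp add: case_prod_unfold)
    qed
  qed (auto simp: mdeg_add)
  also have "\<dots> = (\<Sum>\<beta>\<in>?B. \<Sum>\<gamma>\<in>?B. \<Sum>i=0..k.
      (cps_coeff a \<beta> * fps_nth (?m \<beta>) i) * (cps_coeff b \<gamma> * fps_nth (?m \<gamma>) (k - i)))"
    by (simp add: sum.cartesian_product[symmetric] fps_mult_nth sum_distrib_left mult_ac)
  also have "\<dots> = (\<Sum>\<beta>\<in>?B. \<Sum>i=0..k. \<Sum>\<gamma>\<in>?B.
      (cps_coeff a \<beta> * fps_nth (?m \<beta>) i) * (cps_coeff b \<gamma> * fps_nth (?m \<gamma>) (k - i)))"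
    by (intro sum.cong refl sum.swap)
  also have "\<dots> = (\<Sum>i=0..k. \<Sum>\<beta>\<in>?B. \<Sum>\<gamma>\<in>?B.
      (cps_coeff a \<beta> * fps_nth (?m \<beta>) i) * (cps_coeff b \<gamma> * fps_nth (?m \<gamma>) (k - i)))"
    by (rule sum.swap)
  also have "\<dots> = (\<Sum>i=0..k. fps_nth (cps_subst_fps f a) i * fps_nth (cps_subst_fps f b) (k - i))"
    by (intro sum.cong refl)
       (simp add: fps_nth_cps_subst_fps[of f _ k, OF assms] sum_product)
  finally show "fps_nth (cps_subst_fps f (a * b)) k = fps_nth (cps_subst_fps f a * cps_subst_fps f b) k"
    by (simp add: fps_mult_nth)
qed

lemma cps_subst_fps_power:
  fixes f :: "'m :: finite \<Rightarrow> complex fps"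
  assumes "\<And>i. fps_nth (f i) 0 = 0"
  shows "cps_subst_fps f (a ^ n) = cps_subst_fps f a ^ n"
  by (induction n) (simp_all add: cps_subst_fps_1 cps_subst_fps_mult assms)

lemma cps_subst_fps_prod:
  fixes f :: "'m :: finite \<Rightarrow> complex fps"
  assumes "\<And>i. fps_nth (f i) 0 = 0"
  shows "cps_subst_fps f (prod h A) = (\<Prod>i\<in>A. cps_subst_fps f (h i))"
  by (induction A rule: infinite_finite_induct)
     (simp_all add: cps_subst_fps_1 cps_subst_fps_mult assms)

lemma cps_coeff_mult_eq_0:
  fixes a b :: "'n :: finite cps"
  assumes "\<And>\<alpha>. mdeg \<alpha> < m \<Longrightarrow> cps_coeff a \<alpha> = 0"
    and "\<And>\<alpha>. mdeg \<alpha> < n \<Longrightarrow> cps_coeff b \<alpha> = 0" and "mdeg \<gamma> < m + n"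
  shows "cps_coeff (a * b) \<gamma> = 0"
  unfolding cps_coeff_times conv_mult_def
proof (intro sum.neutral ballI)
  fix p assume "p \<in> {(\<alpha>, \<beta>). \<alpha> + \<beta> = \<gamma>}"
  then obtain \<alpha> \<beta> where p: "p = (\<alpha>, \<beta>)" "\<alpha> + \<beta> = \<gamma>" by auto
  then have "mdeg \<alpha> < m \<or> mdeg \<beta> < n"
    using assms(3) by (auto simp: mdeg_add)
  then show "(case p of (\<beta>, \<gamma>) \<Rightarrow> cps_coeff a \<beta> * cps_coeff b \<gamma>) = 0"
    using assms p by auto
qed

lemma cps_coeff_power_eq_0:
  fixes a :: "'n :: finite cps"
  assumes "cps_coeff a 0 = 0" "mdeg \<gamma> < n"
  shows "cps_coeff (a ^ n) \<gamma> = 0"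
  using assms(2)
proof (induction n arbitrary: \<gamma>)
  case (Suc n)
  have "cps_coeff (a * a ^ n) \<gamma> = 0"
    by (rule cps_coeff_mult_eq_0[of 1 _ n]) (use Suc assms(1) in \<open>auto simp: mdeg_eq_0_iff\<close>)
  then show ?case by simp
qed auto

lemma cps_coeff_monom_subst_eq_0:
  fixes g :: "'m :: finite \<Rightarrow> 'n :: finite cps"
  assumes "\<And>i. cps_coeff (g i) 0 = 0" "mdeg \<gamma> < mdeg \<alpha>"
  shows "cps_coeff (cps_monom_subst g \<alpha>) \<gamma> = 0"
proof -
  have "cps_coeff (\<Prod>i\<in>A. g i ^ (\<alpha> $ i)) \<gamma> = 0" if "finite A" "mdeg \<gamma> < (\<Sum>i\<in>A. \<alpha> $ i)" for A \<gamma>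
    using that
  proof (induction A arbitrary: \<gamma> rule: finite_induct)
    case (insert x A)
    have "cps_coeff (g x ^ (\<alpha> $ x) * (\<Prod>i\<in>A. g i ^ (\<alpha> $ i))) \<gamma> = 0"
      by (rule cps_coeff_mult_eq_0[of "\<alpha> $ x" _ "\<Sum>i\<in>A. \<alpha> $ i"])
         (use insert in \<open>auto simp: cps_coeff_power_eq_0[OF assms(1)]\<close>)
    then show ?case using insert by simp
  qed auto
  from this[of UNIV] show ?thesis using assms(2) by (simp add: mdeg_def)
qed

text \<open>All cutoffs can be taken at \<open>k\<close>, since
  \<open>cps_monom_subst g \<alpha>\<close> has order at least \<open>mdeg \<alpha>\<close>; what
  remains is an exchange of finite sums.\<close>

lemma cps_subst_fps_subst:
  fixes f :: "'n :: finite \<Rightarrow> complex fps" and g :: "'m :: finite \<Rightarrow> 'n cps"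
  assumes f: "\<And>i. fps_nth (f i) 0 = 0" and g: "\<And>i. cps_coeff (g i) 0 = 0"
  shows "cps_subst_fps f (cps_subst g a) = cps_subst_fps (\<lambda>i. cps_subst_fps f (g i)) a"
proof (rule fps_ext)
  fix k
  let ?A = "{\<alpha> :: nat ^ 'm. mdeg \<alpha> \<le> k}" and ?B = "{\<gamma> :: nat ^ 'n. mdeg \<gamma> \<le> k}"
  have "fps_nth (cps_subst_fps f (cps_subst g a)) k
      = (\<Sum>\<gamma>\<in>?B. (\<Sum>\<alpha>\<in>?A. cps_coeff a \<alpha> * cps_coeff (cps_monom_subst g \<alpha>) \<gamma>) *
          fps_nth (cps_monom_subst f \<gamma>) k)"
    unfolding cps_subst_fps_def fps_nth_Abs_fps cps_coeff_subst[of g, OF g]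
    by (intro sum.cong refl arg_cong2[of _ _ _ _ "(*)"] sum.mono_neutral_left)
       (auto simp: cps_coeff_monom_subst_eq_0 g not_le)
  also have "\<dots> = (\<Sum>\<alpha>\<in>?A. cps_coeff a \<alpha> *
      (\<Sum>\<gamma>\<in>?B. cps_coeff (cps_monom_subst g \<alpha>) \<gamma> * fps_nth (cps_monom_subst f \<gamma>) k))"
    unfolding sum_distrib_left sum_distrib_right by (subst sum.swap) (simp add: mult.assoc)
  also have "\<dots> = (\<Sum>\<alpha>\<in>?A. cps_coeff a \<alpha> *
      fps_nth (cps_subst_fps f (cps_monom_subst g \<alpha>)) k)"
    by (simp add: cps_subst_fps_def)
  also have "\<dots> = fps_nth (cps_subst_fps (\<lambda>i. cps_subst_fps f (g i)) a) k"
    unfolding cps_subst_fps_def[of "\<lambda>i. cps_subst_fps f (g i)"]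
    by (simp add: cps_subst_fps_prod cps_subst_fps_power f)
  finally show "fps_nth (cps_subst_fps f (cps_subst g a)) k =
    fps_nth (cps_subst_fps (\<lambda>i. cps_subst_fps f (g i)) a) k" .
qed

lemma cps_subst_fps_compose:
  fixes f :: "'n :: finite \<Rightarrow> complex fps"
  assumes f: "\<And>i. fps_nth (f i) 0 = 0" and t: "fps_nth t 0 = 0"
  shows "cps_subst_fps (\<lambda>i. f i oo t) a = cps_subst_fps f a oo t"
proof (rule fps_ext)
  fix k
  let ?B = "{\<alpha> :: nat ^ 'n. mdeg \<alpha> \<le> k}"
  have "fps_nth (cps_subst_fps f a oo t) k
      = (\<Sum>i=0..k. \<Sum>\<alpha>\<in>?B. cps_coeff a \<alpha> * (fps_nth (cps_monom_subst f \<alpha>) i * fps_nth (t ^ i) k))"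
    unfolding fps_compose_nth
    by (intro sum.cong refl) (simp add: fps_nth_cps_subst_fps[where N = k, OF f] sum_distrib_right mult.assoc)
  also have "\<dots> = (\<Sum>\<alpha>\<in>?B. cps_coeff a \<alpha> * fps_nth (cps_monom_subst f \<alpha> oo t) k)"
    unfolding fps_compose_nth by (subst sum.swap) (simp add: sum_distrib_left)
  also have "\<dots> = fps_nth (cps_subst_fps (\<lambda>i. f i oo t) a) k"
    by (simp add: cps_subst_fps_def fps_compose_prod_distrib fps_compose_power t)
  finally show "fps_nth (cps_subst_fps (\<lambda>i. f i oo t) a) k = fps_nth (cps_subst_fps f a oo t) k" ..
qed

section \<open>Convergence of one-variable series and of substituted series\<close>

lemma conv_radius_add_pos:
  "fps_conv_radius a > 0 \<Longrightarrow> fps_conv_radius b > 0 \<Longrightarrow> fps_conv_radius (a + b :: complex fps) > 0"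
  using fps_conv_radius_add[of a b] by (simp add: min_def split: if_splits)

lemma conv_radius_diff_pos:
  "fps_conv_radius a > 0 \<Longrightarrow> fps_conv_radius b > 0 \<Longrightarrow> fps_conv_radius (a - b :: complex fps) > 0"
  using fps_conv_radius_diff[of a b] by (simp add: min_def split: if_splits)

lemma conv_radius_mult_pos:
  "fps_conv_radius a > 0 \<Longrightarrow> fps_conv_radius b > 0 \<Longrightarrow> fps_conv_radius (a * b :: complex fps) > 0"
  using fps_conv_radius_mult[of a b] by (simp add: min_def split: if_splits)

lemma conv_radius_sum_pos:
  "(\<And>i. i \<in> A \<Longrightarrow> fps_conv_radius (h i :: complex fps) > 0) \<Longrightarrow> fps_conv_radius (sum h A) > 0"
  by (induction A rule: infinite_finite_induct) (auto intro: conv_radius_add_pos)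

text \<open>Removing \<open>fps_X ^ subdegree b\<close> from both series turns \<open>b\<close> into
  a unit with convergent inverse. This supplies the multipliers in the elimination.\<close>

lemma convergent_fps_divide:
  fixes a b :: "complex fps"
  assumes "fps_conv_radius a > 0" "fps_conv_radius b > 0" "b \<noteq> 0" "a \<noteq> 0 \<longrightarrow> subdegree b \<le> subdegree a"
  obtains q where "fps_conv_radius q > 0" "a = q * b"
proof (cases "a = 0")
  case False
  define e where "e = subdegree b"
  define q where "q = fps_shift e a * inverse (fps_shift e b)"
  have b0: "fps_nth (fps_shift e b) 0 \<noteq> 0"
    using assms(3) by (simp add: e_def)
  have "fps_conv_radius q > 0"
    unfolding q_def using assms b0 by (intro conv_radius_mult_pos fps_conv_radius_inverse_pos) auto
  moreover have "b = fps_shift e b * fps_X ^ e"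
    by (simp add: e_def subdegree_decompose)
  moreover have "a = fps_shift e a * fps_X ^ e"
    using assms(4) False by (simp add: e_def fps_shift_times_fps_X_power)
  moreover have "q * (fps_shift e b * fps_X ^ e) = fps_shift e a * fps_X ^ e"
    using inverse_mult_eq_1[OF b0] by (simp add: q_def mult.assoc flip: mult.assoc[of "inverse _"])
  ultimately show ?thesis using that by metis
qed (use that[of 0] in auto)

lemma trunc_norm_1_var:
  fixes a :: "nat ^ 1 \<Rightarrow> complex"
  shows "trunc_norm r N a = (\<Sum>k\<le>N. norm (a (vec k)) * r ^ k)"
  unfolding trunc_norm_def
  by (rule sum.reindex_bij_witness[where i = vec and j = "\<lambda>\<alpha>. \<alpha> $ 1"])
     (auto simp: mdeg_def vec_eq_iff UNIV_1 intro!: arg_cong[where f = a])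

lemma fps_nth_cps_subst_fps_X:
  "fps_nth (cps_subst_fps (\<lambda>_. fps_X) (a :: 1 cps)) k = cps_coeff a (vec k)"
proof -
  have "fps_nth (cps_subst_fps (\<lambda>_. fps_X) a) k
      = (\<Sum>\<alpha>\<in>{vec k}. cps_coeff a \<alpha> * fps_nth (cps_monom_subst (\<lambda>_. fps_X) \<alpha>) k)"
    unfolding cps_subst_fps_def fps_nth_Abs_fps
    by (rule sum.mono_neutral_right[OF finite_mdeg_le])
       (auto simp: UNIV_1 mdeg_def vec_eq_iff split: if_splits)
  then show ?thesis by (simp add: UNIV_1)
qed

text \<open>Intended for convergent \<open>h\<close>. Convergence of composites is then inherited
  from the type \<open>1 cps\<close>.\<close>

definition cps_of_fps :: "complex fps \<Rightarrow> 1 cps" where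
  "cps_of_fps h = Abs_cps (\<lambda>\<alpha>. fps_nth h (\<alpha> $ 1))"

lemma cps_coeff_of_fps:
  assumes "fps_conv_radius h > 0"
  shows "cps_coeff (cps_of_fps h) \<alpha> = fps_nth h (\<alpha> $ 1)"
proof -
  obtain r where r: "0 < ereal r" "ereal r < fps_conv_radius h"
    using ereal_dense2[OF assms] by auto
  have s: "summable (\<lambda>k. norm (fps_nth h k * of_real r ^ k))"
    by (rule norm_summable_fps) (use r in auto)
  have "trunc_norm r N (\<lambda>\<alpha> :: nat ^ 1. fps_nth h (\<alpha> $ 1)) \<le> (\<Sum>k. norm (fps_nth h k * of_real r ^ k))" for N
    unfolding trunc_norm_1_var using r sum_le_suminf[OF s, of "{..N}"]
    by (simp add: norm_mult norm_power)
  then have "conv_coeffs (\<lambda>\<alpha> :: nat ^ 1. fps_nth h (\<alpha> $ 1))"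
    unfolding conv_coeffs_iff using r by auto
  then show ?thesis unfolding cps_of_fps_def by (simp add: Abs_cps_inverse)
qed

lemma cps_subst_fps_X_of_fps:
  "fps_conv_radius h > 0 \<Longrightarrow> cps_subst_fps (\<lambda>_. fps_X) (cps_of_fps h) = h"
  by (rule fps_ext) (simp add: fps_nth_cps_subst_fps_X cps_coeff_of_fps)

lemma conv_radius_cps_subst_fps_X:
  "fps_conv_radius (cps_subst_fps (\<lambda>_. fps_X) (a :: 1 cps)) > 0"
proof -
  obtain r C where r: "r > 0" and C: "\<And>N. trunc_norm r N (cps_coeff a) \<le> C"
    using conv_coeffs_cps_coeff[of a] unfolding conv_coeffs_iff by blast
  have "summable (\<lambda>k. norm (cps_coeff a (vec k)) * r ^ k)"
  proof (rule summableI_nonneg_bounded[where x = C])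
    fix n
    have "(\<Sum>k<n. norm (cps_coeff a (vec k)) * r ^ k) \<le> trunc_norm r n (cps_coeff a)"
      unfolding trunc_norm_1_var using r by (intro sum_mono2) auto
    then show "(\<Sum>k<n. norm (cps_coeff a (vec k)) * r ^ k) \<le> C" using C by (rule order_trans)
  qed (use r in auto)
  then have "summable (\<lambda>k. norm (cps_coeff a (vec k) * of_real r ^ k))"
    using r by (simp add: norm_mult norm_power)
  then have "summable (\<lambda>k. cps_coeff a (vec k) * of_real r ^ k)"
    by (rule summable_norm_cancel)
  then have "conv_radius (\<lambda>k. cps_coeff a (vec k)) \<ge> norm (of_real r :: complex)"
    by (rule conv_radius_geI)
  then show ?thesis
    using r by (auto simp: fps_conv_radius_def fps_nth_cps_subst_fps_X intro: less_le_trans[rotated])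
qed

text \<open>Replacing each \<open>f i\<close> by its counterpart in \<open>1 cps\<close> makes the
  result an element of \<open>1 cps\<close>, which converges by construction.\<close>

lemma conv_radius_cps_subst_fps:
  fixes f :: "'n :: finite \<Rightarrow> complex fps"
  assumes "\<And>i. fps_nth (f i) 0 = 0" "\<And>i. fps_conv_radius (f i) > 0"
  shows "fps_conv_radius (cps_subst_fps f a) > 0"
proof -
  have "cps_subst_fps (\<lambda>_. fps_X) (cps_subst (\<lambda>i. cps_of_fps (f i)) a) = cps_subst_fps f a"
    by (subst cps_subst_fps_subst)
       (simp_all add: assms cps_coeff_of_fps cps_subst_fps_X_of_fps)
  then show ?thesis using conv_radius_cps_subst_fps_X by metis
qed

text \<open>These are the scalars C{x_i}, over which the series in s are free once x_i takes the
  value s^m.\<close>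

definition cps_embed :: "'n :: finite \<Rightarrow> complex fps \<Rightarrow> 'n cps" where
  "cps_embed i h = cps_subst (\<lambda>_. cps_var i) (cps_of_fps h)"

lemma cps_coeff_var_0 [simp]: "cps_coeff (cps_var i) 0 = 0"
  by (auto simp: cps_var.rep_eq vec_eq_iff axis_def)

lemma cps_subst_fps_embed:
  assumes "\<And>i. fps_nth (f i) 0 = 0" "fps_conv_radius h > 0"
  shows "cps_subst_fps f (cps_embed i h) = h oo f i"
proof -
  have "cps_subst_fps f (cps_embed i h) = cps_subst_fps (\<lambda>_. fps_X oo f i) (cps_of_fps h)"
    unfolding cps_embed_def using assms
    by (subst cps_subst_fps_subst) (simp_all add: cps_subst_fps_var)
  also have "\<dots> = h oo f i"
    by (subst cps_subst_fps_compose) (simp_all add: assms cps_subst_fps_X_of_fps)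
  finally show ?thesis .
qed

section \<open>The local ring of convergent power series\<close>

lemma cps_coeff_const_mult: "cps_coeff (cps_const c * a) \<alpha> = c * cps_coeff a \<alpha>"
  by (simp add: cps_coeff_times cps_const.rep_eq conv_mult_const)

lemma cps_coeff_mult_0: "cps_coeff (a * b) 0 = cps_coeff a 0 * cps_coeff b 0"
  by (simp add: cps_coeff_times conv_mult_def splits_0)

lemma cps_coeff_sum: "cps_coeff (sum h A) \<alpha> = (\<Sum>i\<in>A. cps_coeff (h i) \<alpha>)"
  by (induction A rule: infinite_finite_induct) (auto simp: zero_cps.rep_eq plus_cps.rep_eq)

lemma cps_coeff_mult_cong:
  fixes a :: "'n :: finite cps"
  assumes "\<And>\<alpha>. mdeg \<alpha> \<le> N \<Longrightarrow> cps_coeff v \<alpha> = cps_coeff w \<alpha>" "mdeg \<gamma> \<le> N"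
  shows "cps_coeff (a * v) \<gamma> = cps_coeff (a * w) \<gamma>"
proof -
  have "cps_coeff (a * (v - w)) \<gamma> = 0"
    by (rule cps_coeff_mult_eq_0[of 0 _ "Suc N"]) (use assms in \<open>auto simp: minus_cps.rep_eq\<close>)
  then show ?thesis by (simp add: minus_cps.rep_eq right_diff_distrib)
qed

text \<open>The inverse is the geometric series substituted at \<open>u\<close>, so its convergence
  comes with \<open>cps_subst\<close>; the identity is checked in each degree on a partial
  sum.\<close>

lemma cps_one_minus_unit:
  fixes u :: "'n :: finite cps"
  assumes "cps_coeff u 0 = 0"
  shows "\<exists>v. (1 - u) * v = 1"
proof -
  define G :: "complex fps" where "G = inverse (1 - fps_X)"
  have G: "fps_conv_radius G > 0" "\<And>k. fps_nth G k = 1"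
  proof -
    have "inverse (1 - fps_X :: complex fps) = Abs_fps (\<lambda>_. 1)"
      by (rule fps_inverse_unique) (simp add: fps_eq_iff left_diff_distrib fps_X_mult_nth)
    then show "fps_nth G k = 1" for k by (simp add: G_def)
    show "fps_conv_radius G > 0"
      unfolding G_def by (intro fps_conv_radius_inverse_pos conv_radius_diff_pos) auto
  qed
  define v where "v = cps_subst (\<lambda>_. u) (cps_of_fps G)"
  have v: "cps_coeff v \<gamma> = (\<Sum>k\<le>N. cps_coeff (u ^ k) \<gamma>)" if "mdeg \<gamma> \<le> N" for \<gamma> N
  proof -
    have "cps_coeff v \<gamma> = (\<Sum>\<alpha> | mdeg (\<alpha> :: nat ^ 1) \<le> mdeg \<gamma>. cps_coeff (u ^ (\<alpha> $ 1)) \<gamma>)"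
      unfolding v_def by (subst cps_coeff_subst) (simp_all add: assms G cps_coeff_of_fps UNIV_1)
    also have "\<dots> = (\<Sum>k\<le>mdeg \<gamma>. cps_coeff (u ^ k) \<gamma>)"
      by (rule sum.reindex_bij_witness[where i = vec and j = "\<lambda>\<alpha>. \<alpha> $ 1"])
         (auto simp: mdeg_def vec_eq_iff UNIV_1)
    also have "\<dots> = (\<Sum>k\<le>N. cps_coeff (u ^ k) \<gamma>)"
      using that by (intro sum.mono_neutral_left) (auto simp: cps_coeff_power_eq_0 assms)
    finally show ?thesis .
  qed
  have "cps_coeff ((1 - u) * v) \<gamma> = cps_coeff 1 \<gamma>" for \<gamma>
  proof -
    let ?N = "mdeg \<gamma>"
    have "cps_coeff ((1 - u) * v) \<gamma> = cps_coeff ((1 - u) * (\<Sum>k\<le>?N. u ^ k)) \<gamma>"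
      by (rule cps_coeff_mult_cong[of ?N]) (simp_all add: v cps_coeff_sum)
    also have "\<dots> = cps_coeff 1 \<gamma> - cps_coeff (u ^ Suc ?N) \<gamma>"
      by (subst sum_gp_basic) (simp add: minus_cps.rep_eq)
    also have "cps_coeff (u ^ Suc ?N) \<gamma> = 0"
      using assms by (intro cps_coeff_power_eq_0) auto
    finally show ?thesis by simp
  qed
  then show ?thesis by (auto intro: cps_eqI)
qed

lemma cps_unit:
  fixes a :: "'n :: finite cps"
  assumes "cps_coeff a 0 \<noteq> 0"
  shows "\<exists>b. a * b = 1"
proof -
  define c where "c = cps_const (1 / cps_coeff a 0) * a"
  have "cps_coeff (1 - c) 0 = 0"
    using assms by (simp add: c_def minus_cps.rep_eq one_cps.rep_eq cps_coeff_const_mult)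
  then obtain v where "(1 - (1 - c)) * v = 1" using cps_one_minus_unit by blast
  then have "a * (cps_const (1 / cps_coeff a 0) * v) = 1"
    by (simp add: c_def mult_ac)
  then show ?thesis by blast
qed

lemma cps_coeff_var_mult:
  "cps_coeff (cps_var i * b) \<gamma> = (if \<gamma> $ i = 0 then 0 else cps_coeff b (\<gamma> - axis i 1))"
proof -
  have "cps_coeff (cps_var i * b) \<gamma> =
      (\<Sum>p\<in>(if \<gamma> $ i = 0 then {} else {(axis i 1, \<gamma> - axis i 1)}). cps_coeff (cps_var i) (fst p) * cps_coeff b (snd p))"
    unfolding cps_coeff_times conv_mult_def case_prod_unfold
  proof (rule sum.mono_neutral_right)
    show "finite {p. fst p + snd p = \<gamma>}"
      using finite_splits[of \<gamma>] by (simp add: case_prod_unfold)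
    show "(if \<gamma> $ i = 0 then {} else {(axis i 1, \<gamma> - axis i 1)}) \<subseteq> {p. fst p + snd p = \<gamma>}"
      by (auto simp: vec_eq_iff axis_def)
    show "\<forall>p\<in>{p. fst p + snd p = \<gamma>} - (if \<gamma> $ i = 0 then {} else {(axis i 1, \<gamma> - axis i 1)}).
        cps_coeff (cps_var i) (fst p) * cps_coeff b (snd p) = 0"
      by (auto simp: cps_var.rep_eq axis_def split: if_splits)
  qed
  then show ?thesis by (simp add: cps_var.rep_eq)
qed

lemma cps_var_mult_cancel: "cps_var i * a = cps_var i * b \<Longrightarrow> a = b"
proof (rule cps_eqI)
  fix \<alpha> assume "cps_var i * a = cps_var i * b"
  then have "cps_coeff (cps_var i * a) (\<alpha> + axis i 1) = cps_coeff (cps_var i * b) (\<alpha> + axis i 1)"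
    by simp
  then show "cps_coeff a \<alpha> = cps_coeff b \<alpha>"
    by (simp add: cps_coeff_var_mult axis_def)
qed

text \<open>The quotient has the shifted coefficients. The shift is injective, so the weighted sum
  of the quotient is, up to a factor \<open>r\<close>, part of the one for \<open>a\<close>.\<close>

lemma cps_var_dvd:
  fixes a :: "'n :: finite cps"
  assumes "\<And>\<alpha>. \<alpha> $ i = 0 \<Longrightarrow> cps_coeff a \<alpha> = 0"
  shows "\<exists>b. a = cps_var i * b"
proof -
  let ?h = "\<lambda>\<alpha> :: nat ^ 'n. \<alpha> + axis i 1"
  obtain r where r: "r > 0" and s: "(\<lambda>\<alpha>. norm (cps_coeff a \<alpha>) * r ^ mdeg \<alpha>) summable_on UNIV"
    using conv_coeffs_cps_coeff[of a] unfolding conv_coeffs_def by blast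
  have "inj ?h" by (auto simp: inj_def)
  have "(\<lambda>\<alpha>. norm (cps_coeff a \<alpha>) * r ^ mdeg \<alpha>) summable_on range ?h"
    by (rule summable_on_subset_banach[OF s]) auto
  then have "(\<lambda>\<alpha>. (norm (cps_coeff a (?h \<alpha>)) * r ^ mdeg \<alpha>) * r) summable_on UNIV"
    unfolding summable_on_reindex[OF \<open>inj ?h\<close>] by (simp add: o_def mdeg_add mult_ac)
  then have "(\<lambda>\<alpha>. norm (cps_coeff a (?h \<alpha>)) * r ^ mdeg \<alpha> * r * (1 / r)) summable_on UNIV"
    by (rule summable_on_cmult_left)
  then have "conv_coeffs (\<lambda>\<alpha>. cps_coeff a (?h \<alpha>))"
    unfolding conv_coeffs_def using r by (intro exI[of _ r]) auto
  then have b: "cps_coeff (Abs_cps (\<lambda>\<alpha>. cps_coeff a (?h \<alpha>))) \<alpha> = cps_coeff a (?h \<alpha>)" for \<alpha>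
    by (simp add: Abs_cps_inverse)
  have "a = cps_var i * Abs_cps (\<lambda>\<alpha>. cps_coeff a (?h \<alpha>))"
  proof (rule cps_eqI)
    fix \<gamma> :: "nat ^ 'n"
    have "\<gamma> - axis i 1 + axis i 1 = \<gamma>" if "\<gamma> $ i \<noteq> 0"
      using that by (simp add: vec_eq_iff axis_def)
    then show "cps_coeff a \<gamma> = cps_coeff (cps_var i * Abs_cps (\<lambda>\<alpha>. cps_coeff a (?h \<alpha>))) \<gamma>"
      using assms by (auto simp: cps_coeff_var_mult b[unfolded One_nat_def])
  qed
  then show ?thesis by blast
qed

section \<open>Reduction of plane series modulo a variable\<close>

lemma all_2_iff: "i \<noteq> j \<Longrightarrow> (\<forall>k :: 2. P k) \<longleftrightarrow> P i \<and> P j"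
  by (metis exhaust_2)

text \<open>The residue class modulo \<open>cps_var i\<close>, as a series in the other variable.
  There divisibility is a comparison of orders.\<close>

definition restrict_axis :: "2 \<Rightarrow> 2 cps \<Rightarrow> complex fps" where
  "restrict_axis i = cps_subst_fps (\<lambda>k. if k = i then 0 else fps_X)"

lemma UNIV_2_eq: "i \<noteq> j \<Longrightarrow> (UNIV :: 2 set) = {i, j}"
  using exhaust_2 by (auto intro: UNIV_eq_I) metis

lemma fps_nth_restrict_axis:
  assumes "i \<noteq> j"
  shows "fps_nth (restrict_axis i a) k = cps_coeff a (axis j k)"
proof -
  have "fps_nth (restrict_axis i a) k = (\<Sum>\<alpha>\<in>{axis j k}. cps_coeff a \<alpha> *
      fps_nth (cps_monom_subst (\<lambda>k. if k = i then 0 else fps_X) \<alpha>) k)"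
    unfolding cps_subst_fps_def fps_nth_Abs_fps restrict_axis_def
  proof (rule sum.mono_neutral_right)
    show "\<forall>\<alpha>\<in>{\<alpha>. mdeg \<alpha> \<le> k} - {axis j k}. cps_coeff a \<alpha> *
        fps_nth (cps_monom_subst (\<lambda>k. if k = i then 0 else fps_X) \<alpha>) k = 0"
    proof
      fix \<alpha> :: "nat ^ 2" assume "\<alpha> \<in> {\<alpha>. mdeg \<alpha> \<le> k} - {axis j k}"
      then have "\<alpha> $ i \<noteq> 0 \<or> \<alpha> $ j \<noteq> k"
        using assms by (auto simp: vec_eq_iff axis_def all_2_iff[OF assms])
      then show "cps_coeff a \<alpha> * fps_nth (cps_monom_subst (\<lambda>k. if k = i then 0 else fps_X) \<alpha>) k = 0"
        using assms by (auto simp: UNIV_2_eq[OF assms] power_0_left)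
    qed
  qed auto
  then show ?thesis using assms by (simp add: UNIV_2_eq[OF assms] axis_def)
qed

lemma restrict_axis_eq_0_iff: "restrict_axis i a = 0 \<longleftrightarrow> (\<exists>b. a = cps_var i * b)"
proof
  assume 0: "restrict_axis i a = 0"
  obtain j where ij: "i \<noteq> j" using exhaust_2 by (metis zero_neq_one)
  show "\<exists>b. a = cps_var i * b"
  proof (rule cps_var_dvd)
    fix \<alpha> :: "nat ^ 2" assume "\<alpha> $ i = 0"
    then have "\<alpha> = axis j (\<alpha> $ j)"
      using ij by (auto simp: vec_eq_iff axis_def all_2_iff[OF ij])
    then show "cps_coeff a \<alpha> = 0"
      using fps_nth_restrict_axis[OF ij, of a "\<alpha> $ j"] 0 by simp
  qed
qed (auto simp: restrict_axis_def cps_subst_fps_mult cps_subst_fps_var)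

lemma restrict_axis_mult: "restrict_axis i (a * b) = restrict_axis i a * restrict_axis i b"
  by (simp add: restrict_axis_def cps_subst_fps_mult)

text \<open>Each division by \<open>cps_var i\<close> lowers the exponent at \<open>i\<close> of a
  fixed nonzero coefficient, so it can be repeated only finitely often.\<close>

lemma cps_var_power_factor:
  fixes a :: "2 cps"
  assumes "a \<noteq> 0"
  obtains n b where "a = cps_var i ^ n * b" "restrict_axis i b \<noteq> 0"
proof -
  obtain \<alpha> where "cps_coeff a \<alpha> \<noteq> 0"
    using assms cps_eqI[of a 0] by (auto simp: zero_cps.rep_eq)
  moreover have "\<exists>n b. a = cps_var i ^ n * b \<and> restrict_axis i b \<noteq> 0"
    if "cps_coeff a \<alpha> \<noteq> 0" for a \<alpha>
    using that
  proof (induction "\<alpha> $ i" arbitrary: a \<alpha> rule: less_induct)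
    case less
    show ?case
    proof (cases "restrict_axis i a = 0")
      case True
      then obtain b where b: "a = cps_var i * b" by (auto simp: restrict_axis_eq_0_iff)
      with less.prems have "\<alpha> $ i \<noteq> 0" "cps_coeff b (\<alpha> - axis i 1) \<noteq> 0"
        by (auto simp: cps_coeff_var_mult split: if_splits)
      then obtain n c where "b = cps_var i ^ n * c" "restrict_axis i c \<noteq> 0"
        using less.hyps[of "\<alpha> - axis i 1" b] by (auto simp: axis_def)
      then show ?thesis using b by (intro exI[of _ "Suc n"] exI[of _ c]) (auto simp: mult_ac)
    next
      case False
      then show ?thesis by (intro exI[of _ 0] exI[of _ a]) simp
    qed
  qed
  ultimately show ?thesis using that by blast
qed

text \<open>After removal of powers of \<open>cps_var 0\<close> both factors have nonzero
  restriction to the axis, where series in one variable form a domain.\<close>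

lemma cps2_mult_eq_0:
  fixes a b :: "2 cps"
  assumes "a * b = 0"
  shows "a = 0 \<or> b = 0"
proof (rule ccontr)
  assume *: "\<not> (a = 0 \<or> b = 0)"
  obtain m a' where a: "a = cps_var 0 ^ m * a'" "restrict_axis 0 a' \<noteq> 0"
    using * cps_var_power_factor[of a 0] by metis
  obtain n b' where b: "b = cps_var 0 ^ n * b'" "restrict_axis 0 b' \<noteq> 0"
    using * cps_var_power_factor[of b 0] by metis
  have "cps_var (0 :: 2) ^ k * c = 0 \<Longrightarrow> c = 0" for k c
  proof (induction k)
    case (Suc k)
    then have "cps_var 0 * (cps_var 0 ^ k * c) = cps_var 0 * 0" by (simp add: mult_ac)
    then show ?case using Suc.IH cps_var_mult_cancel by blast
  qed simp
  moreover have "cps_var 0 ^ (m + n) * (a' * b') = 0"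
    using assms a b by (simp add: power_add mult_ac)
  ultimately have "a' * b' = 0" by blast
  then have "restrict_axis 0 a' * restrict_axis 0 b' = 0"
    by (simp flip: restrict_axis_mult) (simp add: restrict_axis_def)
  with a b show False by simp
qed

lemma xy_ideal_eq: "xy_ideal = {a. cps_coeff a 0 = 0}"
proof -
  interpret cring "cps_ring :: 2 cps ring" by (rule cring_cps_ring)
  have inv: "\<ominus>\<^bsub>cps_ring\<^esub> a = - a" for a :: "2 cps"
    by (rule minus_equality) (auto simp: cps_ring_def)
  have "ideal {a. cps_coeff a 0 = 0} (cps_ring :: 2 cps ring)"
  proof (rule idealI)
    show "ring (cps_ring :: 2 cps ring)" ..
    show "subgroup {a. cps_coeff a 0 = 0} (add_monoid (cps_ring :: 2 cps ring))"
    proof (rule add.subgroupI)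
      show "{a :: 2 cps. cps_coeff a 0 = 0} \<noteq> {}" by (auto intro!: exI[of _ 0] simp: zero_cps.rep_eq)
      fix a b :: "2 cps" assume "a \<in> {a. cps_coeff a 0 = 0}" "b \<in> {a. cps_coeff a 0 = 0}"
      then show "a \<oplus>\<^bsub>cps_ring\<^esub> b \<in> {a. cps_coeff a 0 = 0}"
        by (simp add: cps_ring_def plus_cps.rep_eq)
    next
      fix a :: "2 cps" assume "a \<in> {a. cps_coeff a 0 = 0}"
      then show "\<ominus>\<^bsub>cps_ring\<^esub> a \<in> {a. cps_coeff a 0 = 0}"
        by (simp add: inv uminus_cps.rep_eq)
    qed (simp add: cps_ring_def)
  qed (auto simp: cps_ring_def cps_coeff_mult_0)
  then have "xy_ideal \<subseteq> {a. cps_coeff a 0 = 0}"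
    unfolding xy_ideal_def by (rule genideal_minimal) auto
  moreover have "a \<in> xy_ideal" if "cps_coeff a 0 = 0" for a
  proof -
    have I: "ideal xy_ideal (cps_ring :: 2 cps ring)"
      unfolding xy_ideal_def by (rule genideal_ideal) (auto simp: cps_ring_def)
    have var: "cps_var i \<in> xy_ideal" for i
      unfolding xy_ideal_def using genideal_self[of "range cps_var"] by (auto simp: cps_ring_def)
    \<comment> \<open>\<open>h\<close> is the part of \<open>a\<close> free of the variable with
      index 0. Its constant term vanishes, so it is a multiple of the other variable; the rest of
      \<open>a\<close> vanishes on the axis and is a multiple of \<open>cps_var 0\<close>.\<close>
    define h where "h = restrict_axis 0 a"
    have h0: "fps_nth h 0 = 0"
      using that fps_nth_restrict_axis[of 0 1 a 0] by (simp add: h_def axis_def zero_vec_def)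
    have hc: "fps_conv_radius h > 0"
      unfolding h_def restrict_axis_def by (rule conv_radius_cps_subst_fps) auto
    define c :: "2 cps" where "c = cps_var 1 * cps_embed 1 (fps_shift 1 h)"
    have "restrict_axis 0 c = fps_X * fps_shift 1 h"
      unfolding c_def restrict_axis_def using hc
      by (simp add: cps_subst_fps_mult cps_subst_fps_var cps_subst_fps_embed)
    also have "\<dots> = h" using h0 by (intro fps_ext) (auto simp: fps_X_mult_nth)
    finally have "restrict_axis 0 (a - c) = 0"
      by (simp add: h_def restrict_axis_def cps_subst_fps_diff)
    then obtain e where "a - c = cps_var 0 * e" by (auto simp: restrict_axis_eq_0_iff)
    then have "a = cps_var 0 * e + cps_var 1 * cps_embed 1 (fps_shift 1 h)"
      by (simp add: c_def algebra_simps)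
    moreover have "cps_var i * b \<in> xy_ideal" for i b
      using ideal.I_r_closed[OF I var] by (simp add: cps_ring_def)
    ultimately show ?thesis
      using ideal.Icarr additive_subgroup.a_closed[OF ideal.axioms(1)[OF I]] by (simp add: cps_ring_def)
  qed
  ultimately show ?thesis by auto
qed

section \<open>Parametrizations and generic projections\<close>

lemma conv_radius_compose_pos:
  fixes F G :: "complex fps"
  assumes "fps_conv_radius F > 0" "fps_conv_radius G > 0" "fps_nth G 0 = 0"
  shows "fps_conv_radius (F oo G) > 0"
  using has_fps_expansion_compose[OF eval_fps_has_fps_expansion[OF assms(1)]
      eval_fps_has_fps_expansion[OF assms(2)] assms(3)]
  by (simp add: has_fps_expansion_def)

lemma eventually_eval_fps_compose:
  fixes F G :: "complex fps"
  assumes "fps_conv_radius F > 0" "fps_conv_radius G > 0" "fps_nth G 0 = 0"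
  shows "eventually (\<lambda>z. eval_fps (F oo G) z = eval_fps F (eval_fps G z)) (nhds 0)"
  using has_fps_expansion_compose[OF eval_fps_has_fps_expansion[OF assms(1)]
      eval_fps_has_fps_expansion[OF assms(2)] assms(3)]
  by (simp add: has_fps_expansion_def)

definition proj_param :: "complex ^ ('n :: finite) ^ 2 \<Rightarrow> ('n \<Rightarrow> complex fps) \<Rightarrow> 2 \<Rightarrow> complex fps" where
  "proj_param L f k = (\<Sum>j\<in>UNIV. fps_const (L $ k $ j) * f j)"

lemma proj_param_nth_0: "(\<And>i. fps_nth (f i) 0 = 0) \<Longrightarrow> fps_nth (proj_param L f k) 0 = 0"
  by (simp add: proj_param_def fps_sum_nth)

lemma conv_radius_proj_param:
  "(\<And>i. fps_conv_radius (f i) > 0) \<Longrightarrow> fps_conv_radius (proj_param L f k) > 0"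
  unfolding proj_param_def by (intro conv_radius_sum_pos conv_radius_mult_pos) auto

lemma proj_param_compose:
  "fps_nth t 0 = 0 \<Longrightarrow> proj_param L (\<lambda>i. f i oo t) k = proj_param L f k oo t"
  by (simp add: proj_param_def fps_compose_sum_distrib fps_compose_mult_distrib)

text \<open>Evaluation on the curve after pulling back is evaluation on the projected branch, so
  \<open>projection_germ L X\<close> becomes the kernel of a substitution.\<close>

lemma cps_subst_fps_pullback:
  assumes "\<And>i. fps_nth (f i) 0 = 0"
  shows "cps_subst_fps f (pullback L a) = cps_subst_fps (proj_param L f) a"
proof -
  have "cps_subst_fps f (\<Sum>j\<in>UNIV. cps_const (L $ k $ j) * cps_var j) = proj_param L f k" for k
    by (simp add: proj_param_def cps_subst_fps_sum cps_subst_fps_mult cps_subst_fps_const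
        cps_subst_fps_var assms)
  moreover have "cps_coeff (\<Sum>j\<in>UNIV. cps_const (L $ k $ j) * cps_var j) 0 = 0" for k
    by (simp add: cps_coeff_sum cps_coeff_const_mult)
  ultimately show ?thesis
    unfolding pullback_def by (subst cps_subst_fps_subst) (simp_all add: assms)
qed

lemma eval_fps_compose_linear:
  fixes f :: "complex fps"
  shows "eval_fps (f oo (fps_const c * fps_X)) u = eval_fps f (c * u)"
  unfolding eval_fps_def fps_compose_linear by (simp add: power_mult_distrib mult_ac)

text \<open>\<open>generic_forms\<close> demands that 0 lie in the cone, and membership in the cone
  carries a parametrization with it, so no normalization theorem has to be invoked.\<close>

lemma generic_forms_parametrized:
  assumes "L \<in> generic_forms X"
  obtains f where "parametrizes f X"
proof -
  have "0 \<in> whitney_C5 X" using assms by (auto simp: generic_forms_def)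
  then show ?thesis using that by (auto simp: whitney_C5_def)
qed

text \<open>Otherwise the leading coefficient vector of \<open>f(u) - f(c u)\<close>, which is a limit of secants,
  would lie both in the cone and in the kernel of \<open>L\<close>.\<close>

lemma generic_projection_asymmetric:
  fixes f :: "'n :: finite \<Rightarrow> complex fps"
  assumes f: "parametrizes f X" and L: "L \<in> generic_forms X" and c: "c \<noteq> 1" "norm c \<le> 1"
  shows "\<exists>k. proj_param L f k oo (fps_const c * fps_X) \<noteq> proj_param L f k"
proof (rule ccontr)
  assume *: "\<nexists>k. proj_param L f k oo (fps_const c * fps_X) \<noteq> proj_param L f k"
  define \<delta> where "\<delta> j = f j - (f j oo (fps_const c * fps_X))" for j
  have fc: "fps_conv_radius (f j) > 0" "fps_nth (f j) 0 = 0" for j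
    using f by (auto simp: parametrizes_def)
  have \<delta>c: "fps_conv_radius (\<delta> j) > 0" for j
    unfolding \<delta>_def by (intro conv_radius_diff_pos conv_radius_compose_pos conv_radius_mult_pos fc) auto
  have fcc: "fps_conv_radius (f j oo (fps_const c * fps_X)) > 0" for j
    by (intro conv_radius_compose_pos conv_radius_mult_pos fc) auto
  have eval_\<delta>: "eventually (\<lambda>u. eval_fps (\<delta> j) u = eval_fps (f j) u - eval_fps (f j) (c * u)) (nhds 0)" for j
  proof -
    have "(\<lambda>u. eval_fps (f j) u - eval_fps (f j oo (fps_const c * fps_X)) u) has_fps_expansion \<delta> j"
      unfolding \<delta>_def by (intro has_fps_expansion_diff eval_fps_has_fps_expansion fc fcc)
    then show ?thesis by (simp add: has_fps_expansion_def eval_fps_compose_linear)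
  qed
  \<comment> \<open>Otherwise \<open>u\<close> and \<open>c * u\<close>, both close to 0 because
    \<open>norm c \<le> 1\<close>, would have the same image, against the injectivity of the
    parametrization.\<close>
  have "\<exists>j. \<delta> j \<noteq> 0"
  proof (rule ccontr)
    assume "\<nexists>j. \<delta> j \<noteq> 0"
    then have "eventually (\<lambda>u. eval_fps (f j) u = eval_fps (f j) (c * u)) (nhds 0)" for j
      using eval_\<delta>[of j] by simp
    then have "eventually (\<lambda>u. \<forall>j. eval_fps (f j) u = eval_fps (f j) (c * u)) (nhds 0)"
      by (intro eventually_all_finite) auto
    then obtain d where d: "d > 0" "\<And>u j. norm u < d \<Longrightarrow> eval_fps (f j) u = eval_fps (f j) (c * u)"
      by (auto simp: eventually_nhds_metric dist_norm)
    obtain \<epsilon> where \<epsilon>: "\<epsilon> > 0" "inj_on (\<lambda>t. \<chi> i. eval_fps (f i) t) (ball 0 \<epsilon>)"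
      using f by (auto simp: parametrizes_def)
    define u :: complex where "u = of_real (min d \<epsilon> / 2)"
    have u: "norm u < d" "norm u < \<epsilon>" "u \<noteq> 0" using d \<epsilon> by (auto simp: u_def)
    have cu: "norm (c * u) < \<epsilon>"
      using c(2) u(2) mult_right_mono[of "norm c" 1 "norm u"] by (simp add: norm_mult)
    have "u = c * u"
      by (rule inj_onD[OF \<epsilon>(2)]) (use u cu d(2) in auto)
    then show False using c u by simp
  qed
  then have ex: "\<exists>n j. fps_nth (\<delta> j) n \<noteq> 0" by (auto simp: fps_eq_iff)
  \<comment> \<open>\<open>e\<close> is the least order among the coordinates of the secant between
    the parameters \<open>u\<close> and \<open>c * u\<close>; scaling by \<open>1 / u ^ e\<close>
    makes the secant converge to the nonzero vector \<open>w\<close>.\<close>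
  define e where "e = (LEAST n. \<exists>j. fps_nth (\<delta> j) n \<noteq> 0)"
  have e: "\<exists>j. fps_nth (\<delta> j) e \<noteq> 0" unfolding e_def by (rule LeastI_ex[OF ex])
  have below: "fps_nth (\<delta> j) n = 0" if "n < e" for n j
    using not_less_Least[of n] that unfolding e_def by blast
  define w :: "complex ^ 'n" where "w = (\<chi> j. fps_nth (\<delta> j) e)"
  have "w \<in> whitney_C5 X"
    unfolding whitney_C5_def mem_Collect_eq
  proof (intro exI conjI)
    show "parametrizes f X" by fact
    show "fps_conv_radius (fps_X :: complex fps) > 0" "fps_nth (fps_X :: complex fps) 0 = 0" by auto
    show "fps_conv_radius (fps_const c * fps_X) > 0" "fps_nth (fps_const c * fps_X) 0 = 0"
      by (auto intro: conv_radius_mult_pos)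
    have ev: "eval_fps fps_X u = u" "eval_fps (fps_const c * fps_X) u = c * u" for u :: complex
      by (simp_all add: eval_fps_mult)
    have "((\<lambda>u. (1 / u ^ e) * (eval_fps (f j) u - eval_fps (f j) (c * u))) \<longlongrightarrow> fps_nth (\<delta> j) e) (at 0)" for j
    proof -
      define s where "s = fps_shift e (\<delta> j)"
      have sc: "fps_conv_radius s > 0" by (simp add: s_def \<delta>c)
      have \<delta>s: "\<delta> j = s * fps_X ^ e"
        using below by (intro fps_ext) (auto simp: s_def fps_X_power_mult_right_nth)
      have "(\<lambda>u. eval_fps s u * u ^ e) has_fps_expansion \<delta> j"
        unfolding \<delta>s by (intro has_fps_expansion_mult eval_fps_has_fps_expansion sc has_fps_expansion_fps_X_power)
      then have "eventually (\<lambda>u. eval_fps (\<delta> j) u = eval_fps s u * u ^ e) (nhds 0)"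
        by (simp add: has_fps_expansion_def)
      with eval_\<delta>[of j] have "eventually (\<lambda>u. eval_fps (f j) u - eval_fps (f j) (c * u) = eval_fps s u * u ^ e) (nhds 0)"
        by eventually_elim auto
      then have "eventually (\<lambda>u. eval_fps s u = (1 / u ^ e) * (eval_fps (f j) u - eval_fps (f j) (c * u))) (at 0)"
        unfolding eventually_at_filter by eventually_elim auto
      moreover have "(eval_fps s \<longlongrightarrow> fps_nth (\<delta> j) e) (at 0)"
        using has_fps_expansion_imp_continuous[OF eval_fps_has_fps_expansion[OF sc], of UNIV]
        by (simp add: continuous_within eval_fps_at_0 s_def)
      ultimately show ?thesis by (rule Lim_transform_eventually[rotated])
    qed
    then show "((\<lambda>u. \<chi> i. (1 / u ^ e) * (eval_fps (f i) (eval_fps fps_X u) -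
        eval_fps (f i) (eval_fps (fps_const c * fps_X) u))) \<longlongrightarrow> w) (at 0)"
      unfolding w_def ev by (intro vec_tendstoI) simp
  qed
  \<comment> \<open>\<open>L *v w\<close> collects the coefficients of degree \<open>e\<close> of
    the projected differences, which vanish by the assumed symmetry.\<close>
  moreover have "L *v w = 0"
  proof -
    have "(L *v w) $ k = fps_nth (proj_param L \<delta> k) e" for k
      by (simp add: matrix_vector_mult_def w_def proj_param_def fps_sum_nth)
    moreover have "proj_param L \<delta> k = 0" for k
      using * by (simp add: proj_param_def \<delta>_def right_diff_distrib sum_subtractf
          fps_compose_sum_distrib fps_compose_mult_distrib)
    ultimately show ?thesis by (simp add: vec_eq_iff)
  qed
  ultimately have "w = 0" using L by (auto simp: generic_forms_def)
  with e show False by (auto simp: w_def vec_eq_iff)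
qed

text \<open>An \<open>m\<close>-th root of \<open>g\<close> is a local coordinate; \<open>t\<close> is its inverse.\<close>

lemma fps_power_coordinate:
  fixes g :: "complex fps"
  assumes g: "fps_conv_radius g > 0" "fps_nth g 0 = 0" "g \<noteq> 0"
  obtains t \<epsilon> where "fps_conv_radius t > 0" "fps_nth t 0 = 0" "t \<noteq> 0" "g oo t = fps_X ^ subdegree g"
    "\<epsilon> > 0" "inj_on (eval_fps t) (ball 0 \<epsilon>)"
proof -
  define m where "m = subdegree g"
  have m: "m > 0" using g by (simp add: m_def subdegree_eq_0_iff flip: neq0_conv)
  define u where "u = fps_shift m g"
  have u0: "fps_nth u 0 \<noteq> 0" using g by (simp add: u_def m_def)
  have uc: "fps_conv_radius u > 0" by (simp add: u_def g)
  have gu: "g = u * fps_X ^ m" by (simp add: u_def m_def subdegree_decompose)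
  define U where "U = eval_fps u"
  have U0: "U 0 = fps_nth u 0" by (simp add: U_def eval_fps_at_0)
  have Ua: "U analytic_on {0}"
    unfolding U_def by (rule has_fps_expansion_imp_analytic_0[OF eval_fps_has_fps_expansion[OF uc]])
  define c where "c = exp (Ln (fps_nth u 0) / of_nat m)"
  have cm: "c ^ m = fps_nth u 0"
    using m u0 by (simp add: c_def exp_of_nat_mult[symmetric])
  \<comment> \<open>Division by \<open>U 0\<close> moves the value at 0 to 1, where
    \<open>Ln\<close> is analytic, and \<open>c\<close> is an m-th root of \<open>U 0\<close>. So
    \<open>V\<close> is an m-th root of \<open>U\<close> near 0, and \<open>S\<close> below is one
    of \<open>g\<close>.\<close>
  define V where "V z = c * exp (Ln (U z / U 0) / of_nat m)" for z
  have Va: "V analytic_on {0}"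
    unfolding V_def using m u0 by (intro analytic_intros Ua) (auto simp: U0)
  define S where "S z = z * V z" for z
  have Sa: "S analytic_on {0}" unfolding S_def by (intro analytic_intros Va)
  have "eventually (\<lambda>z. eval_fps g z = U z * z ^ m) (nhds 0)"
  proof -
    have "(\<lambda>z. U z * z ^ m) has_fps_expansion g"
      unfolding gu U_def by (intro has_fps_expansion_mult eval_fps_has_fps_expansion uc has_fps_expansion_fps_X_power)
    then show ?thesis by (simp add: has_fps_expansion_def)
  qed
  moreover have "eventually (\<lambda>z. U z \<noteq> 0) (nhds 0)"
  proof -
    have "isCont U 0" using Ua by (simp add: analytic_at_imp_isCont)
    then show ?thesis
      using u0 U0 by (auto simp: isCont_def eventually_nhds_conv_at intro: tendsto_imp_eventually_ne)
  qed
  ultimately have "eventually (\<lambda>z. eval_fps g z = S z ^ m) (nhds 0)"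
  proof eventually_elim
    case (elim z)
    have "V z ^ m = fps_nth u 0 * exp (Ln (U z / U 0) / of_nat m) ^ m"
      by (simp add: V_def power_mult_distrib cm)
    also have "exp (Ln (U z / U 0) / of_nat m) ^ m = U z / U 0"
      using m elim u0 U0 by (simp add: exp_of_nat_mult[symmetric])
    finally have "V z ^ m = U z" using u0 by (simp add: U0)
    then show ?case using elim by (simp add: S_def power_mult_distrib mult_ac)
  qed
  then obtain r1 where r1: "r1 > 0" "\<And>z. norm z < r1 \<Longrightarrow> eval_fps g z = S z ^ m"
    by (auto simp: eventually_nhds_metric dist_norm)
  obtain r2 where r2: "r2 > 0" "S holomorphic_on ball 0 r2"
    using Sa by (auto simp: analytic_on_def)
  define B where "B = ball (0 :: complex) (min r1 r2)"
  have hB: "S holomorphic_on B" using r2 by (rule_tac holomorphic_on_subset) (auto simp: B_def)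
  have B0: "0 \<in> B" "open B" using r1 r2 by (auto simp: B_def)
  \<comment> \<open>The root has a simple zero and is therefore locally invertible; \<open>t\<close>
    will be the expansion of its inverse \<open>T\<close>.\<close>
  have "(S has_field_derivative V 0) (at 0)"
  proof -
    have "(V has_field_derivative deriv V 0) (at 0)"
      using Va by (simp add: analytic_on_imp_differentiable_at DERIV_deriv_iff_field_differentiable)
    then have "((\<lambda>z. z * V z) has_field_derivative 1 * V 0 + deriv V 0 * 0) (at 0)"
      by (intro DERIV_mult DERIV_ident)
    then show ?thesis by (simp add: S_def[abs_def])
  qed
  then have "deriv S 0 = V 0" by (rule DERIV_imp_deriv)
  then have "deriv S 0 \<noteq> 0" by (simp add: V_def c_def)
  then obtain r where r: "r > 0" "ball 0 r \<subseteq> B" "inj_on S (ball 0 r)"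
    using has_complex_derivative_locally_injective[OF hB B0] by blast
  have hr: "S holomorphic_on ball 0 r" using hB r(2) by (rule holomorphic_on_subset)
  obtain T where T: "T holomorphic_on S ` ball 0 r" "\<And>z. z \<in> ball 0 r \<Longrightarrow> T (S z) = z"
    using holomorphic_has_inverse[OF hr open_ball r(3)] by metis
  have oS: "open (S ` ball 0 r)" by (rule open_mapping_thm3[OF hr open_ball r(3)])
  have S0: "S 0 = 0" by (simp add: S_def)
  have "0 \<in> S ` ball 0 r" using r(1) S0 by (auto intro!: image_eqI[of _ _ 0])
  then have Ta: "T analytic_on {0}"
    using T(1) oS by (auto simp: analytic_at)
  define t where "t = fps_expansion T 0"
  have Tt: "T has_fps_expansion t"
    unfolding t_def by (rule analytic_at_imp_has_fps_expansion_0[OF Ta])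
  have T0: "T 0 = 0" using T(2)[of 0] r(1) S0 by simp
  have t0: "fps_nth t 0 = 0"
    using has_fps_expansion_imp_0_eq_fps_nth_0[OF Tt] T0 by simp
  obtain s where s: "s > 0" "ball 0 s \<subseteq> S ` ball 0 r"
    using oS \<open>0 \<in> S ` ball 0 r\<close> open_contains_ball by blast
  have "eval_fps g (T w) = w ^ m" if "norm w < s" for w
  proof -
    have "w \<in> S ` ball 0 r" using s(2) that by (auto simp: subset_iff)
    then obtain z where z: "w = S z" "z \<in> ball 0 r" by blast
    then show ?thesis using T(2) r(2) r1(2)[of z] by (auto simp: B_def)
  qed
  then have "eventually (\<lambda>w. eval_fps g (T w) = w ^ m) (nhds 0)"
    using s(1) by (auto simp: eventually_nhds_metric dist_norm)
  moreover have "(eval_fps g \<circ> T) has_fps_expansion (g oo t)"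
    by (rule has_fps_expansion_compose[OF eval_fps_has_fps_expansion[OF g(1)] Tt t0])
  ultimately have "(\<lambda>w. w ^ m) has_fps_expansion (g oo t)"
    using has_fps_expansion_cong[of "eval_fps g \<circ> T" "\<lambda>w. w ^ m"] by (simp add: o_def)
  then have gt: "g oo t = fps_X ^ m"
    using has_fps_expansion_fps_X_power fps_expansion_unique_complex by blast
  have tc: "fps_conv_radius t > 0" using Tt by (simp add: has_fps_expansion_def)
  have "t \<noteq> 0"
  proof
    assume "t = 0"
    then have "fps_X ^ m = (0 :: complex fps)" using gt g(2) by simp
    then show False by simp
  qed
  have "eventually (\<lambda>w. eval_fps t w = T w) (nhds 0)" using Tt by (simp add: has_fps_expansion_def)
  then obtain s' where s': "s' > 0" "\<And>w. norm w < s' \<Longrightarrow> eval_fps t w = T w"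
    by (auto simp: eventually_nhds_metric dist_norm)
  have "inj_on (eval_fps t) (ball 0 (min s s'))"
  proof (rule inj_onI)
    fix v w assume vw: "v \<in> ball 0 (min s s')" "w \<in> ball 0 (min s s')" "eval_fps t v = eval_fps t w"
    then have "v \<in> S ` ball 0 r" "w \<in> S ` ball 0 r" using s(2) by (auto simp: subset_iff)
    then obtain y z where "v = S y" "y \<in> ball 0 r" "w = S z" "z \<in> ball 0 r" by blast
    with vw show "v = w" using s'(2) T(2) by auto
  qed
  then show ?thesis
    using that[of t "min s s'"] tc t0 \<open>t \<noteq> 0\<close> gt s(1) s'(1) by (simp add: m_def)
qed

text \<open>Composition with a nonzero \<open>t\<close> without constant term annihilates no nonzero
  series, so the ideal of the germ stays the same. Continuity of \<open>t\<close> at 0 keeps its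
  values in the ball on which the old map is injective.\<close>

lemma parametrizes_compose:
  fixes f :: "'n :: finite \<Rightarrow> complex fps"
  assumes f: "parametrizes f X" and t: "fps_conv_radius t > 0" "fps_nth t 0 = 0" "t \<noteq> 0"
    and inj: "\<epsilon> > 0" "inj_on (eval_fps t) (ball 0 \<epsilon>)"
  shows "parametrizes (\<lambda>i. f i oo t) X"
proof -
  have fc: "fps_conv_radius (f j) > 0" "fps_nth (f j) 0 = 0" for j
    using f by (auto simp: parametrizes_def)
  obtain \<epsilon>' where \<epsilon>': "\<epsilon>' > 0" "inj_on (\<lambda>t. \<chi> i. eval_fps (f i) t) (ball 0 \<epsilon>')"
    using f by (auto simp: parametrizes_def)
  have "eventually (\<lambda>u. \<forall>j. eval_fps (f j oo t) u = eval_fps (f j) (eval_fps t u)) (nhds 0)"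
    by (intro eventually_all_finite eventually_eval_fps_compose fc t)
  then obtain d1 where d1: "d1 > 0" "\<And>u j. norm u < d1 \<Longrightarrow> eval_fps (f j oo t) u = eval_fps (f j) (eval_fps t u)"
    by (auto simp: eventually_nhds_metric dist_norm)
  have "isCont (eval_fps t) 0"
    using has_fps_expansion_imp_continuous[OF eval_fps_has_fps_expansion[OF t(1)], of UNIV] by simp
  then obtain d2 where d2: "d2 > 0" "\<And>u. norm u < d2 \<Longrightarrow> norm (eval_fps t u) < \<epsilon>'"
    using \<epsilon>'(1) unfolding continuous_at_eps_delta by (auto simp: eval_fps_at_0 t dist_norm)
  have "inj_on (\<lambda>u. \<chi> i. eval_fps (f i oo t) u) (ball 0 (min \<epsilon> (min d1 d2)))"
  proof (rule inj_onI)
    fix u v assume uv: "u \<in> ball 0 (min \<epsilon> (min d1 d2))" "v \<in> ball 0 (min \<epsilon> (min d1 d2))"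
      and eq: "(\<chi> i. eval_fps (f i oo t) u) = (\<chi> i. eval_fps (f i oo t) v)"
    then have "(\<chi> i. eval_fps (f i) (eval_fps t u)) = (\<chi> i. eval_fps (f i) (eval_fps t v))"
      using d1(2) by (simp add: vec_eq_iff)
    then have "eval_fps t u = eval_fps t v"
      by (rule inj_onD[OF \<epsilon>'(2)]) (use uv d2(2) in auto)
    then show "u = v" by (rule inj_onD[OF inj(2)]) (use uv in auto)
  qed
  then have "\<exists>\<epsilon>>0. inj_on (\<lambda>u. \<chi> i. eval_fps (f i oo t) u) (ball 0 \<epsilon>)"
    using inj(1) d1(1) d2(1) by (intro exI[of _ "min \<epsilon> (min d1 d2)"]) auto
  moreover have "X = {a. cps_subst_fps (\<lambda>i. f i oo t) a = 0}"
    using f t by (auto simp: parametrizes_def cps_subst_fps_compose fps_compose_eq_0_iff)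
  ultimately show ?thesis
    unfolding parametrizes_def using fc t by (auto intro: conv_radius_compose_pos)
qed

lemma generic_projection_normal_form:
  fixes X :: "('n :: finite) cps set"
  assumes L: "L \<in> generic_forms X"
  obtains f i m where "parametrizes f X" "m > 0" "proj_param L f i = fps_X ^ m"
proof -
  obtain f where f: "parametrizes f X" using generic_forms_parametrized[OF L] .
  then have fc: "fps_conv_radius (f j) > 0" "fps_nth (f j) 0 = 0" for j
    by (auto simp: parametrizes_def)
  \<comment> \<open>For \<open>c = 0\<close> the composite is the constant term 0, so asymmetry says
    that some coordinate of the projection is nonzero.\<close>
  obtain i where "proj_param L f i oo (fps_const 0 * fps_X) \<noteq> proj_param L f i"
    using generic_projection_asymmetric[OF f L, of 0] by auto
  then have nz: "proj_param L f i \<noteq> 0" by auto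
  note p0 = proj_param_nth_0[of f L i, OF fc(2)]
  obtain t \<epsilon> where t: "fps_conv_radius t > 0" "fps_nth t 0 = 0" "t \<noteq> 0"
      "proj_param L f i oo t = fps_X ^ subdegree (proj_param L f i)"
      "\<epsilon> > 0" "inj_on (eval_fps t) (ball 0 \<epsilon>)"
    using fps_power_coordinate[OF conv_radius_proj_param[OF fc(1)] p0 nz] by metis
  show ?thesis
  proof (rule that)
    show "parametrizes (\<lambda>i. f i oo t) X" by (rule parametrizes_compose[OF f t(1-3,5,6)])
    show "subdegree (proj_param L f i) > 0" using nz p0 by (simp add: subdegree_eq_0_iff flip: neq0_conv)
    show "proj_param L (\<lambda>i. f i oo t) i = fps_X ^ subdegree (proj_param L f i)"
      by (simp add: proj_param_compose t)
  qed
qed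

section \<open>Birationality of generic projections\<close>

text \<open>Coordinates of a series in s over the series in s^m, with respect to the basis s^r,
  \<open>r < m\<close>.\<close>

definition fps_component :: "nat \<Rightarrow> nat \<Rightarrow> complex fps \<Rightarrow> complex fps" where
  "fps_component m r h = Abs_fps (\<lambda>k. fps_nth h (m * k + r))"

text \<open>The coefficients belong to a subseries of an absolutely convergent series; the point
  \<open>R\<close> is replaced by \<open>R ^ m\<close>.\<close>

lemma conv_radius_component:
  assumes "fps_conv_radius h > 0" "m > 0"
  shows "fps_conv_radius (fps_component m r h) > 0"
proof -
  obtain R where R: "0 < ereal R" "ereal R < fps_conv_radius h"
    using ereal_dense2[OF assms(1)] by auto
  let ?g = "\<lambda>n. norm (fps_nth h n * of_real R ^ n)"
  have s: "summable ?g"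
    by (rule norm_summable_fps) (use R in auto)
  have "summable (\<lambda>k. ?g (m * k + r))"
  proof (rule summableI_nonneg_bounded[where x = "suminf ?g"])
    fix N
    have inj: "inj_on (\<lambda>k. m * k + r) {..<N}" using assms(2) by (auto simp: inj_on_def)
    have "(\<Sum>k<N. ?g (m * k + r)) = sum ?g ((\<lambda>k. m * k + r) ` {..<N})"
      by (simp add: sum.reindex[OF inj])
    also have "\<dots> \<le> suminf ?g" by (rule sum_le_suminf[OF s]) auto
    finally show "(\<Sum>k<N. ?g (m * k + r)) \<le> suminf ?g" .
  qed auto
  moreover have "?g (m * k + r) = R ^ r * norm (fps_nth h (m * k + r) * of_real (R ^ m) ^ k)" for k
    using R by (simp add: norm_mult norm_power power_add mult_ac flip: power_mult)
  ultimately have "summable (\<lambda>k. R ^ r * norm (fps_nth h (m * k + r) * of_real (R ^ m) ^ k))" by simp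
  then have "summable (\<lambda>k. norm (fps_nth h (m * k + r) * of_real (R ^ m) ^ k))"
    using R by (subst (asm) summable_cmult_iff) auto
  then have "summable (\<lambda>k. fps_nth h (m * k + r) * of_real (R ^ m) ^ k)"
    by (rule summable_norm_cancel)
  then have "conv_radius (\<lambda>k. fps_nth h (m * k + r)) \<ge> norm (of_real (R ^ m) :: complex)"
    by (rule conv_radius_geI)
  then show ?thesis
    using R by (auto simp: fps_conv_radius_def fps_component_def norm_power intro: less_le_trans[rotated])
qed

text \<open>For letting a conjugation act on the coefficients of the interpolation
  polynomial.\<close>

lemma map_poly_mult_hom:
  fixes \<sigma> :: "complex fps \<Rightarrow> complex fps"
  assumes "\<sigma> 0 = 0" "\<And>a b. \<sigma> (a + b) = \<sigma> a + \<sigma> b" "\<And>a b. \<sigma> (a * b) = \<sigma> a * \<sigma> b"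
  shows "map_poly \<sigma> (p * q) = map_poly \<sigma> p * map_poly \<sigma> q"
proof -
  have "\<sigma> (sum h A) = (\<Sum>i\<in>A. \<sigma> (h i))" for h and A :: "nat set"
    by (induction A rule: infinite_finite_induct) (auto simp: assms)
  then show ?thesis
    by (intro poly_eqI) (simp add: coeff_map_poly assms coeff_mult)
qed

lemma map_poly_prod_hom:
  fixes \<sigma> :: "complex fps \<Rightarrow> complex fps"
  assumes "\<sigma> 0 = 0" "\<sigma> 1 = 1" "\<And>a b. \<sigma> (a + b) = \<sigma> a + \<sigma> b" "\<And>a b. \<sigma> (a * b) = \<sigma> a * \<sigma> b"
  shows "map_poly \<sigma> (prod h A) = (\<Prod>i\<in>A. map_poly \<sigma> (h i))"
  by (induction A rule: infinite_finite_induct) (auto simp: assms map_poly_mult_hom map_poly_1)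

lemma map_poly_sum_hom:
  fixes \<sigma> :: "complex fps \<Rightarrow> complex fps"
  assumes "\<sigma> 0 = 0" "\<And>a b. \<sigma> (a + b) = \<sigma> a + \<sigma> b"
  shows "map_poly \<sigma> (sum h A) = (\<Sum>i\<in>A. map_poly \<sigma> (h i))"
proof -
  have "\<sigma> (sum h A) = (\<Sum>i\<in>A. \<sigma> (h i))" for h :: "'a \<Rightarrow> complex fps" and A
    by (induction A rule: infinite_finite_induct) (auto simp: assms)
  then show ?thesis by (intro poly_eqI) (simp add: coeff_map_poly assms coeff_sum)
qed

text \<open>The Lagrange interpolation polynomial of the conjugates of \<open>h\<close> at the conjugates of \<open>y\<close>
  under \<open>s \<mapsto> \<omega> s\<close> has coefficients that are series in \<open>s ^ m\<close>; its value at \<open>y\<close> is a fixed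
  multiple of \<open>h\<close>.\<close>

lemma generic_projection_conductor:
  fixes f :: "'n :: finite \<Rightarrow> complex fps"
  assumes f: "parametrizes f X" and L: "L \<in> generic_forms X" and m: "m > 0"
    and i: "proj_param L f i = fps_X ^ m"
  obtains \<Delta> where "\<Delta> \<noteq> 0" "\<And>h. fps_conv_radius h > 0 \<Longrightarrow> \<exists>a. cps_subst_fps (proj_param L f) a = \<Delta> * h"
proof -
  have fc: "fps_conv_radius (f j) > 0" "fps_nth (f j) 0 = 0" for j
    using f by (auto simp: parametrizes_def)
  note p0 = proj_param_nth_0[of f L, OF fc(2)]
  obtain j where ij: "i \<noteq> j" using exhaust_2 by (metis zero_neq_one)
  define y where "y = proj_param L f j"
  define sc :: "complex \<Rightarrow> complex fps \<Rightarrow> complex fps" where "sc c h = h oo (fps_const c * fps_X)" for c h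
  have sc: "sc c 0 = 0" "sc c 1 = 1" "sc c (a + b) = sc c a + sc c b" "sc c (a * b) = sc c a * sc c b"
      "sc c (- a) = - sc c a" "sc c (sc d a) = sc (c * d) a" "sc 1 a = a" for c d a b
  proof -
    show "sc c (sc d a) = sc (c * d) a" "sc 1 a = a"
      by (simp_all add: sc_def fps_compose_linear fps_eq_iff power_mult_distrib)
  qed (simp_all add: sc_def fps_compose_add_distrib fps_compose_mult_distrib fps_compose_uminus)
  have scc: "fps_conv_radius (sc c h) > 0" if "fps_conv_radius h > 0" for c h
    unfolding sc_def using that by (intro conv_radius_compose_pos conv_radius_mult_pos) auto
  define Z where "Z = {z :: complex. z ^ m = 1}"
  have finZ: "finite Z" unfolding Z_def using m by (intro finite_roots_unity) auto
  have Z1: "1 \<in> Z" by (simp add: Z_def)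
  \<comment> \<open>A root of unity \<open>z\<close> fixes s^m, the other coordinate of the
    projection, so genericity forces it to move \<open>y\<close>.\<close>
  have distinct: "sc z y \<noteq> y" if "z \<in> Z" "z \<noteq> 1" for z
  proof
    assume "sc z y = y"
    have "norm z ^ m = 1" using that(1) by (simp add: Z_def flip: norm_power)
    then have "norm z = 1" using m by (intro power_eq_imp_eq_base[of "norm z" m 1]) auto
    moreover have "proj_param L f k oo (fps_const z * fps_X) = proj_param L f k" for k
    proof -
      have "sc z (fps_X ^ m) = fps_X ^ m"
        using that(1) by (auto simp: sc_def fps_eq_iff fps_compose_linear Z_def fps_X_power_nth)
      moreover have "k = i \<or> k = j" using UNIV_2_eq[OF ij] by blast
      ultimately show ?thesis using \<open>sc z y = y\<close> i by (auto simp: sc_def y_def)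
    qed
    ultimately show False using generic_projection_asymmetric[OF f L that(2)] by auto
  qed
  \<comment> \<open>The derivative at \<open>y\<close> of the polynomial whose roots are the
    conjugates of \<open>y\<close>.\<close>
  define \<Delta> where "\<Delta> = (\<Prod>w\<in>Z - {1}. y - sc w y)"
  have "\<Delta> \<noteq> 0" using finZ distinct by (auto simp: \<Delta>_def) metis
  moreover have "\<exists>a. cps_subst_fps (proj_param L f) a = \<Delta> * h" if h: "fps_conv_radius h > 0" for h
  proof -
    \<comment> \<open>The denominators of the interpolation formula are left out, so that all
      coefficients stay convergent series; hence the value \<open>\<Delta> * h\<close> in place of
      \<open>h\<close>.\<close>
    define P where "P = (\<Sum>z\<in>Z. [:sc z h:] * (\<Prod>w\<in>Z - {z}. [:- sc w y, 1:]))"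
    have "poly P y = (\<Sum>z\<in>Z. sc z h * (\<Prod>w\<in>Z - {z}. y - sc w y))"
      by (simp add: P_def poly_sum poly_prod)
    \<comment> \<open>For \<open>z \<noteq> 1\<close> the product contains the factor
      \<open>y - sc 1 y\<close>, which is 0.\<close>
    also have "\<dots> = (\<Sum>z\<in>{1}. sc z h * (\<Prod>w\<in>Z - {z}. y - sc w y))"
      using finZ Z1 by (intro sum.mono_neutral_right) (auto simp: sc(7) intro!: bexI[of _ 1])
    finally have Py: "poly P y = \<Delta> * h" by (simp add: sc(7) \<Delta>_def)
    have yc: "fps_conv_radius y > 0" unfolding y_def by (rule conv_radius_proj_param[OF fc(1)])
    have Pc: "fps_conv_radius (coeff P n) > 0" for n
    proof -
      define cv where "cv p \<longleftrightarrow> (\<forall>n. fps_conv_radius (coeff p n) > 0)" for p :: "complex fps poly"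
      have cv_mult: "cv (p * q)" if "cv p" "cv q" for p q
        using that by (auto simp: cv_def coeff_mult intro!: conv_radius_sum_pos conv_radius_mult_pos)
      have cv_prod: "cv (prod g A)" if "\<And>i. i \<in> A \<Longrightarrow> cv (g i)" for g and A :: "complex set"
        using that
      proof (induction A rule: infinite_finite_induct)
        case (insert x F)
        then show ?case by (simp add: cv_mult)
      qed (auto simp: cv_def coeff_1)
      have cv_lin: "cv [:a, b:]" if "fps_conv_radius a > 0" "fps_conv_radius b > 0" for a b
        using that by (auto simp: cv_def coeff_pCons split: nat.splits)
      have "cv ([:sc z h:] * (\<Prod>w\<in>Z - {z}. [:- sc w y, 1:]))" for z
        using scc[OF h] scc[OF yc]
        by (intro cv_mult cv_prod cv_lin) (auto simp: cv_def coeff_pCons split: nat.splits)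
      then show ?thesis
        unfolding P_def coeff_sum by (intro conv_radius_sum_pos) (simp add: cv_def)
    qed
    \<comment> \<open>Multiplication by \<omega> permutes the roots of unity, and with them the
      summands of \<open>P\<close>.\<close>
    have inv: "map_poly (sc \<omega>) P = P" if "\<omega> \<in> Z" for \<omega>
    proof -
      have \<omega>0: "\<omega> \<noteq> 0" using that m by (auto simp: Z_def power_0_left)
      have bij: "bij_betw ((*) \<omega>) Z Z"
        by (rule bij_betwI[where g = "(*) (inverse \<omega>)"])
           (use that \<omega>0 in \<open>auto simp: Z_def power_mult_distrib power_inverse\<close>)
      have bij': "bij_betw ((*) \<omega>) (Z - {z}) (Z - {\<omega> * z})" if "z \<in> Z" for z
        using bij_betw_DiffI[OF bij, of "{z}" "{\<omega> * z}"] bij_betwE[OF bij] that by (simp add: bij_betw_def)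
      have smult: "map_poly (sc \<omega>) (Polynomial.smult a p) = Polynomial.smult (sc \<omega> a) (map_poly (sc \<omega>) p)" for a p
        by (rule poly_eqI) (simp add: coeff_map_poly sc)
      have "map_poly (sc \<omega>) P = (\<Sum>z\<in>Z. [:sc (\<omega> * z) h:] * (\<Prod>w\<in>Z - {z}. [:- sc (\<omega> * w) y, 1:]))"
        unfolding P_def
        by (simp add: map_poly_sum_hom smult map_poly_prod_hom sc map_poly_pCons)
      also have "\<dots> = (\<Sum>z\<in>Z. [:sc (\<omega> * z) h:] * (\<Prod>w\<in>Z - {\<omega> * z}. [:- sc w y, 1:]))"
        by (intro sum.cong refl arg_cong2[of _ _ _ _ "(*)"] prod.reindex_bij_betw bij')
      also have "\<dots> = P"
        unfolding P_def by (rule sum.reindex_bij_betw[OF bij])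
      finally show ?thesis .
    qed
    have coeff_P: "coeff P n = fps_component m 0 (coeff P n) oo fps_X ^ m" for n
    proof -
      \<comment> \<open>A primitive m-th root of unity: invariance under it leaves only exponents
        divisible by \<open>m\<close>.\<close>
      define \<omega> where "\<omega> = exp (2 * of_real pi * \<i> * of_nat 1 / of_nat m)"
      have "\<omega> \<in> Z" unfolding Z_def \<omega>_def using complex_root_unity[of m 1] m by simp
      have "sc \<omega> (coeff P n) = coeff P n"
        using arg_cong[OF inv[OF \<open>\<omega> \<in> Z\<close>], of "\<lambda>p. coeff p n"] by (simp add: coeff_map_poly sc)
      then have eq: "\<omega> ^ k * fps_nth (coeff P n) k = fps_nth (coeff P n) k" for k
        by (auto simp: sc_def fps_eq_iff fps_compose_linear)
      have "\<omega> ^ k = exp (2 * of_real pi * \<i> * of_nat k / of_nat m)" for k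
        by (simp add: \<omega>_def exp_of_nat_mult[symmetric] mult_ac)
      then have "\<omega> ^ k = 1 \<Longrightarrow> m dvd k" for k
        using complex_root_unity_eq_1[of m k] m by simp
      with eq have "fps_nth (coeff P n) k = 0" if "\<not> m dvd k" for k
        using that by (metis mult_cancel_right1)
      then show ?thesis
        using m by (intro fps_ext) (auto simp: fps_nth_compose_X_power fps_component_def)
    qed
    \<comment> \<open>The coefficients of \<open>P\<close> are series in s^m, the value of the
      variable \<open>i\<close>, and \<open>y\<close> is the value of the variable \<open>j\<close>.
      So \<open>poly P y\<close> is the value of a plane series.\<close>
    define a where "a = (\<Sum>n\<le>degree P. cps_embed i (fps_component m 0 (coeff P n)) * cps_var j ^ n)"
    have "cps_subst_fps (proj_param L f) a = (\<Sum>n\<le>degree P. coeff P n * y ^ n)"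
      unfolding a_def cps_subst_fps_sum
      by (intro sum.cong refl)
         (simp add: cps_subst_fps_mult p0 cps_subst_fps_power cps_subst_fps_var cps_subst_fps_embed
            conv_radius_component[OF Pc m] i y_def flip: coeff_P)
    also have "\<dots> = \<Delta> * h" by (simp add: poly_altdef flip: Py)
    finally show ?thesis by blast
  qed
  ultimately show ?thesis using that by blast
qed

section \<open>Matrices over commutative rings\<close>

lemma matrix_vector_mult_smult:
  fixes A :: "'a :: comm_ring_1 ^ 'n ^ 'm"
  shows "A *v (c *s x) = c *s (A *v x)"
  by (simp add: vec_eq_iff matrix_vector_mult_def sum_distrib_left mult_ac)

lemma matrix_eq_columns:
  fixes A B :: "'a :: comm_ring_1 ^ 'n ^ 'm"
  assumes "\<And>x. A *v x = B *v x"
  shows "A = B"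
proof -
  have "A $ i $ j = (A *v axis j 1) $ i" for A :: "'a ^ 'n ^ 'm" and i j
    by (simp add: matrix_vector_mult_def axis_def if_distrib cong: if_cong)
  then show ?thesis by (simp add: vec_eq_iff assms)
qed

lemma mat_mult_vector: "mat c *v x = c *s (x :: 'a :: comm_ring_1 ^ 'n)"
  by (simp add: vec_eq_iff matrix_vector_mult_def mat_def if_distrib if_distribR cong: if_cong)

lemma mat_commute: "mat c ** A = A ** mat (c :: 'a :: comm_ring_1)"
  by (rule matrix_eq_columns) (simp add: mat_mult_vector matrix_vector_mult_smult flip: matrix_vector_mul_assoc)

text \<open>Cramer's rule: the entries of \<open>B\<close> are determinants with row
  \<open>k\<close> replaced by a unit vector. Multilinearity collects the sum into one determinant,
  which for \<open>l \<noteq> k\<close> has two equal rows.\<close>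

lemma adjugate_right:
  fixes A :: "'a :: comm_ring_1 ^ 'n ^ 'n"
  obtains B where "A ** B = mat (det A)"
proof
  define B :: "'a ^ 'n ^ 'n" where "B = (\<chi> j k. det (\<chi> i. if i = k then axis j 1 else A $ i))"
  have "(\<Sum>j\<in>UNIV. A $ l $ j * B $ j $ k) = (if l = k then det A else 0)" for l k
  proof -
    have "(\<Sum>j\<in>UNIV. A $ l $ j * B $ j $ k)
        = (\<Sum>j\<in>UNIV. det (\<chi> i. if i = k then A $ l $ j *s axis j 1 else A $ i))"
      by (simp add: B_def det_row_mul)
    also have "\<dots> = det (\<chi> i. if i = k then (\<Sum>j\<in>UNIV. A $ l $ j *s axis j 1) else A $ i)"
      by (simp add: det_linear_row_sum)
    also have "\<dots> = det (\<chi> i. if i = k then A $ l else A $ i)"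
      unfolding basis_expansion ..
    also have "\<dots> = (if l = k then det A else 0)"
    proof (cases "l = k")
      case True
      then have "(\<chi> i. if i = k then A $ l else A $ i) = A" by (simp add: vec_eq_iff)
      then show ?thesis using True by simp
    next
      case False
      then have "det (\<chi> i. if i = k then A $ l else A $ i) = 0"
        by (intro det_identical_rows[of l k]) (auto simp: row_def vec_eq_iff)
      then show ?thesis using False by simp
    qed
    finally show ?thesis .
  qed
  then show "A ** B = mat (det A)" by (simp add: vec_eq_iff matrix_matrix_mult_def mat_def)
qed

lemma adjugate_left:
  fixes A :: "'a :: comm_ring_1 ^ 'n ^ 'n"
  obtains B where "B ** A = mat (det A)"
proof -
  obtain B where "transpose A ** B = mat (det A)" using adjugate_right[of "transpose A"] by auto
  then have "transpose (transpose A ** B) = mat (det A)" by (simp add: transpose_mat)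
  then show ?thesis using that by (simp add: matrix_transpose_mul)
qed

lemma invertible_if_det_unit:
  fixes A :: "'a :: comm_ring_1 ^ 'n ^ 'n"
  assumes "det A * u = 1"
  shows "invertible A"
proof -
  obtain B where B: "A ** B = mat (det A)" by (rule adjugate_right)
  obtain C where C: "C ** A = mat (det A)" by (rule adjugate_left)
  have m: "mat (det A) ** mat u = mat 1"
    by (rule matrix_eq_columns)
       (simp add: mat_mult_vector assms mult.commute[of u] flip: matrix_vector_mul_assoc)
  have 1: "A ** (B ** mat u) = mat 1" by (simp add: matrix_mul_assoc B m)
  have 2: "(mat u ** C) ** A = mat 1"
    by (simp add: C m mat_commute[of u "mat (det A)"] flip: matrix_mul_assoc)
  have "mat u ** C = B ** mat u"
    by (metis 1 2 matrix_mul_assoc matrix_mul_lid matrix_mul_rid)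
  then show ?thesis using 1 2 unfolding invertible_def by metis
qed

lemma matrix_inv_mult:
  fixes A :: "'a :: comm_ring_1 ^ 'n ^ 'n"
  assumes "invertible A"
  shows "A ** matrix_inv A = mat 1" "matrix_inv A ** A = mat 1"
  using someI_ex[OF assms[unfolded invertible_def]] by (simp_all add: matrix_inv_def)

lemma matrix_inv_unique_comm:
  fixes A :: "'a :: comm_ring_1 ^ 'n ^ 'n"
  assumes "A ** B = mat 1" "B ** A = mat 1"
  shows "matrix_inv A = B"
proof -
  have "invertible A" using assms unfolding invertible_def by blast
  then show ?thesis
    by (metis assms(1) matrix_inv_mult(2) matrix_mul_assoc matrix_mul_lid matrix_mul_rid)
qed

section \<open>Vectors of convergent power series\<close>

interpretation cps_vec: Modules.module "(*s) :: 'a :: comm_ring_1 \<Rightarrow> 'a ^ 'n \<Rightarrow> 'a ^ 'n"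
  by unfold_locales (simp_all add: vector_add_ldistrib vector_sadd_rdistrib)

lemma cps_coeff_prod_0: "cps_coeff (prod h A) 0 = (\<Prod>i\<in>A. cps_coeff (h i) 0)"
  by (induction A rule: infinite_finite_induct) (auto simp: one_cps.rep_eq cps_coeff_mult_0)

lemma cps_coeff_of_int_0: "cps_coeff (of_int k) 0 = of_int k"
proof -
  have nat: "cps_coeff (of_nat n) 0 = of_nat n" for n
    by (induction n) (auto simp: zero_cps.rep_eq one_cps.rep_eq plus_cps.rep_eq)
  show ?thesis
    by (cases k rule: int_cases2) (simp_all add: nat uminus_cps.rep_eq)
qed

text \<open>Reduction modulo the maximal ideal. A matrix of relations is minimal when its reduction
  is 0.\<close>

definition const_matrix :: "('n :: finite) cps ^ 'a ^ 'b \<Rightarrow> complex ^ 'a ^ 'b" where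
  "const_matrix A = (\<chi> i j. cps_coeff (A $ i $ j) 0)"

lemma cps_coeff_det_0:
  fixes A :: "('n :: finite) cps ^ 'b ^ 'b"
  shows "cps_coeff (det A) 0 = det (const_matrix A)"
  by (simp add: det_def cps_coeff_sum cps_coeff_mult_0 cps_coeff_prod_0 cps_coeff_of_int_0 const_matrix_def)

lemma const_matrix_mult: "const_matrix (A ** B) = const_matrix A ** const_matrix B"
  by (simp add: const_matrix_def matrix_matrix_mult_def vec_eq_iff cps_coeff_sum cps_coeff_mult_0)

lemma const_matrix_1: "const_matrix (mat 1) = mat 1"
  by (simp add: const_matrix_def mat_def vec_eq_iff one_cps.rep_eq zero_cps.rep_eq)

text \<open>Reduction commutes with determinants, so a one-sided inverse over C already makes
  \<open>det A\<close> a unit.\<close>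

lemma invertible_if_const_invertible:
  fixes A :: "('n :: finite) cps ^ 'b ^ 'b"
  assumes "const_matrix A ** B = mat 1"
  shows "invertible A"
proof -
  have "det (const_matrix A) * det B = 1"
    using assms by (metis det_I det_mul)
  then have "cps_coeff (det A) 0 \<noteq> 0" by (auto simp: cps_coeff_det_0)
  then show ?thesis using cps_unit invertible_if_det_unit by blast
qed

text \<open>\<open>det d\<close> divides a power of \<open>F\<close> and is nonzero, so the adjugate
  yields injectivity over the domain of plane series; cancelling \<open>d\<close> then reverses the
  order of the factors.\<close>

lemma matrix_cps2_inject:
  fixes d h :: "2 cps ^ 'b ^ 'b"
  assumes "d ** h = mat F" "F \<noteq> 0"
  shows "h ** d = mat F" "inj ((*v) d)"
proof -
  have pow: "F ^ n \<noteq> 0" for n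
    by (induction n) (use assms(2) cps2_mult_eq_0 in auto)
  have "det (mat F :: 2 cps ^ 'b ^ 'b) = F ^ CARD('b)"
    by (subst det_diagonal) (simp_all add: mat_def)
  then have "det d * det h = F ^ CARD('b)" by (simp flip: det_mul assms(1))
  then have det: "det d \<noteq> 0" using pow by auto
  obtain C where C: "C ** d = mat (det d)" by (rule adjugate_left)
  have inj0: "v = 0" if "d *v v = 0" for v
  proof -
    have "det d *s v = C *v (d *v v)" by (simp add: matrix_vector_mul_assoc C mat_mult_vector)
    then have "det d *s v = 0" using that by simp
    then show ?thesis using det cps2_mult_eq_0 by (auto simp: vec_eq_iff)
  qed
  then show inj: "inj ((*v) d)"
    by (intro injI) (metis eq_iff_diff_eq_0 matrix_vector_mult_diff_distrib)
  have "d *v ((h ** d) *v v) = d *v (mat F *v v)" for v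
    by (simp add: matrix_vector_mul_assoc matrix_mul_assoc assms(1) mat_commute)
  then show "h ** d = mat F"
    using inj by (intro matrix_eq_columns) (auto dest: injD)
qed

text \<open>Gaussian elimination: in each coordinate a vector of minimal order serves as pivot.\<close>

lemma elimination:
  fixes K :: "(2 cps ^ 'b) set" and c :: "'i \<Rightarrow> 2 cps ^ 'b \<Rightarrow> complex fps"
  assumes "finite I" "S \<noteq> {}"
    and K0: "0 \<in> K" and Kd: "\<And>v w. v \<in> K \<Longrightarrow> w \<in> K \<Longrightarrow> v - w \<in> K"
    and Ks: "\<And>r v. r \<in> S \<Longrightarrow> v \<in> K \<Longrightarrow> r *s v \<in> K"
    and cd: "\<And>i v w. i \<in> I \<Longrightarrow> c i (v - w) = c i v - c i w"
    and ck: "\<And>i r v. i \<in> I \<Longrightarrow> r \<in> S \<Longrightarrow> c i v = 0 \<Longrightarrow> c i (r *s v) = 0"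
    and cq: "\<And>i v w. i \<in> I \<Longrightarrow> v \<in> K \<Longrightarrow> w \<in> K \<Longrightarrow> c i w \<noteq> 0 \<Longrightarrow>
      c i v \<noteq> 0 \<longrightarrow> subdegree (c i w) \<le> subdegree (c i v) \<Longrightarrow> \<exists>r\<in>S. c i (r *s w) = c i v"
  shows "\<exists>w. (\<forall>i\<in>I. w i \<in> K) \<and> (\<forall>v\<in>K. \<exists>r. (\<forall>i\<in>I. r i \<in> S) \<and>
    v - (\<Sum>i\<in>I. r i *s w i) \<in> K \<and> (\<forall>j\<in>I. c j (v - (\<Sum>i\<in>I. r i *s w i)) = 0))"
  using assms
proof (induction I arbitrary: K rule: finite_induct)
  case (insert x I)
  note K0 = insert.prems(2) and Kd = insert.prems(3) and Ks = insert.prems(4)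
    and cd = insert.prems(5) and ck = insert.prems(6) and cq = insert.prems(7)
  have c0: "c i 0 = 0" if "i \<in> insert x I" for i using cd[OF that, of 0 0] by simp
  have "\<exists>w0\<in>K. \<forall>v\<in>K. \<exists>r\<in>S. c x (v - r *s w0) = 0"
  proof (cases "\<exists>w\<in>K. c x w \<noteq> 0")
    case False
    obtain r where "r \<in> S" using \<open>S \<noteq> {}\<close> by blast
    with False K0 Kd Ks show ?thesis by (intro bexI[of _ 0] ballI bexI[of _ r]) auto
  next
    case True
    then obtain w0 where w0: "w0 \<in> K" "c x w0 \<noteq> 0"
        "\<And>v. v \<in> K \<Longrightarrow> c x v \<noteq> 0 \<Longrightarrow> subdegree (c x w0) \<le> subdegree (c x v)"
      using ex_has_least_nat[of "\<lambda>w. w \<in> K \<and> c x w \<noteq> 0" _ "\<lambda>w. subdegree (c x w)"] by blast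
    show ?thesis
    proof (intro bexI[of _ w0] ballI)
      fix v assume "v \<in> K"
      then obtain r where "r \<in> S" "c x (r *s w0) = c x v" using cq[of x v w0] w0 by auto
      then show "\<exists>r\<in>S. c x (v - r *s w0) = 0" by (intro bexI[of _ r]) (simp_all add: cd)
    qed (rule w0)
  qed
  then obtain w0 where w0: "w0 \<in> K" "\<And>v. v \<in> K \<Longrightarrow> \<exists>r\<in>S. c x (v - r *s w0) = 0" by blast
  \<comment> \<open>Further pivots are taken among vectors whose coordinate \<open>x\<close>
    vanishes, so later subtractions do not disturb it.\<close>
  define K' where "K' = {v \<in> K. c x v = 0}"
  have "\<exists>w. (\<forall>i\<in>I. w i \<in> K') \<and> (\<forall>v\<in>K'. \<exists>r. (\<forall>i\<in>I. r i \<in> S) \<and>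
    v - (\<Sum>i\<in>I. r i *s w i) \<in> K' \<and> (\<forall>j\<in>I. c j (v - (\<Sum>i\<in>I. r i *s w i)) = 0))"
  proof (rule insert.IH[OF \<open>S \<noteq> {}\<close>])
    show "0 \<in> K'" using K0 c0 by (simp add: K'_def)
    show "v - w \<in> K'" if "v \<in> K'" "w \<in> K'" for v w
      using that Kd cd by (simp add: K'_def)
    show "r *s v \<in> K'" if "r \<in> S" "v \<in> K'" for r v
      using that Ks ck by (simp add: K'_def)
    show "c i (v - w) = c i v - c i w" if "i \<in> I" for i v w using cd that by simp
    show "c i (r *s v) = 0" if "i \<in> I" "r \<in> S" "c i v = 0" for i r v using ck that by simp
    show "\<exists>r\<in>S. c i (r *s w) = c i v" if "i \<in> I" "v \<in> K'" "w \<in> K'" "c i w \<noteq> 0"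
      "c i v \<noteq> 0 \<longrightarrow> subdegree (c i w) \<le> subdegree (c i v)" for i v w
      using cq[of i v w] that by (simp add: K'_def)
  qed
  then obtain w where w: "\<And>i. i \<in> I \<Longrightarrow> w i \<in> K'"
    "\<And>v. v \<in> K' \<Longrightarrow> \<exists>r. (\<forall>i\<in>I. r i \<in> S) \<and>
      v - (\<Sum>i\<in>I. r i *s w i) \<in> K' \<and> (\<forall>j\<in>I. c j (v - (\<Sum>i\<in>I. r i *s w i)) = 0)" by blast
  let ?w = "w(x := w0)"
  show ?case
  proof (intro exI[of _ ?w] conjI ballI)
    fix i assume "i \<in> insert x I"
    then show "?w i \<in> K" using w0(1) w(1) by (auto simp: K'_def)
  next
    fix v assume v: "v \<in> K"
    then obtain r0 where r0: "r0 \<in> S" "c x (v - r0 *s w0) = 0" using w0(2) by blast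
    then have "v - r0 *s w0 \<in> K'" using v w0(1) Kd Ks by (simp add: K'_def)
    then obtain r where r: "\<And>i. i \<in> I \<Longrightarrow> r i \<in> S"
        "v - r0 *s w0 - (\<Sum>i\<in>I. r i *s w i) \<in> K'"
        "\<And>j. j \<in> I \<Longrightarrow> c j (v - r0 *s w0 - (\<Sum>i\<in>I. r i *s w i)) = 0"
      using w(2) by blast
    have eq: "v - (\<Sum>i\<in>insert x I. (r(x := r0)) i *s ?w i) = v - r0 *s w0 - (\<Sum>i\<in>I. r i *s w i)"
    proof -
      have "(\<Sum>i\<in>I. (r(x := r0)) i *s ?w i) = (\<Sum>i\<in>I. r i *s w i)"
        using insert.hyps by (intro sum.cong) auto
      then show ?thesis using insert.hyps by simp
    qed
    show "\<exists>r. (\<forall>i\<in>insert x I. r i \<in> S) \<and> v - (\<Sum>i\<in>insert x I. r i *s ?w i) \<in> K \<and>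
        (\<forall>j\<in>insert x I. c j (v - (\<Sum>i\<in>insert x I. r i *s ?w i)) = 0)"
    proof (rule exI[of _ "r(x := r0)"], unfold eq, intro conjI ballI)
      show "(r(x := r0)) i \<in> S" if "i \<in> insert x I" for i using that r(1) r0(1) by auto
      show "v - r0 *s w0 - (\<Sum>i\<in>I. r i *s w i) \<in> K" using r(2) by (simp add: K'_def)
      show "c j (v - r0 *s w0 - (\<Sum>i\<in>I. r i *s w i)) = 0" if "j \<in> insert x I" for j
        using that r(2,3) by (auto simp: K'_def)
    qed
  qed
qed auto

text \<open>The surplus generators are removed one at a time. In \<open>w = u + x *s k\<close>, the
  vector \<open>k\<close> contains \<open>w\<close> with some coefficient \<open>c\<close>, and
  \<open>1 - x * c\<close> is a unit because \<open>x\<close> lies in the maximal ideal.\<close>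

lemma nakayama:
  fixes K :: "('n :: finite cps ^ 'b) set"
  assumes "finite W" "W \<subseteq> K" "K \<subseteq> cps_vec.span (U \<union> W)" and x: "cps_coeff x 0 = 0"
    and K: "\<And>v. v \<in> K \<Longrightarrow> \<exists>u\<in>cps_vec.span U. \<exists>k\<in>K. v = u + x *s k"
  shows "K \<subseteq> cps_vec.span U"
  using assms(1-3)
proof (induction W rule: finite_induct)
  case (insert w W)
  from insert.prems obtain u k where u: "u \<in> cps_vec.span U" "k \<in> K" "w = u + x *s k"
    using K[of w] by auto
  have "k \<in> cps_vec.span (insert w (U \<union> W))" using u insert.prems by auto
  then obtain c where c: "k - c *s w \<in> cps_vec.span (U \<union> W)"
    by (auto simp: cps_vec.span_insert)
  obtain e where e: "(1 - x * c) * e = 1"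
    using cps_one_minus_unit[of "x * c"] x by (auto simp: cps_coeff_mult_0)
  have "(1 - x * c) *s w = w - x *s (c *s w)"
    by (simp add: vector_sub_rdistrib vector_smult_assoc)
  also have "\<dots> = u + x *s k - x *s (c *s w)" using u(3) by simp
  also have "\<dots> = u + x *s (k - c *s w)" by (simp add: vector_ssub_ldistrib)
  finally have "(1 - x * c) *s w = u + x *s (k - c *s w)" .
  moreover have "u \<in> cps_vec.span (U \<union> W)" using u(1) cps_vec.span_mono[of U "U \<union> W"] by auto
  ultimately have "e *s ((1 - x * c) *s w) \<in> cps_vec.span (U \<union> W)"
    using c by (metis cps_vec.span_add cps_vec.span_scale)
  then have "w \<in> cps_vec.span (U \<union> W)"
    using e unfolding vector_smult_assoc by (simp add: mult.commute[of e])
  then have "U \<union> insert w W \<subseteq> cps_vec.span (U \<union> W)"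
    using cps_vec.span_superset[of "U \<union> W"] by auto
  then have "cps_vec.span (U \<union> insert w W) \<subseteq> cps_vec.span (U \<union> W)"
    by (rule cps_vec.span_minimal) (rule cps_vec.subspace_span)
  then show ?case using insert.IH insert.prems by auto
qed simp

section \<open>Free resolutions of length one\<close>

text \<open>Only exponents divisible by \<open>m\<close> occur in the first factor, and they
  preserve residues modulo \<open>m\<close>: taking coordinates is linear over the series in
  s^m.\<close>

lemma fps_component_mult:
  assumes "r < m"
  shows "fps_component m r ((q oo fps_X ^ m) * h) = q * fps_component m r h"
proof (rule fps_ext)
  fix k
  have m: "m > 0" using assms by simp
  have inj: "inj_on ((*) m) {0..k}" using m by (auto simp: inj_on_def)
  have "fps_nth ((q oo fps_X ^ m) * h) (m * k + r)
      = (\<Sum>i=0..m * k + r. fps_nth (q oo fps_X ^ m) i * fps_nth h (m * k + r - i))"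
    by (simp add: fps_mult_nth)
  also have "\<dots> = (\<Sum>i\<in>(*) m ` {0..k}. fps_nth (q oo fps_X ^ m) i * fps_nth h (m * k + r - i))"
  proof (rule sum.mono_neutral_right)
    show "(*) m ` {0..k} \<subseteq> {0..m * k + r}" by (auto intro!: trans_le_add1 mult_le_mono2)
    show "\<forall>i\<in>{0..m * k + r} - (*) m ` {0..k}. fps_nth (q oo fps_X ^ m) i * fps_nth h (m * k + r - i) = 0"
    proof
      fix i assume i: "i \<in> {0..m * k + r} - (*) m ` {0..k}"
      have "\<not> m dvd i"
      proof
        assume "m dvd i"
        then obtain l where l: "i = m * l" by blast
        then have "m * l < m * Suc k" using i assms by simp
        then have "l \<le> k" using m by (simp add: nat_mult_less_cancel1 del: mult_Suc_right)
        then show False using i l by auto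
      qed
      then show "fps_nth (q oo fps_X ^ m) i * fps_nth h (m * k + r - i) = 0"
        using m by (simp add: fps_nth_compose_X_power)
    qed
  qed simp
  also have "\<dots> = (\<Sum>l=0..k. fps_nth q l * fps_nth h (m * k + r - m * l))"
    using m by (simp add: sum.reindex[OF inj] fps_nth_compose_X_power)
  also have "\<dots> = (\<Sum>l=0..k. fps_nth q l * fps_nth (fps_component m r h) (k - l))"
  proof (intro sum.cong refl)
    fix l assume "l \<in> {0..k}"
    then have "m * k + r - m * l = m * (k - l) + r"
      by (simp add: diff_mult_distrib2)
    then show "fps_nth q l * fps_nth h (m * k + r - m * l) = fps_nth q l * fps_nth (fps_component m r h) (k - l)"
      by (simp add: fps_component_def)
  qed
  finally show "fps_nth (fps_component m r ((q oo fps_X ^ m) * h)) k = fps_nth (q * fps_component m r h) k"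
    by (simp add: fps_component_def fps_mult_nth)
qed

lemma fps_eq_0_if_components:
  assumes "m > 0" "\<And>r. r < m \<Longrightarrow> fps_component m r h = 0"
  shows "h = 0"
proof (rule fps_ext)
  fix n
  have "fps_nth (fps_component m (n mod m) h) (n div m) = fps_nth h n"
    by (simp add: fps_component_def)
  then show "fps_nth h n = fps_nth 0 n" using assms by simp
qed

lemma fps_component_diff: "fps_component m r (a - b) = fps_component m r a - fps_component m r b"
  by (simp add: fps_component_def fps_eq_iff)

text \<open>Linear maps from a free module over the plane series, which act on one-variable series
  through the parametrization \<open>g\<close>. Generators of a local ring are given by such a map,
  relations by its kernel.\<close>

locale semilinear =
  fixes g :: "2 \<Rightarrow> complex fps" and P :: "2 cps ^ 'a \<Rightarrow> complex fps"
  assumes g0: "\<And>k. fps_nth (g k) 0 = 0"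
    and P_add: "P (v + w) = P v + P w"
    and P_smult: "P (a *s v) = cps_subst_fps g a * P v"
begin

lemma P_0: "P 0 = 0" using P_add[of 0 0] by simp

lemma P_diff: "P (v - w) = P v - P w"
  using P_add[of "v - w" w] by simp

lemma P_sum: "P (sum h A) = (\<Sum>j\<in>A. P (h j))"
  by (induction A rule: infinite_finite_induct) (auto simp: P_0 P_add)

lemma P_axis: "P v = (\<Sum>j\<in>UNIV. cps_subst_fps g (v $ j) * P (axis j 1))"
  by (subst basis_expansion[symmetric, of v]) (simp only: P_sum P_smult)

text \<open>The kernel is finitely generated because it is, modulo \<open>F\<close>, a module over the series in
  \<open>g i = s ^ m\<close> inside a free module of finite rank; its reduction modulo \<open>x\<^sub>i\<close> is generated
  by \<open>CARD('a)\<close> elements, so the kernel is as well by Nakayama's lemma.\<close>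

lemma kernel_eq_range_matrix:
  assumes gc: "\<And>k. fps_conv_radius (g k) > 0" and m: "m > 0" "g i = fps_X ^ m"
    and F: "\<And>a. cps_subst_fps g a = 0 \<longleftrightarrow> (\<exists>t. a = t * F)"
  shows "\<exists>d :: 2 cps ^ 'a ^ 'a. range ((*v) d) = {v. P v = 0}"
proof -
  define K where "K = {v. P v = 0}"
  have K: "0 \<in> K" "v \<in> K \<Longrightarrow> w \<in> K \<Longrightarrow> v - w \<in> K" "v \<in> K \<Longrightarrow> w \<in> K \<Longrightarrow> v + w \<in> K"
      "v \<in> K \<Longrightarrow> r *s v \<in> K" for v w r
    by (simp_all add: K_def P_0 P_diff P_add P_smult)
  define S where "S = cps_embed i ` {q. fps_conv_radius q > 0}"
  define I where "I = (UNIV :: 'a set) \<times> {..<m}"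
  \<comment> \<open>Coordinates over the series in s^m of the values of the entries. With scalars
    from \<open>S\<close>, the series in x_i, divisibility of coordinates is decided by order, as
    elimination requires.\<close>
  define c where "c = (\<lambda>(j, r) (v :: 2 cps ^ 'a). fps_component m r (cps_subst_fps g (v $ j)))"
  have c_embed: "c (j, r) (cps_embed i q *s v) = q * c (j, r) v" if "fps_conv_radius q > 0" "r < m" for j r q v
    using that by (simp add: c_def cps_subst_fps_mult g0 cps_subst_fps_embed m fps_component_mult)
  have c_conv: "fps_conv_radius (c p v) > 0" for p v
    unfolding c_def case_prod_unfold
    by (intro conv_radius_component conv_radius_cps_subst_fps g0 gc m)
  have "\<exists>w. (\<forall>p\<in>I. w p \<in> K) \<and> (\<forall>v\<in>K. \<exists>r. (\<forall>p\<in>I. r p \<in> S) \<and>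
    v - (\<Sum>p\<in>I. r p *s w p) \<in> K \<and> (\<forall>q\<in>I. c q (v - (\<Sum>p\<in>I. r p *s w p)) = 0))"
  proof (rule elimination)
    show "finite I" by (simp add: I_def)
    show "S \<noteq> {}" by (auto simp: S_def intro!: exI[of _ 0])
    show "c p (v - w) = c p v - c p w" for p v w
      by (simp add: c_def case_prod_unfold cps_subst_fps_diff fps_component_diff)
    show "c p (r *s v) = 0" if "p \<in> I" "r \<in> S" "c p v = 0" for p r v
      using that by (auto simp: I_def S_def c_embed)
    show "\<exists>r\<in>S. c p (r *s w) = c p v" if p: "p \<in> I" "c p w \<noteq> 0"
      "c p v \<noteq> 0 \<longrightarrow> subdegree (c p w) \<le> subdegree (c p v)" for p v w
    proof -
      obtain q where q: "fps_conv_radius q > 0" "c p v = q * c p w"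
        using convergent_fps_divide[OF c_conv c_conv p(2,3)] by blast
      then show ?thesis using p(1) by (auto simp: S_def I_def c_embed intro!: bexI[of _ "cps_embed i q"])
    qed
  qed (use K in auto)
  then obtain w where w: "(\<forall>p\<in>I. w p \<in> K) \<and> (\<forall>v\<in>K. \<exists>r. (\<forall>p\<in>I. r p \<in> S) \<and>
    v - (\<Sum>p\<in>I. r p *s w p) \<in> K \<and> (\<forall>q\<in>I. c q (v - (\<Sum>p\<in>I. r p *s w p)) = 0))" ..
  \<comment> \<open>Elimination sees the entries only modulo \<open>F\<close>, so the vectors
    \<open>axis j F\<close> have to be added.\<close>
  define W where "W = w ` I \<union> range (\<lambda>j. axis j F)"
  have FK: "axis j F \<in> K" for j
  proof -
    have "axis j F = F *s axis j 1" by (simp add: vec_eq_iff axis_def)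
    moreover have "cps_subst_fps g F = 0" using F[of F] by (metis mult_1)
    ultimately show ?thesis by (simp add: K_def P_smult)
  qed
  have W: "finite W" "W \<subseteq> K" using w FK by (auto simp: W_def I_def)
  have KW: "K \<subseteq> cps_vec.span W"
  proof
    fix v assume "v \<in> K"
    with w have "\<exists>r. (\<forall>p\<in>I. r p \<in> S) \<and> v - (\<Sum>p\<in>I. r p *s w p) \<in> K \<and>
        (\<forall>q\<in>I. c q (v - (\<Sum>p\<in>I. r p *s w p)) = 0)" by (elim conjE) (rule bspec)
    then obtain r where r: "\<forall>q\<in>I. c q (v - (\<Sum>p\<in>I. r p *s w p)) = 0" by (elim exE conjE)
    let ?u = "v - (\<Sum>p\<in>I. r p *s w p)"
    have "\<exists>t. ?u $ j = t * F" for j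
    proof -
      have "cps_subst_fps g (?u $ j) = 0"
      proof (rule fps_eq_0_if_components[OF m(1)])
        fix k assume "k < m"
        then have "c (j, k) ?u = 0" using r by (simp add: I_def)
        then show "fps_component m k (cps_subst_fps g (?u $ j)) = 0"
          by (simp only: c_def case_prod_conv)
      qed
      then show ?thesis by (simp only: F)
    qed
    then obtain t where t: "\<And>j. ?u $ j = t j * F" by metis
    have "?u = (\<Sum>j\<in>UNIV. ?u $ j *s axis j 1)" by (simp only: basis_expansion)
    also have "\<dots> = (\<Sum>j\<in>UNIV. t j *s axis j F)"
      unfolding t by (intro sum.cong refl) (simp add: vec_eq_iff axis_def)
    also have "\<dots> \<in> cps_vec.span W"
      by (intro cps_vec.span_sum cps_vec.span_scale cps_vec.span_base) (simp add: W_def)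
    finally have "?u \<in> cps_vec.span W" .
    moreover have "(\<Sum>p\<in>I. r p *s w p) \<in> cps_vec.span W"
      by (intro cps_vec.span_sum cps_vec.span_scale cps_vec.span_base) (simp add: W_def)
    ultimately have "?u + (\<Sum>p\<in>I. r p *s w p) \<in> cps_vec.span W" by (rule cps_vec.span_add)
    then show "v \<in> cps_vec.span W" by simp
  qed
  obtain i' where i': "i \<noteq> i'" using exhaust_2 by (metis zero_neq_one)
  define e where "e j v = restrict_axis i (v $ j)" for j and v :: "2 cps ^ 'a"
  have e_conv: "fps_conv_radius (e j v) > 0" for j v
    unfolding e_def restrict_axis_def by (intro conv_radius_cps_subst_fps) auto
  \<comment> \<open>A second elimination, modulo x_i and with all plane series as scalars. Now there
    is one coordinate per entry, which brings the number of generators down to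
    \<open>CARD('a)\<close>.\<close>
  have "\<exists>u :: 'a \<Rightarrow> 2 cps ^ 'a. (\<forall>j\<in>UNIV. u j \<in> K) \<and> (\<forall>v\<in>K. \<exists>r. (\<forall>j\<in>UNIV. r j \<in> UNIV) \<and>
    v - (\<Sum>j\<in>UNIV. r j *s u j) \<in> K \<and> (\<forall>l\<in>UNIV. e l (v - (\<Sum>j\<in>UNIV. r j *s u j)) = 0))"
  proof (rule elimination)
    show "\<exists>r\<in>UNIV. e j (r *s w) = e j v" if ew: "e j w \<noteq> 0"
      "e j v \<noteq> 0 \<longrightarrow> subdegree (e j w) \<le> subdegree (e j v)" for j v w
    proof -
      obtain q where q: "fps_conv_radius q > 0" "e j v = q * e j w"
        using convergent_fps_divide[OF e_conv e_conv ew] by blast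
      have "e j (cps_embed i' q *s w) = q * e j w"
        using i' q(1) by (simp add: e_def restrict_axis_mult) (simp add: restrict_axis_def cps_subst_fps_embed)
      then show ?thesis using q by auto
    qed
  qed (use K in \<open>auto simp: e_def restrict_axis_def cps_subst_fps_mult cps_subst_fps_diff\<close>)
  then obtain u :: "'a \<Rightarrow> 2 cps ^ 'a" where u: "(\<forall>j\<in>UNIV. u j \<in> K) \<and> (\<forall>v\<in>K. \<exists>r. (\<forall>j\<in>UNIV. r j \<in> UNIV) \<and>
    v - (\<Sum>j\<in>UNIV. r j *s u j) \<in> K \<and> (\<forall>l\<in>UNIV. e l (v - (\<Sum>j\<in>UNIV. r j *s u j)) = 0))" ..
  have "K \<subseteq> cps_vec.span (range u)"
  proof (rule nakayama[OF W, where x = "cps_var i"])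
    show "K \<subseteq> cps_vec.span (range u \<union> W)"
      using KW cps_vec.span_mono[of W "range u \<union> W"] by auto
    show "cps_coeff (cps_var i) 0 = 0" by simp
    fix v assume "v \<in> K"
    with u have "\<exists>r. (\<forall>j\<in>UNIV. r j \<in> UNIV) \<and> v - (\<Sum>j\<in>UNIV. r j *s u j) \<in> K \<and>
        (\<forall>l\<in>UNIV. e l (v - (\<Sum>j\<in>UNIV. r j *s u j)) = 0)" by (elim conjE) (rule bspec)
    then obtain r where "(\<forall>j\<in>UNIV. r j \<in> UNIV) \<and> v - (\<Sum>j\<in>UNIV. r j *s u j) \<in> K \<and>
        (\<forall>l\<in>UNIV. e l (v - (\<Sum>j\<in>UNIV. r j *s u j)) = 0)" ..
    then have r: "v - (\<Sum>j\<in>UNIV. r j *s u j) \<in> K" "\<And>l. e l (v - (\<Sum>j\<in>UNIV. r j *s u j)) = 0"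
      by simp_all
    let ?y = "v - (\<Sum>j\<in>UNIV. r j *s u j)"
    have "\<exists>t. ?y $ l = cps_var i * t" for l
      using r(2)[of l] unfolding e_def restrict_axis_eq_0_iff .
    then obtain t where t: "\<And>l. ?y $ l = cps_var i * t l" by metis
    have y: "?y = cps_var i *s (\<chi> l. t l)"
      unfolding vec_eq_iff by (simp only: t vector_smult_component vec_lambda_beta simp_thms)
    \<comment> \<open>x_i takes the nonzero value s^m, so a relation divisible by x_i is x_i times a
      relation: torsion-freeness in the form that Nakayama's lemma asks for.\<close>
    have "cps_subst_fps g (cps_var i) * P (\<chi> l. t l) = 0"
      using r(1) unfolding y by (simp add: K_def P_smult)
    then have "(\<chi> l. t l) \<in> K" using m by (simp add: K_def cps_subst_fps_var g0)
    moreover have "(\<Sum>j\<in>UNIV. r j *s u j) \<in> cps_vec.span (range u)"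
      by (intro cps_vec.span_sum cps_vec.span_scale cps_vec.span_base) simp
    moreover have "v = (\<Sum>j\<in>UNIV. r j *s u j) + cps_var i *s (\<chi> l. t l)"
      using y by (metis add_diff_eq add_diff_cancel_left')
    ultimately show "\<exists>s\<in>cps_vec.span (range u). \<exists>k\<in>K. v = s + cps_var i *s k" by blast
  qed
  define d :: "2 cps ^ 'a ^ 'a" where "d = (\<chi> a j. u j $ a)"
  have d: "d *v r = (\<Sum>j\<in>UNIV. r $ j *s u j)" for r
    by (simp add: vec_eq_iff matrix_vector_mult_def d_def mult.commute)
  have "cps_vec.span (range u) \<subseteq> range ((*v) d)"
  proof (rule cps_vec.span_minimal)
    have "u j = d *v axis j 1" for j
      by (simp add: vec_eq_iff matrix_vector_mult_def d_def axis_def if_distrib cong: if_cong)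
    then show "range u \<subseteq> range ((*v) d)" by auto
    show "cps_vec.subspace (range ((*v) d))"
      unfolding cps_vec.subspace_def
      by (auto simp flip: matrix_vector_right_distrib matrix_vector_mult_smult intro: image_eqI[of _ _ 0])
  qed
  moreover have "d *v r \<in> K" for r
    using u by (simp add: d K_def P_sum P_smult)
  ultimately have "range ((*v) d) = K" using \<open>K \<subseteq> cps_vec.span (range u)\<close> by auto
  then show ?thesis unfolding K_def by blast
qed

text \<open>\<open>F\<close> annihilates the module, so each \<open>F *s axis j 1\<close> is a
  relation; its coordinates in the columns of \<open>d\<close> form column \<open>j\<close> of
  \<open>h\<close>.\<close>

lemma kernel_matrix_factorization:
  fixes d :: "2 cps ^ 'a ^ 'a"
  assumes d: "range ((*v) d) = {v. P v = 0}" and F: "cps_subst_fps g F = 0" "F \<noteq> 0"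
  shows "\<exists>h. d ** h = mat F \<and> h ** d = mat F"
proof -
  have "F *s axis j 1 \<in> range ((*v) d)" for j by (simp add: d P_smult F)
  then have "\<exists>w. F *s axis j 1 = d *v w" for j by (simp add: image_iff)
  then obtain w where w: "\<And>j. F *s axis j 1 = d *v w j" by metis
  define h :: "2 cps ^ 'a ^ 'a" where "h = (\<chi> a j. w j $ a)"
  have "(d ** h) $ k $ j = (d *v w j) $ k" for k j
    by (simp add: matrix_matrix_mult_def matrix_vector_mult_def h_def)
  then have "d ** h = mat F"
    by (simp add: vec_eq_iff mat_def axis_def flip: w)
  then show ?thesis using matrix_cps2_inject F by blast
qed

end

section \<open>Lifting to free modules and uniqueness of minimal resolutions\<close>

lemma semilinear_lift:
  fixes P Q :: "2 cps ^ 'b \<Rightarrow> complex fps"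
  assumes "semilinear g P" "semilinear g Q" "range Q \<subseteq> range P"
  obtains \<phi> :: "2 cps ^ 'b ^ 'b" where "\<And>v. P (\<phi> *v v) = Q v"
proof -
  interpret P: semilinear g P by fact
  interpret Q: semilinear g Q by fact
  have "\<exists>w. Q (axis j 1) = P w" for j using assms(3) by (auto simp: image_subset_iff image_iff)
  then obtain w where w: "\<And>j. Q (axis j 1) = P (w j)" by metis
  show ?thesis
  proof (rule that)
    fix v
    have "(\<chi> a j. w j $ a) *v v = (\<Sum>j\<in>UNIV. v $ j *s w j)"
      by (simp add: vec_eq_iff matrix_vector_mult_def mult.commute)
    then show "P ((\<chi> a j. w j $ a) *v v) = Q v"
      by (simp add: P.P_sum P.P_smult Q.P_axis[of v] w)
  qed
qed

lemma matrix_lift: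
  fixes d e :: "'a :: comm_ring_1 ^ 'b ^ 'b"
  assumes "\<And>v. d *v v \<in> range ((*v) e)"
  obtains \<psi> where "d = e ** \<psi>"
proof -
  have "\<exists>w. d *v axis j 1 = e *v w" for j using assms by (auto simp: image_iff)
  then obtain w where w: "\<And>j. d *v axis j 1 = e *v w j" by metis
  have "d = e ** (\<chi> a j. w j $ a)"
  proof -
    have "d $ k $ j = (d *v axis j 1) $ k" for k j
      by (simp add: matrix_vector_mult_def axis_def if_distrib cong: if_cong)
    then show ?thesis
      unfolding w by (simp add: vec_eq_iff matrix_matrix_mult_def matrix_vector_mult_def)
  qed
  then show ?thesis using that by blast
qed

text \<open>\<open>A - mat 1\<close> factors through \<open>d\<close> and so vanishes modulo the
  maximal ideal. Meant for composites of lifts, which differ from the identity by relations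
  only.\<close>

lemma const_matrix_eq_1:
  fixes A d :: "2 cps ^ 'b ^ 'b"
  assumes "\<And>v. A *v v - v \<in> range ((*v) d)" "const_matrix d = 0"
  shows "const_matrix A = mat 1"
proof -
  obtain E where "A - mat 1 = d ** E"
    using matrix_lift[of "A - mat 1" d] assms(1) by (auto simp: matrix_vector_mult_diff_rdistrib)
  then have "const_matrix (A - mat 1) = const_matrix d ** const_matrix E"
    by (simp add: const_matrix_mult)
  then have "const_matrix (A - mat 1) = 0"
    by (simp add: assms(2) matrix_matrix_mult_def vec_eq_iff)
  moreover have "const_matrix (A - mat 1) = const_matrix A - const_matrix (mat 1 :: 2 cps ^ 'b ^ 'b)"
    unfolding const_matrix_def vec_eq_iff by (simp add: minus_cps.rep_eq)
  ultimately show ?thesis by (simp add: const_matrix_1)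
qed

text \<open>Lifts in both directions compose to matrices reducing to the identity, which makes
  \<phi> invertible. It induces \<psi> on the kernels, and injectivity of \<open>d\<close> and
  \<open>e\<close> makes \<psi> invertible too.\<close>

lemma minimal_resolutions_equivalent:
  fixes P Q :: "2 cps ^ 'b \<Rightarrow> complex fps" and d e :: "2 cps ^ 'b ^ 'b"
  assumes "semilinear g P" "semilinear g Q" "range Q = range P"
    and d: "range ((*v) d) = {v. Q v = 0}" "inj ((*v) d)" "const_matrix d = 0"
    and e: "range ((*v) e) = {v. P v = 0}" "inj ((*v) e)" "const_matrix e = 0"
  obtains \<phi> \<psi> where "invertible \<phi>" "invertible \<psi>" "\<phi> ** d = e ** \<psi>"
proof -
  interpret P: semilinear g P by fact
  interpret Q: semilinear g Q by fact
  obtain \<phi> where \<phi>: "\<And>v. P (\<phi> *v v) = Q v"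
    using semilinear_lift[OF assms(1,2)] assms(3) by auto
  obtain \<phi>' where \<phi>': "\<And>v. Q (\<phi>' *v v) = P v"
    using semilinear_lift[OF assms(2,1)] assms(3) by auto
  have "const_matrix (\<phi>' ** \<phi>) = mat 1"
    by (rule const_matrix_eq_1[OF _ d(3)])
       (simp add: d(1) Q.P_diff \<phi> \<phi>' flip: matrix_vector_mul_assoc)
  moreover have "const_matrix (\<phi> ** \<phi>') = mat 1"
    by (rule const_matrix_eq_1[OF _ e(3)])
       (simp add: e(1) P.P_diff \<phi> \<phi>' flip: matrix_vector_mul_assoc)
  ultimately have inv: "invertible \<phi>"
    using invertible_if_const_invertible by (metis const_matrix_mult)
  define \<phi>i where "\<phi>i = matrix_inv \<phi>"
  have \<phi>i: "\<phi> ** \<phi>i = mat 1" "\<phi>i ** \<phi> = mat 1" unfolding \<phi>i_def by (rule matrix_inv_mult[OF inv])+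
  have P\<phi>i: "Q (\<phi>i *v v) = P v" for v
    by (simp add: matrix_vector_mul_assoc \<phi>i flip: \<phi>)
  have lift: "(\<phi> ** d) *v v \<in> range ((*v) e)" for v
    using d(1) by (auto simp: e(1) \<phi> simp flip: matrix_vector_mul_assoc)
  obtain \<psi> where \<psi>: "\<phi> ** d = e ** \<psi>" using matrix_lift[OF lift] .
  have lift': "(\<phi>i ** e) *v v \<in> range ((*v) d)" for v
    using e(1) by (auto simp: d(1) P\<phi>i simp flip: matrix_vector_mul_assoc)
  obtain \<psi>' where \<psi>': "\<phi>i ** e = d ** \<psi>'" using matrix_lift[OF lift'] .
  have cancel: "A = B" if "inj ((*v) c)" "c ** A = c ** B" for A B c :: "2 cps ^ 'b ^ 'b"
  proof (rule matrix_eq_columns)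
    fix v show "A *v v = B *v v"
      using that by (metis injD matrix_vector_mul_assoc)
  qed
  have "d ** (\<psi>' ** \<psi>) = d ** mat 1"
    by (metis \<phi>i(2) \<psi> \<psi>' matrix_mul_assoc matrix_mul_lid matrix_mul_rid)
  then have 1: "\<psi>' ** \<psi> = mat 1" by (rule cancel[OF d(2)])
  have "e ** (\<psi> ** \<psi>') = e ** mat 1"
    by (metis \<phi>i(1) \<psi> \<psi>' matrix_mul_assoc matrix_mul_lid matrix_mul_rid)
  then have "\<psi> ** \<psi>' = mat 1" by (rule cancel[OF e(2)])
  with 1 have "invertible \<psi>" unfolding invertible_def by blast
  with inv \<psi> show ?thesis using that by blast
qed

text \<open>If \<open>f\<close> is linear and \<open>q = f 1\<close>, then \<open>q f (z z') = f z f z'\<close> by torsion-freeness; taking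
  for \<open>z = z'\<close> the preimage of 1 shows that \<open>q\<close> is a unit, and \<open>f / q\<close> is multiplicative.\<close>

lemma linear_iso_imp_algebra_iso:
  fixes \<gamma>1 \<gamma>2 :: "2 cps \<Rightarrow> complex fps"
  assumes B1: "1 \<in> B1" "\<And>z z'. z \<in> B1 \<Longrightarrow> z' \<in> B1 \<Longrightarrow> z * z' \<in> B1"
      "\<And>a z. z \<in> B1 \<Longrightarrow> \<gamma>1 a * z \<in> B1"
    and B2: "1 \<in> B2" "\<And>z z'. z \<in> B2 \<Longrightarrow> z' \<in> B2 \<Longrightarrow> z * z' \<in> B2"
    and f: "bij_betw f B1 B2" "\<And>z z'. z \<in> B1 \<Longrightarrow> z' \<in> B1 \<Longrightarrow> f (z + z') = f z + f z'"
      "\<And>a z. z \<in> B1 \<Longrightarrow> f (\<gamma>1 a * z) = \<gamma>2 a * f z"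
    and frac: "\<And>z. z \<in> B1 \<Longrightarrow> \<exists>a a'. \<gamma>1 a' \<noteq> 0 \<and> \<gamma>1 a' * z = \<gamma>1 a"
    and ker: "\<And>a. \<gamma>1 a = 0 \<longleftrightarrow> \<gamma>2 a = 0"
  obtains g where "bij_betw g B1 B2" "g 1 = 1" "\<And>z z'. z \<in> B1 \<Longrightarrow> z' \<in> B1 \<Longrightarrow> g (z + z') = g z + g z'"
    "\<And>z z'. z \<in> B1 \<Longrightarrow> z' \<in> B1 \<Longrightarrow> g (z * z') = g z * g z'"
    "\<And>a z. z \<in> B1 \<Longrightarrow> g (\<gamma>1 a * z) = \<gamma>2 a * g z"
proof -
  define q where "q = f 1"
  have fB: "f z \<in> B2" if "z \<in> B1" for z using f(1) that by (rule bij_betw_apply)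
  have mult: "q * f (z * z') = f z * f z'" if z: "z \<in> B1" "z' \<in> B1" for z z'
  proof -
    \<comment> \<open>As a fraction, \<open>z\<close> is itself a scalar, so \<open>f\<close> must
      treat it like one up to the factor \<open>q\<close>.\<close>
    obtain a a' where a: "\<gamma>1 a' \<noteq> 0" "\<gamma>1 a' * z = \<gamma>1 a" using frac[OF z(1)] by blast
    have "f (\<gamma>1 a' * z) = f (\<gamma>1 a * 1)" by (simp add: a)
    then have 1: "\<gamma>2 a' * f z = \<gamma>2 a * q" unfolding f(3)[OF z(1)] f(3)[OF B1(1)] q_def .
    have "f (\<gamma>1 a' * (z * z')) = f (\<gamma>1 a * z')" by (simp add: a flip: mult.assoc)
    then have 2: "\<gamma>2 a' * f (z * z') = \<gamma>2 a * f z'"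
      unfolding f(3)[OF B1(2)[OF z]] f(3)[OF z(2)] .
    have "\<gamma>2 a' * (q * f (z * z')) = q * (\<gamma>2 a' * f (z * z'))" by (simp add: mult_ac)
    also have "\<dots> = (\<gamma>2 a * q) * f z'" unfolding 2 by (simp add: mult_ac)
    also have "\<dots> = \<gamma>2 a' * (f z * f z')" unfolding 1[symmetric] by (simp add: mult_ac)
    finally show ?thesis using a(1) ker by simp
  qed
  obtain z0 where z0: "z0 \<in> B1" "f z0 = 1" using f(1) B2(1) by (auto simp: bij_betw_def)
  define p where "p = f (z0 * z0)"
  have p: "q * p = 1" "p \<in> B2" "q \<in> B2"
    using mult[OF z0(1) z0(1)] z0 fB B1 by (auto simp: p_def q_def)
  have "bij_betw (\<lambda>w. p * w) B2 B2"
    by (rule bij_betwI[where g = "\<lambda>w. q * w"])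
       (use p B2 in \<open>auto simp flip: mult.assoc simp: mult.commute[of p q]\<close>)
  then have bij: "bij_betw (\<lambda>z. p * f z) B1 B2"
    using bij_betw_trans[OF f(1)] by (simp add: o_def)
  show ?thesis
  proof (rule that[OF bij])
    show "p * f 1 = 1" using p by (simp add: q_def mult.commute)
    show "p * f (z + z') = p * f z + p * f z'" if "z \<in> B1" "z' \<in> B1" for z z'
      using that by (simp add: f algebra_simps)
    show "p * f (z * z') = p * f z * (p * f z')" if "z \<in> B1" "z' \<in> B1" for z z'
    proof -
      have "p * f z * (p * f z') = p * p * (q * f (z * z'))" using that by (simp add: mult mult_ac)
      also have "\<dots> = (q * p) * (p * f (z * z'))" by (simp add: mult_ac)
      finally show ?thesis by (simp only: p mult_1_left)
    qed
    show "p * f (\<gamma>1 a * z) = \<gamma>2 a * (p * f z)" if "z \<in> B1" for a z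
      unfolding f(3)[OF that] by (simp add: mult_ac)
  qed
qed

section \<open>Local rings of projected curves\<close>

lemma cps_coset: "I +>\<^bsub>cps_ring\<^esub> a = (\<lambda>i. i + a) ` I"
  by (auto simp: a_r_coset_def r_coset_def cps_ring_def)

text \<open>Cosets of a kernel are fibres; a class is known by the one series to which all its
  members evaluate.\<close>

lemma cps_coset_kernel:
  assumes "I = {a. cps_subst_fps f a = 0}"
  shows "I +>\<^bsub>cps_ring\<^esub> a = {b. cps_subst_fps f b = cps_subst_fps f a}"
proof -
  have "b \<in> (\<lambda>i. i + a) ` I" if "cps_subst_fps f b = cps_subst_fps f a" for b
    using that by (intro image_eqI[of _ _ "b - a"]) (auto simp: assms cps_subst_fps_diff)
  then show ?thesis unfolding cps_coset by (auto simp: assms cps_subst_fps_add)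
qed

lemma free_module_coset: "N +>\<^bsub>free_module\<^esub> v = (\<lambda>w. w + v) ` N"
  by (auto simp: a_r_coset_def r_coset_def free_module_def)

lemma carrier_local_ring: "carrier (local_ring I) = range (\<lambda>a. I +>\<^bsub>cps_ring\<^esub> a)"
  by (auto simp: local_ring_def FactRing_def A_RCOSETS_def RCOSETS_def a_r_coset_def cps_ring_def)

lemma cgenideal_cps_ring: "cgenideal cps_ring F = {a. \<exists>t. a = t * F}"
  by (auto simp: cgenideal_def cps_ring_def)

text \<open>Fixes a parameter in which coordinate \<open>i\<close> of the projection is s^m. Other
  curves over the same branch come with their own parameters and exponents, but share
  \<open>Y\<close> and \<open>F\<close>.\<close>

locale curve_projection =
  fixes f :: "'n :: finite \<Rightarrow> complex fps" and X :: "'n cps set" and L :: "complex ^ 'n ^ 2"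
    and Y :: "2 cps set" and F :: "2 cps" and i :: 2 and m :: nat
  assumes param: "parametrizes f X" and generic: "L \<in> generic_forms X"
    and Y: "projection_germ L X = Y" and YF: "Y = cgenideal cps_ring F" and F0: "F \<noteq> 0"
    and m: "m > 0" "proj_param L f i = fps_X ^ m"
begin

text \<open>\<open>B\<close> is O_X realised as a ring of series, \<open>cl z\<close> the coset with
  value \<open>z\<close>, and \<gamma> gives the action of plane series on \<open>B\<close>.\<close>

abbreviation "\<sigma> \<equiv> cps_subst_fps f"
abbreviation "\<gamma> \<equiv> cps_subst_fps (proj_param L f)"
abbreviation "cl z \<equiv> {a. \<sigma> a = z}"
abbreviation "B \<equiv> range \<sigma>"
abbreviation "M \<equiv> local_algebra X L"

lemma f: "fps_conv_radius (f j) > 0" "fps_nth (f j) 0 = 0"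
  using param by (auto simp: parametrizes_def)

lemma g: "fps_conv_radius (proj_param L f k) > 0" "fps_nth (proj_param L f k) 0 = 0"
  using conv_radius_proj_param[OF f(1)] proj_param_nth_0[of f, OF f(2)] by auto

lemmas \<sigma> = cps_subst_fps_add cps_subst_fps_diff cps_subst_fps_sum cps_subst_fps_mult[of f, OF f(2)]
  cps_subst_fps_1[of f, OF f(2)] cps_subst_fps_pullback[of f, OF f(2)]
lemmas \<gamma> = cps_subst_fps_add cps_subst_fps_diff cps_subst_fps_sum
  cps_subst_fps_mult[of "proj_param L f", OF g(2)] cps_subst_fps_1[of "proj_param L f", OF g(2)]

lemma X_eq: "X = {a. \<sigma> a = 0}"
  using param by (simp add: parametrizes_def)

lemma Y_eq: "Y = {a. \<gamma> a = 0}"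
  using Y by (simp add: projection_germ_def X_eq \<sigma> set_eq_iff)

lemma \<gamma>_eq_0_iff: "\<gamma> a = 0 \<longleftrightarrow> (\<exists>t. a = t * F)"
  using Y_eq YF by (auto simp: cgenideal_cps_ring set_eq_iff)

lemma X_coset: "X +>\<^bsub>cps_ring\<^esub> a = cl (\<sigma> a)"
  by (rule cps_coset_kernel[OF X_eq])

lemma Y_coset: "Y +>\<^bsub>cps_ring\<^esub> a = {b. \<gamma> b = \<gamma> a}"
  by (rule cps_coset_kernel[OF Y_eq])

lemma carrier_M: "carrier M = cl ` B"
  by (auto simp: local_algebra_def carrier_local_ring X_coset)

lemma zero_M: "\<zero>\<^bsub>M\<^esub> = cl 0"
  by (simp add: local_algebra_def local_ring_def FactRing_def X_eq)

lemma one_M: "\<one>\<^bsub>M\<^esub> = cl 1"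
proof -
  have "\<one>\<^bsub>M\<^esub> = X +>\<^bsub>cps_ring\<^esub> 1"
    by (simp add: local_algebra_def local_ring_def FactRing_def cps_ring_def)
  then show ?thesis by (simp add: X_coset \<sigma>)
qed

lemma add_M: "z \<in> B \<Longrightarrow> w \<in> B \<Longrightarrow> cl z \<oplus>\<^bsub>M\<^esub> cl w = cl (z + w)"
proof -
  assume "z \<in> B" "w \<in> B"
  then obtain a b where ab: "z = \<sigma> a" "w = \<sigma> b" by auto
  have "cl z \<oplus>\<^bsub>M\<^esub> cl w = {c + d | c d. \<sigma> c = z \<and> \<sigma> d = w}"
    by (auto simp: local_algebra_def local_ring_def FactRing_def set_add_def set_mult_def cps_ring_def)
  also have "\<dots> = cl (z + w)"
  proof -
    have "\<exists>c d. e = c + d \<and> \<sigma> c = z \<and> \<sigma> d = w" if "\<sigma> e = z + w" for e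
      using that ab by (intro exI[of _ a] exI[of _ "e - a"]) (simp add: \<sigma>)
    then show ?thesis by (auto simp: \<sigma>)
  qed
  finally show ?thesis .
qed

lemma mult_M: "z \<in> B \<Longrightarrow> w \<in> B \<Longrightarrow> cl z \<otimes>\<^bsub>M\<^esub> cl w = cl (z * w)"
proof -
  assume "z \<in> B" "w \<in> B"
  then obtain a b where ab: "z = \<sigma> a" "w = \<sigma> b" by auto
  have "cl z \<otimes>\<^bsub>M\<^esub> cl w = (\<Union>c\<in>cl z. \<Union>d\<in>cl w. X +>\<^bsub>cps_ring\<^esub> (c * d))"
    by (simp add: local_algebra_def local_ring_def FactRing_def rcoset_mult_def cps_ring_def)
  also have "\<dots> = cl (z * w)"
    using ab by (auto simp: X_coset \<sigma>)
  finally show ?thesis .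
qed

lemma smult_M: "z \<in> B \<Longrightarrow> (Y +>\<^bsub>cps_ring\<^esub> a) \<odot>\<^bsub>M\<^esub> cl z = cl (\<gamma> a * z)"
proof -
  assume "z \<in> B"
  then obtain b where b: "z = \<sigma> b" by auto
  have "(Y +>\<^bsub>cps_ring\<^esub> a) \<odot>\<^bsub>M\<^esub> cl z
      = (\<Union>c\<in>Y +>\<^bsub>cps_ring\<^esub> a. \<Union>d\<in>cl z. X +>\<^bsub>cps_ring\<^esub> (pullback L c * d))"
    by (simp add: local_algebra_def)
  also have "\<dots> = cl (\<gamma> a * z)"
    using b by (auto simp: X_coset Y_coset \<sigma>)
  finally show ?thesis .
qed

lemma B_closed: "1 \<in> B" "0 \<in> B" "z \<in> B \<Longrightarrow> w \<in> B \<Longrightarrow> z + w \<in> B" "z \<in> B \<Longrightarrow> w \<in> B \<Longrightarrow> z * w \<in> B"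
  "z \<in> B \<Longrightarrow> \<gamma> a * z \<in> B" "(\<And>j. j \<in> J \<Longrightarrow> h j \<in> B) \<Longrightarrow> sum h J \<in> B"
proof -
  show *: "1 \<in> B" "0 \<in> B" using \<sigma>(5) cps_subst_fps_0 by (metis rangeI)+
  show **: "z + w \<in> B" if "z \<in> B" "w \<in> B" for z w
    using that by (auto simp flip: \<sigma>(1))
  show ***: "z * w \<in> B" if "z \<in> B" "w \<in> B" for z w
    using that by (auto simp flip: \<sigma>(4))
  show "\<gamma> a * z \<in> B" if "z \<in> B" for a z
    using ***[OF _ that, of "\<gamma> a"] by (simp flip: \<sigma>(6))
  show "(\<And>j. j \<in> J \<Longrightarrow> h j \<in> B) \<Longrightarrow> sum h J \<in> B"
    by (induction J rule: infinite_finite_induct) (use * ** in auto)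
qed

lemma cl_inject: "z \<in> B \<Longrightarrow> cl z = cl w \<Longrightarrow> z = w"
  by auto

lemma cl_carrier: "z \<in> B \<Longrightarrow> cl z \<in> carrier M"
  by (simp add: carrier_M)

text \<open>The choice is harmless: \<sigma> is constant on each coset, so this inverts
  \<open>cl\<close> on \<open>B\<close>.\<close>

definition coset_val :: "'n cps set \<Rightarrow> complex fps" where
  "coset_val C = \<sigma> (SOME a. a \<in> C)"

lemma coset_val_cl: "z \<in> B \<Longrightarrow> coset_val (cl z) = z"
  unfolding coset_val_def using someI_ex[of "\<lambda>a. a \<in> cl z"] by auto

lemma carrier_M_E:
  assumes "C \<in> carrier M"
  obtains "coset_val C \<in> B" "C = cl (coset_val C)"
  using assms unfolding carrier_M by (auto simp: coset_val_cl)

lemma bij_coset_val: "bij_betw coset_val (carrier M) B"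
  by (rule bij_betwI[where g = cl]) (auto simp: carrier_M coset_val_cl)

lemma bij_cl: "bij_betw cl B (carrier M)"
  by (rule bij_betwI[where g = coset_val]) (auto simp: carrier_M coset_val_cl)

subsection \<open>Fractions and generators\<close>

lemma common_denominator: "\<exists>\<Delta>. \<Delta> \<noteq> 0 \<and> (\<forall>z\<in>B. \<exists>a. \<gamma> a = \<Delta> * z)"
proof -
  obtain \<Delta> where "\<Delta> \<noteq> 0" "\<And>h. fps_conv_radius h > 0 \<Longrightarrow> \<exists>a. \<gamma> a = \<Delta> * h"
    using generic_projection_conductor[OF param generic m] by blast
  then show ?thesis using conv_radius_cps_subst_fps[of f, OF f(2,1)] by (intro exI[of _ \<Delta>]) auto
qed

lemma fraction: assumes "z \<in> B" shows "\<exists>a a'. \<gamma> a' \<noteq> 0 \<and> \<gamma> a' * z = \<gamma> a"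
proof -
  obtain \<Delta> where \<Delta>: "\<Delta> \<noteq> 0" "\<And>z. z \<in> B \<Longrightarrow> \<exists>a. \<gamma> a = \<Delta> * z"
    using common_denominator by blast
  \<comment> \<open>As 1 lies in \<open>B\<close>, the denominator \<Delta> is itself a value of
    \<gamma>.\<close>
  obtain a a' where "\<gamma> a = \<Delta> * z" "\<gamma> a' = \<Delta> * 1"
    using \<Delta>(2)[OF assms] \<Delta>(2)[OF B_closed(1)] by blast
  then show ?thesis using \<Delta>(1) by (intro exI[of _ a] exI[of _ a']) simp
qed

definition gspan :: "complex fps set \<Rightarrow> complex fps set" where
  "gspan S = {z. \<exists>a. z = (\<Sum>s\<in>S. \<gamma> (a s) * s)}"

lemma gspan_closed: "0 \<in> gspan S" "z \<in> gspan S \<Longrightarrow> w \<in> gspan S \<Longrightarrow> z + w \<in> gspan S"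
  "z \<in> gspan S \<Longrightarrow> \<gamma> a * z \<in> gspan S" "finite S \<Longrightarrow> s \<in> S \<Longrightarrow> s \<in> gspan S"
  "(\<And>j. j \<in> J \<Longrightarrow> h j \<in> gspan S) \<Longrightarrow> sum h J \<in> gspan S"
proof -
  show 0: "0 \<in> gspan S" by (auto simp: gspan_def intro!: exI[of _ "\<lambda>_. 0"])
  show add: "z + w \<in> gspan S" if zw: "z \<in> gspan S" "w \<in> gspan S" for z w
  proof -
    obtain a b where "z = (\<Sum>s\<in>S. \<gamma> (a s) * s)" "w = (\<Sum>s\<in>S. \<gamma> (b s) * s)"
      using zw unfolding gspan_def by blast
    then have "z + w = (\<Sum>s\<in>S. \<gamma> (a s + b s) * s)"
      by (simp add: \<gamma>(1) distrib_right sum.distrib)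
    then show ?thesis by (auto simp: gspan_def)
  qed
  show "\<gamma> a * z \<in> gspan S" if z: "z \<in> gspan S"
  proof -
    obtain b where "z = (\<Sum>s\<in>S. \<gamma> (b s) * s)" using z unfolding gspan_def by blast
    then have "\<gamma> a * z = (\<Sum>s\<in>S. \<gamma> (a * b s) * s)"
      by (simp add: \<gamma>(4) sum_distrib_left mult_ac)
    then show ?thesis by (auto simp: gspan_def)
  qed
  show "s \<in> gspan S" if "finite S" "s \<in> S"
  proof -
    have "(\<Sum>t\<in>S. \<gamma> (if t = s then 1 else 0) * t) = (\<Sum>t\<in>S. if t = s then s else 0)"
      by (intro sum.cong) (auto simp: \<gamma>(5))
    then show ?thesis using that by (auto simp: gspan_def intro!: exI[of _ "\<lambda>t. if t = s then 1 else 0"])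
  qed
  show "(\<And>j. j \<in> J \<Longrightarrow> h j \<in> gspan S) \<Longrightarrow> sum h J \<in> gspan S"
    by (induction J rule: infinite_finite_induct) (use 0 add in auto)
qed

text \<open>With \<open>\<le>\<close> the predicate is monotone in \<open>k\<close>, so minimality
  of a positive \<open>k\<close> is failure at \<open>k - 1\<close>.\<close>

definition generated_by :: "nat \<Rightarrow> bool" where
  "generated_by k \<longleftrightarrow> (\<exists>S. finite S \<and> card S \<le> k \<and> S \<subseteq> B \<and> B \<subseteq> gspan S)"

lemma submodule_M:
  assumes "T \<subseteq> B" "0 \<in> T" "\<And>z w. z \<in> T \<Longrightarrow> w \<in> T \<Longrightarrow> z + w \<in> T" "\<And>a z. z \<in> T \<Longrightarrow> \<gamma> a * z \<in> T"
  shows "submodule (cl ` T) (local_ring Y) M"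
proof -
  have "subgroup (cl ` T) (add_monoid M)"
  proof (unfold_locales)
    show "cl ` T \<subseteq> carrier (add_monoid M)" using assms(1) by (auto simp: carrier_M)
    show "x \<otimes>\<^bsub>add_monoid M\<^esub> y \<in> cl ` T" if "x \<in> cl ` T" "y \<in> cl ` T" for x y
      using that assms(1,3) add_M by (auto simp: subset_iff)
    show "\<one>\<^bsub>add_monoid M\<^esub> \<in> cl ` T" using assms(2) by (auto simp: zero_M)
    show "inv\<^bsub>add_monoid M\<^esub> x \<in> cl ` T" if x: "x \<in> cl ` T" for x
    proof -
      obtain z where z: "z \<in> T" "x = cl z" using x by blast
      have "\<gamma> (- 1) * z = - z" by (simp add: cps_subst_fps_uminus \<gamma>(5))
      then have mz: "- z \<in> T" using assms(4)[OF z(1), of "- 1"] by simp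
      have "inv\<^bsub>add_monoid M\<^esub> x = cl (- z)"
        unfolding m_inv_def
      proof (rule the_equality)
        show "cl (- z) \<in> carrier (add_monoid M) \<and> x \<otimes>\<^bsub>add_monoid M\<^esub> cl (- z) = \<one>\<^bsub>add_monoid M\<^esub> \<and>
            cl (- z) \<otimes>\<^bsub>add_monoid M\<^esub> x = \<one>\<^bsub>add_monoid M\<^esub>"
          using z mz assms(1) by (auto simp: add_M zero_M cl_carrier subset_iff)
        fix y assume y: "y \<in> carrier (add_monoid M) \<and> x \<otimes>\<^bsub>add_monoid M\<^esub> y = \<one>\<^bsub>add_monoid M\<^esub> \<and>
            y \<otimes>\<^bsub>add_monoid M\<^esub> x = \<one>\<^bsub>add_monoid M\<^esub>"
        then obtain w where w: "w \<in> B" "y = cl w" by (auto simp: carrier_M)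
        have zB: "z \<in> B" using z assms(1) by auto
        have "cl (z + w) = cl 0" using y w z zB by (simp add: add_M zero_M)
        then have "z + w = 0" using cl_inject B_closed(3)[OF zB w(1)] by blast
        then have "w = - z" by (simp add: eq_neg_iff_add_eq_0 add.commute)
        then show "y = cl (- z)" using w by simp
      qed
      then show ?thesis using mz by simp
    qed
  qed
  moreover have "submodule_axioms (cl ` T) (local_ring Y) M"
    unfolding submodule_axioms_def using assms(1,4) smult_M
    by (auto simp: carrier_local_ring subset_iff)
  ultimately show ?thesis by (rule submodule.intro)
qed

text \<open>Generation by an intersection of submodules is matched with linear combinations of
  series: one direction tests the intersection against the span itself, the other puts all partial
  sums into every submodule.\<close>

lemma min_generators_le_iff: "min_generators (local_ring Y) M \<le> enat k \<longleftrightarrow> generated_by k"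
proof
  assume le: "min_generators (local_ring Y) M \<le> enat k"
  have "\<exists>S. finite S \<and> S \<subseteq> carrier M \<and> \<Inter> {N. submodule N (local_ring Y) M \<and> S \<subseteq> N} = carrier M \<and> card S \<le> k"
  proof (rule ccontr)
    assume no: "\<not> ?thesis"
    \<comment> \<open>Every competitor then has at least \<open>Suc k\<close> elements; an empty
      family has infinite infimum and fits as well.\<close>
    then have "enat (Suc k) \<le> min_generators (local_ring Y) M"
      unfolding min_generators_def
    proof (intro INF_greatest)
      fix S assume S: "S \<in> {S. finite S \<and> S \<subseteq> carrier M \<and>
        \<Inter> {N. submodule N (local_ring Y) M \<and> S \<subseteq> N} = carrier M}"
      then have "\<not> card S \<le> k" using no by blast
      then show "enat (Suc k) \<le> enat (card S)" by simp
    qed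
    with le have "enat (Suc k) \<le> enat k" by (rule order_trans[rotated])
    then show False by simp
  qed
  then obtain S where S: "finite S" "S \<subseteq> carrier M" "card S \<le> k"
    "\<Inter> {N. submodule N (local_ring Y) M \<and> S \<subseteq> N} = carrier M" by blast
  define T where "T = coset_val ` S"
  have T: "finite T" "card T \<le> k" "T \<subseteq> B"
    using S bij_betw_apply[OF bij_coset_val] card_image_le[OF S(1), of coset_val] by (auto simp: T_def)
  define G where "G = gspan T \<inter> B"
  have "submodule (cl ` G) (local_ring Y) M"
    by (rule submodule_M) (auto simp: G_def intro: gspan_closed B_closed)
  moreover have "S \<subseteq> cl ` G"
  proof
    fix C assume C: "C \<in> S"
    then have "C \<in> carrier M" using S by auto
    then have "coset_val C \<in> B" "C = cl (coset_val C)" by (auto elim: carrier_M_E)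
    then show "C \<in> cl ` G" using C T(1) by (auto simp: G_def T_def intro!: image_eqI[of _ _ "coset_val C"] gspan_closed(4))
  qed
  ultimately have "carrier M \<subseteq> cl ` G" using S(4) by blast
  have "B \<subseteq> gspan T"
  proof
    fix z assume z: "z \<in> B"
    then obtain w where w: "w \<in> G" "cl z = cl w"
      using \<open>carrier M \<subseteq> cl ` G\<close> cl_carrier[OF z] by (auto simp: subset_iff image_iff)
    then show "z \<in> gspan T" using cl_inject[OF z w(2)] by (simp add: G_def)
  qed
  then show "generated_by k" unfolding generated_by_def using T by blast
next
  assume "generated_by k"
  then obtain S where S: "finite S" "card S \<le> k" "S \<subseteq> B" "B \<subseteq> gspan S" unfolding generated_by_def by blast
  let ?S = "cl ` S"
  have "\<Inter> {N. submodule N (local_ring Y) M \<and> ?S \<subseteq> N} = carrier M"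
  proof
    have "submodule (cl ` B) (local_ring Y) M"
      by (rule submodule_M) (auto intro: B_closed)
    then show "\<Inter> {N. submodule N (local_ring Y) M \<and> ?S \<subseteq> N} \<subseteq> carrier M"
      unfolding carrier_M using image_mono[OF S(3), of cl] by (intro Inter_lower) simp
    show "carrier M \<subseteq> \<Inter> {N. submodule N (local_ring Y) M \<and> ?S \<subseteq> N}"
    proof (intro subsetI InterI)
      fix C N assume C: "C \<in> carrier M" and N: "N \<in> {N. submodule N (local_ring Y) M \<and> ?S \<subseteq> N}"
      then interpret N: submodule N "local_ring Y" M by simp
      obtain a where a: "coset_val C = (\<Sum>s\<in>S. \<gamma> (a s) * s)" "C = cl (coset_val C)"
        using C S(4) by (elim carrier_M_E) (auto simp: gspan_def)
      have "cl (\<Sum>s\<in>R. \<gamma> (a s) * s) \<in> N" if "R \<subseteq> S" for R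
        using finite_subset[OF that S(1)] that
      proof (induction R rule: finite_induct)
        case empty
        then show ?case using N.one_closed by (simp add: zero_M)
      next
        case (insert x R)
        have "cl (\<gamma> (a x) * x) \<in> N"
        proof -
          have "(Y +>\<^bsub>cps_ring\<^esub> a x) \<odot>\<^bsub>M\<^esub> cl x \<in> N"
            by (rule N.smult_closed) (use N insert in \<open>auto simp: carrier_local_ring\<close>)
          then show ?thesis using insert S(3) by (auto simp: smult_M)
        qed
        then have "cl (\<gamma> (a x) * x) \<oplus>\<^bsub>M\<^esub> cl (\<Sum>s\<in>R. \<gamma> (a s) * s) \<in> N"
          using N.m_closed insert by auto
        moreover have "\<gamma> (a x) * x \<in> B" "(\<Sum>s\<in>R. \<gamma> (a s) * s) \<in> B"
          using insert S(3) by (auto intro!: B_closed(5,6))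
        ultimately show ?case using insert.hyps by (simp add: add_M)
      qed
      from this[of S] show "C \<in> N" using a by simp
    qed
  qed
  then have "min_generators (local_ring Y) M \<le> enat (card ?S)"
    unfolding min_generators_def using S(1,3) by (intro INF_lower) (auto simp: carrier_M)
  also have "\<dots> \<le> enat k" using card_image_le[OF S(1), of cl] S(2) by simp
  finally show "min_generators (local_ring Y) M \<le> enat k" .
qed

lemma min_generators_eq_iff:
  "k > 0 \<Longrightarrow> min_generators (local_ring Y) M = enat k \<longleftrightarrow> generated_by k \<and> \<not> generated_by (k - 1)"
  unfolding min_generators_le_iff[symmetric]
  by (cases "min_generators (local_ring Y) M") auto

end

section \<open>Cokernels of matrix factorizations\<close>

definition coker_class :: "2 cps ^ 'b ^ 'b \<Rightarrow> 2 cps ^ 'b \<Rightarrow> (2 cps ^ 'b) set" where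
  "coker_class d v = {w. w - v \<in> range ((*v) d)}"

lemma range_matrix_closed:
  fixes d :: "'a :: comm_ring_1 ^ 'n ^ 'm"
  shows "v \<in> range ((*v) d) \<Longrightarrow> w \<in> range ((*v) d) \<Longrightarrow> v + w \<in> range ((*v) d)"
    "v \<in> range ((*v) d) \<Longrightarrow> w \<in> range ((*v) d) \<Longrightarrow> v - w \<in> range ((*v) d)"
    "v \<in> range ((*v) d) \<Longrightarrow> a *s v \<in> range ((*v) d)" "0 \<in> range ((*v) d)"
  by (auto simp flip: matrix_vector_right_distrib matrix_vector_mult_diff_distrib matrix_vector_mult_smult
      intro: image_eqI[of _ _ 0])

lemma coker_class_eq_iff:
  fixes d :: "2 cps ^ 'b ^ 'b"
  shows "coker_class d v = coker_class d w \<longleftrightarrow> v - w \<in> range ((*v) d)"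
proof
  assume "coker_class d v = coker_class d w"
  moreover have "v \<in> coker_class d v" by (simp add: coker_class_def range_matrix_closed(4))
  ultimately show "v - w \<in> range ((*v) d)" by (simp add: coker_class_def)
next
  assume vw: "v - w \<in> range ((*v) d)"
  have "u - v \<in> range ((*v) d) \<longleftrightarrow> u - w \<in> range ((*v) d)" for u
    using range_matrix_closed(1)[OF _ vw, of "u - v"] range_matrix_closed(2)[OF _ vw, of "u - w"] by auto
  then show "coker_class d v = coker_class d w" by (simp add: coker_class_def)
qed

lemma coker_class_mem: "v \<in> coker_class d v"
  by (simp add: coker_class_def range_matrix_closed(4))

lemma coker_coset: "range ((*v) d) +>\<^bsub>free_module\<^esub> v = coker_class d v"
proof -
  have "w \<in> (\<lambda>u. u + v) ` range ((*v) d)" if "w - v \<in> range ((*v) d)" for w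
    using that by (intro image_eqI[of w _ "w - v"]) simp_all
  then show ?thesis unfolding free_module_coset coker_class_def by auto
qed

lemma carrier_coker: "carrier (coker d) = range (coker_class d)"
proof -
  have "carrier (coker d) = range (\<lambda>v. range ((*v) d) +>\<^bsub>free_module\<^esub> v)"
    by (auto simp: coker_def A_RCOSETS_def RCOSETS_def a_r_coset_def free_module_def)
  then show ?thesis by (simp add: coker_coset)
qed

lemma add_coker: "coker_class d v \<oplus>\<^bsub>coker d\<^esub> coker_class d w = coker_class d (v + w)"
proof -
  have "coker_class d v \<oplus>\<^bsub>coker d\<^esub> coker_class d w = {x + y | x y. x \<in> coker_class d v \<and> y \<in> coker_class d w}"
    by (auto simp: coker_def set_add_def set_mult_def free_module_def)
  also have "\<dots> = coker_class d (v + w)"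
  proof
    show "{x + y | x y. x \<in> coker_class d v \<and> y \<in> coker_class d w} \<subseteq> coker_class d (v + w)"
    proof clarify
      fix x y assume "x \<in> coker_class d v" "y \<in> coker_class d w"
      then have "(x - v) + (y - w) \<in> range ((*v) d)"
        unfolding coker_class_def by (intro range_matrix_closed(1)) auto
      then show "x + y \<in> coker_class d (v + w)" by (simp add: coker_class_def algebra_simps)
    qed
    show "coker_class d (v + w) \<subseteq> {x + y | x y. x \<in> coker_class d v \<and> y \<in> coker_class d w}"
    proof
      fix u assume "u \<in> coker_class d (v + w)"
      then have "u - w \<in> coker_class d v" by (simp add: coker_class_def algebra_simps)
      moreover have "u = (u - w) + w" by simp
      ultimately show "u \<in> {x + y | x y. x \<in> coker_class d v \<and> y \<in> coker_class d w}"
        using coker_class_mem by blast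
    qed
  qed
  finally show ?thesis .
qed

context curve_projection
begin

lemma \<gamma>_F: "\<gamma> F = 0"
  using \<gamma>_eq_0_iff[of F] by (metis mult_1)

text \<open>Two representatives of a class differ by a multiple of \<open>F\<close>, and
  \<open>F *s v = d *v (h *v v)\<close> lies in the image of \<open>d\<close>.\<close>

lemma smult_coker:
  assumes dh: "d ** h = mat F"
  shows "(Y +>\<^bsub>cps_ring\<^esub> a) \<odot>\<^bsub>coker d\<^esub> coker_class d v = coker_class d (a *s v)"
proof -
  have eq: "coker_class d (b *s w) = coker_class d (a *s v)"
    if b: "b \<in> Y +>\<^bsub>cps_ring\<^esub> a" and w: "w \<in> coker_class d v" for b w
  proof -
    have "\<gamma> (b - a) = 0" using b by (simp add: Y_coset \<gamma>)
    then obtain t where t: "b - a = t * F" by (auto simp: \<gamma>_eq_0_iff)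
    have "F *s v = d *v (h *v v)" by (simp add: matrix_vector_mul_assoc dh mat_mult_vector)
    then have "F *s v \<in> range ((*v) d)" by (metis rangeI)
    then have "t *s (F *s v) \<in> range ((*v) d)" by (rule range_matrix_closed(3))
    then have "(b - a) *s v \<in> range ((*v) d)" by (simp add: t vector_smult_assoc)
    moreover have "b *s (w - v) \<in> range ((*v) d)"
      using w by (intro range_matrix_closed(3)) (simp add: coker_class_def)
    ultimately have "b *s (w - v) + (b - a) *s v \<in> range ((*v) d)" by (intro range_matrix_closed(1))
    moreover have "b *s (w - v) + (b - a) *s v = b *s w - a *s v"
      by (simp add: vec_eq_iff algebra_simps)
    ultimately show ?thesis by (simp add: coker_class_eq_iff)
  qed
  have "a \<in> Y +>\<^bsub>cps_ring\<^esub> a" by (simp add: Y_coset)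
  have "(Y +>\<^bsub>cps_ring\<^esub> a) \<odot>\<^bsub>coker d\<^esub> coker_class d v
      = (\<Union>b\<in>Y +>\<^bsub>cps_ring\<^esub> a. \<Union>w\<in>coker_class d v. coker_class d (b *s w))"
    by (simp add: coker_def coker_coset)
  also have "\<dots> = coker_class d (a *s v)"
    using eq \<open>a \<in> Y +>\<^bsub>cps_ring\<^esub> a\<close> coker_class_mem[of v d] by blast
  finally show ?thesis .
qed

subsection \<open>Minimal resolutions\<close>

text \<open>\<open>minimal_free_resolution\<close> with the augmentation valued in series instead of
  cosets, so that differences and kernels can be computed. \<open>const_matrix d = 0\<close> is the
  minimality.\<close>

definition is_resolution :: "2 cps ^ 'b ^ 'b \<Rightarrow> (2 cps ^ 'b \<Rightarrow> complex fps) \<Rightarrow> bool" where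
  "is_resolution d P \<longleftrightarrow> semilinear (proj_param L f) P \<and> range P = B \<and>
     range ((*v) d) = {v. P v = 0} \<and> inj ((*v) d) \<and> const_matrix d = 0"

lemma const_matrix_eq_0_iff:
  fixes d :: "2 cps ^ 'b ^ 'c"
  shows "const_matrix d = 0 \<longleftrightarrow> (\<forall>i j. d $ i $ j \<in> xy_ideal)"
  by (simp add: const_matrix_def vec_eq_iff xy_ideal_eq)

lemma resolution_coset_val:
  assumes "minimal_free_resolution Y X L d p"
  shows "is_resolution d (\<lambda>v. coset_val (p v))"
proof -
  have p: "p (v + w) = p v \<oplus>\<^bsub>M\<^esub> p w" "p (a *s v) = (Y +>\<^bsub>cps_ring\<^esub> a) \<odot>\<^bsub>M\<^esub> p v"
    "range p = carrier M" "range ((*v) d) = {v. p v = \<zero>\<^bsub>M\<^esub>}" "inj ((*v) d)"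
    "\<forall>i j. d $ i $ j \<in> xy_ideal" for v w a
    using assms unfolding minimal_free_resolution_def by simp_all
  have P: "coset_val (p v) \<in> B" "p v = cl (coset_val (p v))" for v
    using p(3) carrier_M_E[of "p v"] by blast+
  have "semilinear (proj_param L f) (\<lambda>v. coset_val (p v))"
  proof
    show "coset_val (p (v + w)) = coset_val (p v) + coset_val (p w)" for v w
    proof -
      have "p (v + w) = cl (coset_val (p v)) \<oplus>\<^bsub>M\<^esub> cl (coset_val (p w))" using p(1) P(2) by simp
      also have "\<dots> = cl (coset_val (p v) + coset_val (p w))" by (rule add_M[OF P(1) P(1)])
      finally show ?thesis using P(1) by (simp add: coset_val_cl B_closed(3))
    qed
    show "coset_val (p (a *s v)) = \<gamma> a * coset_val (p v)" for a v
    proof -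
      have "p (a *s v) = (Y +>\<^bsub>cps_ring\<^esub> a) \<odot>\<^bsub>M\<^esub> cl (coset_val (p v))" using p(2) P(2) by simp
      also have "\<dots> = cl (\<gamma> a * coset_val (p v))" by (rule smult_M[OF P(1)])
      finally show ?thesis using P(1) by (simp add: coset_val_cl B_closed(5))
    qed
  qed (rule g(2))
  moreover have "range (\<lambda>v. coset_val (p v)) = B"
  proof -
    have "range (\<lambda>v. coset_val (p v)) = coset_val ` range p" by auto
    then show ?thesis using bij_coset_val by (simp add: p(3) bij_betw_def)
  qed
  moreover have "p v = \<zero>\<^bsub>M\<^esub> \<longleftrightarrow> coset_val (p v) = 0" for v
    using P[of v] coset_val_cl[OF B_closed(2)] by (metis zero_M)
  ultimately show ?thesis
    unfolding is_resolution_def const_matrix_eq_0_iff using p by simp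
qed

lemma resolution_cl:
  assumes "is_resolution d P"
  shows "minimal_free_resolution Y X L d (\<lambda>v. cl (P v))"
proof -
  have P: "semilinear (proj_param L f) P" "range P = B" "range ((*v) d) = {v. P v = 0}"
      "inj ((*v) d)" "\<forall>i j. d $ i $ j \<in> xy_ideal"
    using assms unfolding is_resolution_def const_matrix_eq_0_iff by blast+
  interpret semilinear "proj_param L f" P by fact
  have PB: "P v \<in> B" for v using P(2) by blast
  have "cl (P v) = \<zero>\<^bsub>M\<^esub> \<longleftrightarrow> P v = 0" for v
  proof
    assume "cl (P v) = \<zero>\<^bsub>M\<^esub>"
    then have "cl (P v) = cl 0" by (simp only: zero_M)
    then show "P v = 0" by (rule cl_inject[OF PB])
  qed (simp only: zero_M)
  moreover have "range (\<lambda>v. cl (P v)) = carrier M"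
    unfolding carrier_M P(2)[symmetric] by auto
  ultimately show ?thesis
    unfolding minimal_free_resolution_def using P
    by (auto simp: P_add P_smult add_M[OF PB PB] smult_M[OF PB])
qed

text \<open>A unit coefficient would express one generator by the remaining
  \<open>CARD('b) - 1\<close>.\<close>

lemma relations_nonunit:
  fixes P :: "2 cps ^ 'b \<Rightarrow> complex fps"
  assumes P: "semilinear (proj_param L f) P" "range P = B"
    and min: "\<not> generated_by (CARD('b) - 1)" and v: "P v = 0"
  shows "cps_coeff (v $ j) 0 = 0"
proof (rule ccontr)
  assume "cps_coeff (v $ j) 0 \<noteq> 0"
  then obtain e where e: "v $ j * e = 1" using cps_unit by blast
  interpret semilinear "proj_param L f" P by fact
  define S where "S = (\<lambda>l. P (axis l 1)) ` (UNIV - {j})"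
  have S: "finite S" "card S \<le> CARD('b) - 1" "S \<subseteq> B"
    using P(2) card_image_le[of "UNIV - {j}" "\<lambda>l. P (axis l 1)"] by (auto simp: S_def)
  have Sl: "P (axis l 1) \<in> gspan S" if "l \<noteq> j" for l
    using that S(1) by (intro gspan_closed(4)) (auto simp: S_def)
  have "0 = \<gamma> e * P v" using v by simp
  also have "\<dots> = (\<Sum>l\<in>UNIV. \<gamma> (e * v $ l) * P (axis l 1))"
    by (subst P_axis) (simp add: sum_distrib_left \<gamma>(4) mult_ac)
  also have "\<dots> = \<gamma> (e * v $ j) * P (axis j 1) + (\<Sum>l\<in>UNIV - {j}. \<gamma> (e * v $ l) * P (axis l 1))"
    by (subst sum.remove[of _ j]) auto
  also have "\<gamma> (e * v $ j) = 1" using e by (simp add: mult.commute \<gamma>(5))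
  finally have "P (axis j 1) = - (\<Sum>l\<in>UNIV - {j}. \<gamma> (e * v $ l) * P (axis l 1))"
    by (simp add: eq_neg_iff_add_eq_0)
  also have "\<dots> = (\<Sum>l\<in>UNIV - {j}. \<gamma> (- (e * v $ l)) * P (axis l 1))"
    by (simp add: sum_negf cps_subst_fps_uminus)
  also have "\<dots> \<in> gspan S" by (intro gspan_closed(5) gspan_closed(3) Sl) auto
  finally have "P (axis l 1) \<in> gspan S" for l using Sl by (cases "l = j") auto
  then have "P w \<in> gspan S" for w
    by (subst P_axis) (intro gspan_closed(5) gspan_closed(3))
  then have "B \<subseteq> gspan S" unfolding P(2)[symmetric] by auto
  then show False using min S unfolding generated_by_def by blast
qed

lemma resolution_exists:
  assumes gen: "generated_by CARD('b)" and min: "\<not> generated_by (CARD('b) - 1)"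
  shows "\<exists>(d :: 2 cps ^ 'b ^ 'b) h P. is_resolution d P \<and> matrix_factorization F (d, h)"
proof -
  obtain S where S: "finite S" "card S \<le> CARD('b)" "S \<subseteq> B" "B \<subseteq> gspan S"
    using gen unfolding generated_by_def by blast
  obtain k where k: "inj_on k S" "k ` S \<subseteq> (UNIV :: 'b set)"
    using card_le_inj[OF S(1) finite_class.finite_UNIV S(2)] by blast
  \<comment> \<open>The generators are indexed through the injection \<open>k\<close>; if
    \<open>S\<close> has fewer than \<open>CARD('b)\<close> elements, surplus basis vectors are sent
    to 0.\<close>
  define u where "u j = (if j \<in> k ` S then inv_into S k j else 0)" for j
  have uk: "u (k s) = s" if "s \<in> S" for s using that k(1) by (simp add: u_def)
  have uB: "u j \<in> B" for j using S(3) k(1) B_closed(2) by (auto simp: u_def inv_into_f_f)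
  define P where "P v = (\<Sum>j\<in>UNIV. \<gamma> (v $ j) * u j)" for v :: "2 cps ^ 'b"
  have P: "semilinear (proj_param L f) P"
  proof
    show "P (v + w) = P v + P w" for v w
      by (simp add: P_def \<gamma>(1) distrib_right sum.distrib)
    show "P (a *s v) = \<gamma> a * P v" for a v
      by (simp add: P_def \<gamma>(4) sum_distrib_left mult.assoc)
  qed (rule g(2))
  interpret semilinear "proj_param L f" P by fact
  have rP: "range P = B"
  proof
    show "range P \<subseteq> B" using uB by (auto simp: P_def intro!: B_closed(5,6))
    show "B \<subseteq> range P"
    proof
      fix z assume "z \<in> B"
      then obtain a where a: "z = (\<Sum>s\<in>S. \<gamma> (a s) * s)" using S(4) unfolding gspan_def by blast
      have "P (\<chi> j. a (u j)) = (\<Sum>j\<in>k ` S. \<gamma> (a (u j)) * u j)"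
        unfolding P_def by (intro sum.mono_neutral_cong_right) (auto simp: u_def)
      also have "\<dots> = z" using k(1) by (simp add: sum.reindex uk a)
      finally show "z \<in> range P" by (metis rangeI)
    qed
  qed
  obtain d :: "2 cps ^ 'b ^ 'b" where d: "range ((*v) d) = {v. P v = 0}"
    using kernel_eq_range_matrix[OF g(1) m \<gamma>_eq_0_iff] by blast
  obtain h where h: "d ** h = mat F" "h ** d = mat F"
    using kernel_matrix_factorization[OF d \<gamma>_F F0] by blast
  have "const_matrix d = 0"
  proof -
    have "d $ k $ j = (d *v axis j 1) $ k" for k j
      by (simp add: matrix_vector_mult_def axis_def if_distrib cong: if_cong)
    moreover have "cps_coeff ((d *v axis j 1) $ k) 0 = 0" for k j
      using d by (intro relations_nonunit[OF P rP min]) auto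
    ultimately show ?thesis by (simp add: const_matrix_def vec_eq_iff)
  qed
  then have "is_resolution d P"
    unfolding is_resolution_def using P rP d matrix_cps2_inject(2)[OF h(1) F0] by blast
  then show ?thesis using h unfolding matrix_factorization_def by auto
qed

text \<open>A unit entry of \<open>h\<close> would give a functional on \<open>B\<close> with values in the local ring of \<open>Y\<close>
  that takes the value 1; as \<open>B\<close> has rank one, \<open>B\<close> would be cyclic.\<close>

lemma cofactor_nonunit:
  fixes d h :: "2 cps ^ 'b ^ 'b"
  assumes res: "is_resolution d P" and hd: "h ** d = mat F" and min: "\<not> generated_by 1"
  shows "const_matrix h = 0"
proof (rule ccontr)
  have P: "semilinear (proj_param L f) P" "range P = B" "range ((*v) d) = {v. P v = 0}"
    using res unfolding is_resolution_def by blast+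
  interpret semilinear "proj_param L f" P by fact
  assume "const_matrix h \<noteq> 0"
  then obtain i k where "cps_coeff (h $ i $ k) 0 \<noteq> 0" by (auto simp: const_matrix_def vec_eq_iff)
  then obtain e where e: "h $ i $ k * e = 1" using cps_unit by blast
  \<comment> \<open>Row \<open>i\<close> of \<open>h\<close>. Since \<open>h ** d = mat F\<close>,
    it takes relations to multiples of \<open>F\<close>, which makes it a functional on
    \<open>B\<close>.\<close>
  define \<eta> where "\<eta> v = (h *v v) $ i" for v
  have \<eta>: "\<eta> (v - w) = \<eta> v - \<eta> w" "\<eta> (a *s v) = a * \<eta> v" for v w a
    by (simp_all add: \<eta>_def matrix_vector_mult_diff_distrib matrix_vector_mult_smult)
  have \<eta>0: "\<gamma> (\<eta> v) = 0" if Pv: "P v = 0" for v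
  proof -
    obtain w where "v = d *v w" using P(3) Pv by blast
    then have "\<eta> v = w $ i * F"
      by (simp add: \<eta>_def matrix_vector_mul_assoc hd mat_mult_vector mult.commute)
    then show ?thesis by (simp add: \<gamma> \<gamma>_F)
  qed
  define \<beta> where "\<beta> = e *s (axis k 1 :: 2 cps ^ 'b)"
  have "\<eta> (axis k 1) = h $ i $ k"
    by (simp add: \<eta>_def matrix_vector_mult_def axis_def if_distrib cong: if_cong)
  then have \<beta>: "\<eta> \<beta> = 1" using e by (simp add: \<beta>_def \<eta> mult.commute)
  obtain \<Delta> where \<Delta>: "\<Delta> \<noteq> 0" "\<And>z. z \<in> B \<Longrightarrow> \<exists>a. \<gamma> a = \<Delta> * z" using common_denominator by blast
  have PB: "P v \<in> B" for v using P(2) by blast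
  have "P v = \<gamma> (\<eta> v) * P \<beta>" for v
  proof (rule ccontr)
    assume neq: "P v \<noteq> \<gamma> (\<eta> v) * P \<beta>"
    \<comment> \<open>\<eta> vanishes on \<open>w\<close>, yet a common denominator makes
      \<open>a *s \<beta> - c *s w\<close> a relation. Applying \<eta> gives
      \<open>\<gamma> a = 0\<close>, against \<open>P w \<noteq> 0\<close>.\<close>
    define w where "w = v - \<eta> v *s \<beta>"
    have w: "P w \<noteq> 0" "\<eta> w = 0" using neq by (auto simp: w_def P_diff P_smult \<eta> \<beta>)
    obtain a c where a: "\<gamma> a = \<Delta> * P w" "\<gamma> c = \<Delta> * P \<beta>" using \<Delta>(2)[OF PB] by metis
    have "P (a *s \<beta> - c *s w) = 0" by (simp add: P_diff P_smult a)
    then have "\<gamma> (\<eta> (a *s \<beta> - c *s w)) = 0" by (rule \<eta>0)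
    then have "\<gamma> a = 0" by (simp add: \<eta> \<beta> w)
    then show False using a(1) \<Delta>(1) w(1) by simp
  qed
  then have "B \<subseteq> gspan {P \<beta>}"
    unfolding P(2)[symmetric] by (metis gspan_closed(3,4) finite.emptyI finite.insertI image_subsetI insertI1)
  then have "generated_by 1" unfolding generated_by_def using PB by (intro exI[of _ "{P \<beta>}"]) auto
  then show False using min by blast
qed

text \<open>Relations reduce to 0 modulo the maximal ideal because \<open>d\<close> does. Preimages
  of a generating set therefore reduce to a spanning set of C^b, which has at least b
  elements.\<close>

lemma resolution_generators:
  fixes d :: "2 cps ^ 'b ^ 'b"
  assumes res: "is_resolution d P"
  shows "generated_by CARD('b)" "\<not> generated_by (CARD('b) - 1)"
proof -
  have P: "semilinear (proj_param L f) P" "range P = B" "range ((*v) d) = {v. P v = 0}" "const_matrix d = 0"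
    using res unfolding is_resolution_def by blast+
  interpret semilinear "proj_param L f" P by fact
  have PB: "P v \<in> B" for v using P(2) by blast
  let ?S = "range (\<lambda>l. P (axis l 1))"
  have "P w \<in> gspan ?S" for w
    by (subst P_axis) (intro gspan_closed(5) gspan_closed(3) gspan_closed(4); simp)
  then have "B \<subseteq> gspan ?S" unfolding P(2)[symmetric] by auto
  moreover have "card ?S \<le> CARD('b)" by (rule card_image_le) simp
  ultimately show "generated_by CARD('b)"
    unfolding generated_by_def using PB by (intro exI[of _ ?S]) auto
  show "\<not> generated_by (CARD('b) - 1)"
  proof
    assume "generated_by (CARD('b) - 1)"
    then obtain S where S: "finite S" "card S \<le> CARD('b) - 1" "S \<subseteq> B" "B \<subseteq> gspan S"
      unfolding generated_by_def by blast
    have "\<exists>v. P v = s" if "s \<in> S" for s using S(3) that P(2) by (metis rangeE subsetD)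
    then obtain v where v: "\<And>s. s \<in> S \<Longrightarrow> P (v s) = s" by metis
    define c :: "2 cps ^ 'b \<Rightarrow> complex ^ 'b" where "c w = (\<chi> j. cps_coeff (w $ j) 0)" for w
    have c0: "c w = 0" if Pw: "P w = 0" for w
    proof -
      obtain x where "w = d *v x" using P(3) Pw by blast
      moreover have "cps_coeff (d $ i $ j) 0 = 0" for i j
        using P(4) by (simp add: const_matrix_def vec_eq_iff)
      ultimately show ?thesis
        by (simp add: c_def vec_eq_iff matrix_vector_mult_def cps_coeff_sum cps_coeff_mult_0)
    qed
    have "axis j 1 \<in> vec.span (c ` v ` S)" for j
    proof -
      obtain a where a: "P (axis j 1) = (\<Sum>s\<in>S. \<gamma> (a s) * s)" using PB S(4) unfolding gspan_def by blast
      define w where "w = (\<Sum>s\<in>S. a s *s v s)"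
      have "P (axis j 1 - w) = 0"
        by (simp add: w_def P_diff P_sum P_smult a v)
      then have "c (axis j 1 - w) = 0" by (rule c0)
      then have "axis j 1 = c w"
        by (auto simp: c_def vec_eq_iff minus_cps.rep_eq axis_def one_cps.rep_eq zero_cps.rep_eq split: if_splits)
      also have "c w = (\<Sum>s\<in>S. cps_coeff (a s) 0 *s c (v s))"
        by (simp add: c_def w_def vec_eq_iff cps_coeff_sum cps_coeff_mult_0)
      also have "\<dots> \<in> vec.span (c ` v ` S)"
        by (intro vec.span_sum vec.span_scale vec.span_base) auto
      finally show ?thesis .
    qed
    then have "(\<Sum>j\<in>UNIV. y $ j *s axis j 1) \<in> vec.span (c ` v ` S)" for y :: "complex ^ 'b"
      by (intro vec.span_sum vec.span_scale)
    then have "(UNIV :: (complex ^ 'b) set) \<subseteq> vec.span (c ` v ` S)" unfolding basis_expansion by auto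
    then have "vec.dim (UNIV :: (complex ^ 'b) set) \<le> card (c ` v ` S)"
      using S(1) by (intro vec.dim_le_card) auto
    also have "\<dots> \<le> card S" by (metis card_image_le finite_imageI S(1) le_trans)
    finally have "CARD('b) \<le> card S" by (simp add: vec_dim_card card_cart_basis)
    \<comment> \<open>Subtraction of natural numbers is truncated, so positivity is what makes
      \<open>CARD('b) - 1\<close> smaller than \<open>CARD('b)\<close>.\<close>
    moreover have "CARD('b) > 0" by simp
    ultimately show False using S(2) by linarith
  qed
qed

section \<open>Resolutions and isomorphisms with the cokernel\<close>

lemma coker_iso_of_resolution:
  assumes res: "is_resolution d P" and dh: "d ** h = mat F"
  shows "module_iso (local_ring Y) (coker d) M \<noteq> {}"
proof -
  have P: "semilinear (proj_param L f) P" "range P = B" "range ((*v) d) = {v. P v = 0}"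
    using res unfolding is_resolution_def by blast+
  interpret semilinear "proj_param L f" P by fact
  have PB: "P v \<in> B" for v using P(2) by blast
  define \<theta> where "\<theta> C = cl (P (SOME v. v \<in> C))" for C
  have \<theta>: "\<theta> (coker_class d v) = cl (P v)" for v
  proof -
    have "(SOME w. w \<in> coker_class d v) \<in> coker_class d v"
      using coker_class_mem by (rule someI)
    then have "P ((SOME w. w \<in> coker_class d v) - v) = 0" by (auto simp: coker_class_def P(3))
    then show ?thesis by (simp add: \<theta>_def P_diff)
  qed
  have "\<theta> \<in> module_iso (local_ring Y) (coker d) M"
    unfolding module_iso_def mem_Collect_eq
  proof (intro conjI ballI)
    show "bij_betw \<theta> (carrier (coker d)) (carrier M)"
      unfolding bij_betw_def
    proof
      show "inj_on \<theta> (carrier (coker d))"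
        unfolding carrier_coker
      proof (rule inj_onI, clarify)
        fix v w assume "\<theta> (coker_class d v) = \<theta> (coker_class d w)"
        then have "P v = P w" unfolding \<theta> by (rule cl_inject[OF PB])
        then show "coker_class d v = coker_class d w" by (simp add: coker_class_eq_iff P(3) P_diff)
      qed
      have "\<theta> ` range (coker_class d) = cl ` range P" by (auto simp: \<theta> image_image)
      then show "\<theta> ` carrier (coker d) = carrier M" by (simp add: carrier_coker carrier_M P(2))
    qed
    show "\<theta> (x \<oplus>\<^bsub>coker d\<^esub> y) = \<theta> x \<oplus>\<^bsub>M\<^esub> \<theta> y" if "x \<in> carrier (coker d)" "y \<in> carrier (coker d)" for x y
      using that by (auto simp: carrier_coker add_coker \<theta> add_M[OF PB PB] P_add)
    show "\<theta> (a \<odot>\<^bsub>coker d\<^esub> x) = a \<odot>\<^bsub>M\<^esub> \<theta> x" if "a \<in> carrier (local_ring Y)" "x \<in> carrier (coker d)" for a x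
      using that by (auto simp: carrier_coker carrier_local_ring smult_coker[OF dh] \<theta> smult_M[OF PB] P_smult)
  qed
  then show ?thesis by blast
qed

text \<open>Preceding \<theta> by the projection onto the cokernel gives a surjection whose kernel
  is the image of \<open>d\<close>; injectivity of \<open>d\<close> comes from
  \<open>d ** h = mat F\<close>.\<close>

lemma resolution_of_coker_iso:
  assumes iso: "\<theta> \<in> module_iso (local_ring Y) (coker d) M" and dh: "d ** h = mat F"
    and d0: "const_matrix d = 0"
  shows "is_resolution d (\<lambda>v. coset_val (\<theta> (coker_class d v)))"
proof -
  let ?p = "\<lambda>v. \<theta> (coker_class d v)" and ?P = "\<lambda>v. coset_val (\<theta> (coker_class d v))"
  have \<theta>: "bij_betw \<theta> (range (coker_class d)) (carrier M)"
    "\<theta> (coker_class d v \<oplus>\<^bsub>coker d\<^esub> coker_class d w) = ?p v \<oplus>\<^bsub>M\<^esub> ?p w"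
    "\<theta> ((Y +>\<^bsub>cps_ring\<^esub> a) \<odot>\<^bsub>coker d\<^esub> coker_class d v) = (Y +>\<^bsub>cps_ring\<^esub> a) \<odot>\<^bsub>M\<^esub> ?p v" for v w a
    using iso unfolding module_iso_def carrier_coker carrier_local_ring by auto
  have pM: "?p v \<in> carrier M" for v using \<theta>(1) by (auto simp: bij_betw_def)
  have P: "?P v \<in> B" "?p v = cl (?P v)" for v
    using carrier_M_E[OF pM[of v]] by blast+
  have "semilinear (proj_param L f) ?P"
  proof
    show "?P (v + w) = ?P v + ?P w" for v w
    proof -
      have "?p (v + w) = cl (?P v) \<oplus>\<^bsub>M\<^esub> cl (?P w)" using \<theta>(2)[of v w] P(2) by (simp add: add_coker)
      also have "\<dots> = cl (?P v + ?P w)" by (rule add_M[OF P(1) P(1)])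
      finally show ?thesis using P(1) by (simp add: coset_val_cl B_closed(3))
    qed
    show "?P (a *s v) = \<gamma> a * ?P v" for a v
    proof -
      have "?p (a *s v) = (Y +>\<^bsub>cps_ring\<^esub> a) \<odot>\<^bsub>M\<^esub> cl (?P v)"
        using \<theta>(3)[of a v] P(2) by (simp add: smult_coker[OF dh])
      also have "\<dots> = cl (\<gamma> a * ?P v)" by (rule smult_M[OF P(1)])
      finally show ?thesis using P(1) by (simp add: coset_val_cl B_closed(5))
    qed
  qed (rule g(2))
  then interpret semilinear "proj_param L f" ?P .
  have "range ?P = coset_val ` \<theta> ` range (coker_class d)" by (simp add: image_image)
  also have "\<dots> = B" using \<theta>(1) bij_coset_val by (simp add: bij_betw_def)
  finally have "range ?P = B" .
  moreover have "?P v = 0 \<longleftrightarrow> v \<in> range ((*v) d)" for v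
  proof -
    have "?P v = 0 \<longleftrightarrow> ?p v = ?p 0" using P P_0 by metis
    also have "\<dots> \<longleftrightarrow> coker_class d v = coker_class d 0"
      using \<theta>(1) by (auto simp: bij_betw_def dest: inj_onD)
    finally show ?thesis by (simp add: coker_class_eq_iff)
  qed
  ultimately show ?thesis
    unfolding is_resolution_def using semilinear_axioms d0 matrix_cps2_inject(2)[OF dh F0] by blast
qed

end

section \<open>Orbits and algebra isomorphisms\<close>

lemma gl_orbitI: "invertible \<phi> \<Longrightarrow> invertible \<psi> \<Longrightarrow> gl_act (\<phi>, \<psi>) m \<in> gl_orbit m"
  unfolding gl_orbit_def by blast

lemma gl_act_1:
  fixes m :: "'b :: finite mat_pair"
  shows "gl_act (mat 1, mat 1) m = m"
proof -
  have "matrix_inv (mat 1 :: 2 cps ^ 'b ^ 'b) = mat 1" by (rule matrix_inv_unique_comm) simp_all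
  then show ?thesis by (cases m) (simp add: gl_act_def)
qed

lemma gl_orbit_self:
  fixes m :: "'b :: finite mat_pair"
  shows "m \<in> gl_orbit m"
proof -
  have "invertible (mat 1 :: 2 cps ^ 'b ^ 'b)" by (auto simp: invertible_def intro!: exI[of _ "mat 1"])
  then show ?thesis using gl_orbitI[of "mat 1" "mat 1" m] by (simp add: gl_act_1)
qed

lemma invertible_matrix_mult:
  fixes A B :: "'a :: comm_ring_1 ^ 'n ^ 'n"
  assumes "invertible A" "invertible B"
  shows "invertible (A ** B)" "matrix_inv (A ** B) = matrix_inv B ** matrix_inv A"
proof -
  note i = matrix_inv_mult[OF assms(1)] matrix_inv_mult[OF assms(2)]
  have *: "(A ** B) ** (matrix_inv B ** matrix_inv A) = mat 1"
    "(matrix_inv B ** matrix_inv A) ** (A ** B) = mat 1"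
    by (metis i matrix_mul_assoc matrix_mul_rid)+
  then show "invertible (A ** B)" unfolding invertible_def by blast
  show "matrix_inv (A ** B) = matrix_inv B ** matrix_inv A" by (rule matrix_inv_unique_comm[OF *])
qed

lemma invertible_matrix_inv:
  fixes A :: "'a :: comm_ring_1 ^ 'n ^ 'n"
  assumes "invertible A"
  shows "invertible (matrix_inv A)" "matrix_inv (matrix_inv A) = A"
  using matrix_inv_mult[OF assms] by (auto simp: invertible_def intro: matrix_inv_unique_comm)

lemma gl_orbit_trans: "m2 \<in> gl_orbit m1 \<Longrightarrow> m3 \<in> gl_orbit m2 \<Longrightarrow> m3 \<in> gl_orbit m1"
proof -
  assume "m2 \<in> gl_orbit m1" "m3 \<in> gl_orbit m2"
  then obtain a b c e where "invertible a" "invertible b" "m2 = gl_act (a, b) m1"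
    "invertible c" "invertible e" "m3 = gl_act (c, e) m2" unfolding gl_orbit_def by blast
  then show ?thesis
    using gl_orbitI[of "c ** a" "e ** b" m1]
    by (cases m1) (simp add: gl_act_def invertible_matrix_mult matrix_mul_assoc)
qed

lemma gl_orbit_sym: "m2 \<in> gl_orbit m1 \<Longrightarrow> m1 \<in> gl_orbit m2"
proof -
  assume "m2 \<in> gl_orbit m1"
  then obtain a b where ab: "invertible a" "invertible b" "m2 = gl_act (a, b) m1"
    unfolding gl_orbit_def by blast
  obtain d h where m1: "m1 = (d, h)" by fastforce
  note i = matrix_inv_mult[OF ab(1)] matrix_inv_mult[OF ab(2)]
  have "matrix_inv a ** (a ** d ** matrix_inv b) ** b = d"
    by (metis i matrix_mul_assoc matrix_mul_lid matrix_mul_rid)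
  moreover have "matrix_inv b ** (b ** h ** matrix_inv a) ** a = h"
    by (metis i matrix_mul_assoc matrix_mul_lid matrix_mul_rid)
  ultimately have "gl_act (matrix_inv a, matrix_inv b) m2 = m1"
    by (simp add: ab m1 gl_act_def invertible_matrix_inv)
  then show ?thesis
    using gl_orbitI[of "matrix_inv a" "matrix_inv b" m2] ab invertible_matrix_inv(1) by metis
qed

lemma gl_orbit_eq_iff: "gl_orbit m1 = gl_orbit m2 \<longleftrightarrow> m2 \<in> gl_orbit m1"
  using gl_orbit_self gl_orbit_sym gl_orbit_trans by blast

section \<open>Comparison of two curves over the same plane branch\<close>

locale two_curve_projections =
  C1: curve_projection f1 X1 L1 Y F i1 m1 + C2: curve_projection f2 X2 L2 Y F i2 m2
  for f1 :: "'n :: finite \<Rightarrow> complex fps" and X1 L1 and f2 :: "'n \<Rightarrow> complex fps" and X2 L2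
    and Y F i1 m1 i2 m2
begin

text \<open>Following \<open>P1\<close> by \<theta> yields a second minimal presentation of the
  second local ring, with matrix \<open>d1\<close>, so uniqueness of minimal resolutions
  applies.\<close>

lemma module_iso_imp_same_orbit:
  fixes d1 h1 d2 h2 :: "2 cps ^ 'b ^ 'b"
  assumes iso: "\<theta> \<in> module_iso (local_ring Y) (local_algebra X1 L1) (local_algebra X2 L2)"
    and r1: "C1.is_resolution d1 P1" "d1 ** h1 = mat F"
    and r2: "C2.is_resolution d2 P2" "d2 ** h2 = mat F"
  shows "(d2, h2) \<in> gl_orbit (d1, h1)"
proof -
  have P1: "semilinear (proj_param L1 f1) P1" "range P1 = C1.B" "range ((*v) d1) = {v. P1 v = 0}"
    "inj ((*v) d1)" "const_matrix d1 = 0"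
    using r1 unfolding C1.is_resolution_def by blast+
  have P2: "semilinear (proj_param L2 f2) P2" "range P2 = C2.B" "range ((*v) d2) = {v. P2 v = 0}"
    "inj ((*v) d2)" "const_matrix d2 = 0"
    using r2 unfolding C2.is_resolution_def by blast+
  interpret P1: semilinear "proj_param L1 f1" P1 by fact
  interpret P2: semilinear "proj_param L2 f2" P2 by fact
  have PB: "P1 v \<in> C1.B" for v using P1(2) by blast
  have \<theta>: "bij_betw \<theta> (carrier (local_algebra X1 L1)) (carrier (local_algebra X2 L2))"
    "\<And>x y. x \<in> carrier (local_algebra X1 L1) \<Longrightarrow> y \<in> carrier (local_algebra X1 L1) \<Longrightarrow>
      \<theta> (x \<oplus>\<^bsub>local_algebra X1 L1\<^esub> y) = \<theta> x \<oplus>\<^bsub>local_algebra X2 L2\<^esub> \<theta> y"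
    "\<And>a x. x \<in> carrier (local_algebra X1 L1) \<Longrightarrow>
      \<theta> ((Y +>\<^bsub>cps_ring\<^esub> a) \<odot>\<^bsub>local_algebra X1 L1\<^esub> x) = (Y +>\<^bsub>cps_ring\<^esub> a) \<odot>\<^bsub>local_algebra X2 L2\<^esub> \<theta> x"
    using iso unfolding module_iso_def carrier_local_ring by auto
  define q where "q v = \<theta> (C1.cl (P1 v))" for v
  define Q where "Q v = C2.coset_val (q v)" for v
  have qM: "q v \<in> carrier (local_algebra X2 L2)" for v
    unfolding q_def using bij_betw_apply[OF \<theta>(1) C1.cl_carrier[OF PB]] .
  have Q: "Q v \<in> C2.B" "q v = C2.cl (Q v)" for v
    unfolding Q_def using C2.carrier_M_E[OF qM[of v]] by blast+
  have "semilinear (proj_param L2 f2) Q"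
  proof
    show "Q (v + w) = Q v + Q w" for v w
    proof -
      have "q (v + w) = q v \<oplus>\<^bsub>local_algebra X2 L2\<^esub> q w"
        unfolding q_def P1.P_add C1.add_M[OF PB PB, symmetric]
        by (rule \<theta>(2)[OF C1.cl_carrier[OF PB] C1.cl_carrier[OF PB]])
      also have "\<dots> = C2.cl (Q v + Q w)" unfolding Q(2) by (rule C2.add_M[OF Q(1) Q(1)])
      finally show ?thesis using Q(1) by (simp add: Q_def[of "v + w"] C2.coset_val_cl C2.B_closed(3))
    qed
    show "Q (a *s v) = C2.\<gamma> a * Q v" for a v
    proof -
      have "q (a *s v) = (Y +>\<^bsub>cps_ring\<^esub> a) \<odot>\<^bsub>local_algebra X2 L2\<^esub> q v"
        unfolding q_def P1.P_smult C1.smult_M[OF PB, symmetric]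
        by (rule \<theta>(3)[OF C1.cl_carrier[OF PB]])
      also have "\<dots> = C2.cl (C2.\<gamma> a * Q v)" unfolding Q(2) by (rule C2.smult_M[OF Q(1)])
      finally show ?thesis using Q(1) by (simp add: Q_def[of "a *s v"] C2.coset_val_cl C2.B_closed(5))
    qed
  qed (rule C2.g(2))
  then interpret Q: semilinear "proj_param L2 f2" Q .
  have "range Q = C2.coset_val ` \<theta> ` C1.cl ` range P1"
    by (simp add: Q_def q_def image_image)
  also have "\<dots> = C2.B"
    using \<theta>(1) C1.bij_cl C2.bij_coset_val unfolding P1(2) by (simp add: bij_betw_def)
  finally have rQ: "range Q = range P2" by (simp add: P2(2))
  have "Q v = 0 \<longleftrightarrow> P1 v = 0" for v
  proof -
    have "Q v = 0 \<longleftrightarrow> C2.cl (Q v) = C2.cl 0"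
      by (rule iffI[OF _ C2.cl_inject[OF Q(1)]]; simp only:)
    also have "\<dots> \<longleftrightarrow> q v = q 0" unfolding Q(2)[of v] Q(2)[of 0] Q.P_0 by (rule refl)
    also have "\<dots> \<longleftrightarrow> C1.cl (P1 v) = C1.cl (P1 0)"
      unfolding q_def
      by (rule inj_on_eq_iff[OF bij_betw_imp_inj_on[OF \<theta>(1)] C1.cl_carrier[OF PB] C1.cl_carrier[OF PB]])
    also have "\<dots> \<longleftrightarrow> P1 v = 0"
      unfolding P1.P_0 by (rule iffI[OF C1.cl_inject[OF PB]]; simp only:)
    finally show ?thesis .
  qed
  then have d1: "range ((*v) d1) = {v. Q v = 0}" by (simp add: P1(3))
  obtain \<phi> \<psi> where \<phi>: "invertible \<phi>" "invertible \<psi>" "\<phi> ** d1 = d2 ** \<psi>"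
    using minimal_resolutions_equivalent[OF P2(1) Q.semilinear_axioms rQ d1 P1(4,5) P2(3-5)] by blast
  note i = matrix_inv_mult[OF \<phi>(1)] matrix_inv_mult[OF \<phi>(2)]
  have d2: "\<phi> ** d1 ** matrix_inv \<psi> = d2"
    unfolding \<phi>(3) by (simp add: i flip: matrix_mul_assoc)
  \<comment> \<open>The cofactor is determined by \<open>d2\<close> and \<open>F\<close>: both
    candidates have the same product with the injective \<open>d2\<close>.\<close>
  have "d2 ** (\<psi> ** h1 ** matrix_inv \<phi>) = d2 ** h2"
  proof -
    have "d2 ** (\<psi> ** h1 ** matrix_inv \<phi>) = \<phi> ** (d1 ** h1) ** matrix_inv \<phi>"
      by (simp add: matrix_mul_assoc flip: \<phi>(3))
    also have "\<dots> = mat F ** (\<phi> ** matrix_inv \<phi>)"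
      by (simp add: r1(2) matrix_mul_assoc flip: mat_commute[of F \<phi>])
    finally show ?thesis by (simp add: i r2(2))
  qed
  then have "d2 *v ((\<psi> ** h1 ** matrix_inv \<phi>) *v v) = d2 *v (h2 *v v)" for v
    by (simp add: matrix_vector_mul_assoc)
  then have "\<psi> ** h1 ** matrix_inv \<phi> = h2"
    using P2(4) by (intro matrix_eq_columns) (auto dest: injD)
  then have "gl_act (\<phi>, \<psi>) (d1, h1) = (d2, h2)" by (simp add: gl_act_def d2)
  then show ?thesis using gl_orbitI[OF \<phi>(1,2), of "(d1, h1)"] by simp
qed

text \<open>The orbit relation identifies the two rings only linearly over plane series;
  \<open>linear_iso_imp_algebra_iso\<close> repairs multiplicativity, as both evaluations of plane
  series have the kernel generated by \<open>F\<close>.\<close>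

lemma same_orbit_imp_algebra_iso:
  fixes d1 h1 d2 h2 :: "2 cps ^ 'b ^ 'b"
  assumes orb: "(d2, h2) \<in> gl_orbit (d1, h1)"
    and r1: "C1.is_resolution d1 P1" and r2: "C2.is_resolution d2 P2"
  shows "algebra_iso (local_ring Y) (local_algebra X1 L1) (local_algebra X2 L2) \<noteq> {}"
proof -
  have P1: "semilinear (proj_param L1 f1) P1" "range P1 = C1.B" "range ((*v) d1) = {v. P1 v = 0}"
    using r1 unfolding C1.is_resolution_def by blast+
  have P2: "semilinear (proj_param L2 f2) P2" "range P2 = C2.B" "range ((*v) d2) = {v. P2 v = 0}"
    using r2 unfolding C2.is_resolution_def by blast+
  interpret P1: semilinear "proj_param L1 f1" P1 by fact
  interpret P2: semilinear "proj_param L2 f2" P2 by fact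
  obtain \<phi> \<psi> where \<phi>: "invertible \<phi>" "invertible \<psi>" "d2 = \<phi> ** d1 ** matrix_inv \<psi>"
    using orb unfolding gl_orbit_def by (auto simp: gl_act_def)
  note i = matrix_inv_mult[OF \<phi>(1)] matrix_inv_mult[OF \<phi>(2)]
  have d2: "d2 ** \<psi> = \<phi> ** d1" unfolding \<phi>(3) by (simp add: i flip: matrix_mul_assoc)
  have ker: "P2 (\<phi> *v v) = 0 \<longleftrightarrow> P1 v = 0" for v
  proof
    assume "P1 v = 0"
    then obtain w where "v = d1 *v w" using P1(3) by blast
    then have "\<phi> *v v = d2 *v (\<psi> *v w)" by (simp add: matrix_vector_mul_assoc d2)
    then show "P2 (\<phi> *v v) = 0" using P2(3) by blast
  next
    assume "P2 (\<phi> *v v) = 0"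
    then obtain w where "\<phi> *v v = d2 *v w" using P2(3) by blast
    then have "matrix_inv \<phi> *v (\<phi> *v v) = matrix_inv \<phi> *v (\<phi> *v (d1 *v (matrix_inv \<psi> *v w)))"
      by (simp add: \<phi>(3) matrix_vector_mul_assoc matrix_mul_assoc)
    then have "v = d1 *v (matrix_inv \<psi> *v w)"
      by (simp add: matrix_vector_mul_assoc matrix_mul_assoc i)
    then show "P1 v = 0" using P1(3) by blast
  qed
  \<comment> \<open>Any preimage under \<open>P1\<close> may be chosen, because \<phi> matches the
    kernels of \<open>P1\<close> and \<open>P2\<close>.\<close>
  define k where "k z = P2 (\<phi> *v (SOME v. P1 v = z))" for z
  have k: "k (P1 v) = P2 (\<phi> *v v)" for v
  proof -
    have "P1 (SOME w. P1 w = P1 v) = P1 v" by (rule someI) simp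
    then have "P2 (\<phi> *v ((SOME w. P1 w = P1 v) - v)) = 0" unfolding ker by (simp add: P1.P_diff)
    then show ?thesis by (simp add: k_def matrix_vector_mult_diff_distrib P2.P_diff)
  qed
  have bij: "bij_betw k C1.B C2.B"
    unfolding bij_betw_def P1(2)[symmetric] P2(2)[symmetric]
  proof
    show "inj_on k (range P1)"
    proof (rule inj_onI, clarify)
      fix v w assume "k (P1 v) = k (P1 w)"
      then have "P2 (\<phi> *v (v - w)) = 0" by (simp add: k matrix_vector_mult_diff_distrib P2.P_diff)
      then show "P1 v = P1 w" unfolding ker by (simp add: P1.P_diff)
    qed
    have "P2 w \<in> k ` range P1" for w
    proof -
      have "P2 w = k (P1 (matrix_inv \<phi> *v w))" by (simp add: k matrix_vector_mul_assoc i)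
      then show ?thesis by blast
    qed
    then show "k ` range P1 = range P2" by (auto simp: k)
  qed
  have "\<exists>v. z = P1 v" if "z \<in> C1.B" for z using that P1(2) by (metis rangeE)
  note PE = this
  have kadd: "k (z + w) = k z + k w" if zw: "z \<in> C1.B" "w \<in> C1.B" for z w
  proof -
    obtain x y where "z = P1 x" "w = P1 y" using PE zw by metis
    then show ?thesis by (simp add: k matrix_vector_right_distrib P2.P_add flip: P1.P_add)
  qed
  have ksmult: "k (C1.\<gamma> a * z) = C2.\<gamma> a * k z" if z: "z \<in> C1.B" for a z
  proof -
    obtain x where "z = P1 x" using PE z by metis
    then show ?thesis by (simp add: k matrix_vector_mult_smult P2.P_smult flip: P1.P_smult)
  qed
  have kery: "C1.\<gamma> a = 0 \<longleftrightarrow> C2.\<gamma> a = 0" for a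
    unfolding C1.\<gamma>_eq_0_iff C2.\<gamma>_eq_0_iff ..
  obtain l where l: "bij_betw l C1.B C2.B" "l 1 = 1"
    "\<And>z z'. z \<in> C1.B \<Longrightarrow> z' \<in> C1.B \<Longrightarrow> l (z + z') = l z + l z'"
    "\<And>z z'. z \<in> C1.B \<Longrightarrow> z' \<in> C1.B \<Longrightarrow> l (z * z') = l z * l z'"
    "\<And>a z. z \<in> C1.B \<Longrightarrow> l (C1.\<gamma> a * z) = C2.\<gamma> a * l z"
    using linear_iso_imp_algebra_iso[of C1.B C1.\<gamma> C2.B k C2.\<gamma>,
        OF C1.B_closed(1,4,5) C2.B_closed(1,4) bij kadd ksmult C1.fraction kery] by blast
  define \<theta> where "\<theta> = C2.cl \<circ> l \<circ> C1.coset_val"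
  have \<theta>: "\<theta> (C1.cl z) = C2.cl (l z)" if "z \<in> C1.B" for z
    using C1.coset_val_cl[OF that] by (simp add: \<theta>_def)
  have lB: "l z \<in> C2.B" if "z \<in> C1.B" for z using bij_betw_apply[OF l(1) that] .
  have b: "bij_betw \<theta> (carrier (local_algebra X1 L1)) (carrier (local_algebra X2 L2))"
    unfolding \<theta>_def by (intro bij_betw_trans[OF bij_betw_trans[OF C1.bij_coset_val l(1)] C2.bij_cl, unfolded o_assoc])
  have add: "\<theta> (x \<oplus>\<^bsub>local_algebra X1 L1\<^esub> y) = \<theta> x \<oplus>\<^bsub>local_algebra X2 L2\<^esub> \<theta> y"
    if xy: "x \<in> carrier (local_algebra X1 L1)" "y \<in> carrier (local_algebra X1 L1)" for x y
  proof -
    obtain z w where zw: "z \<in> C1.B" "x = C1.cl z" "w \<in> C1.B" "y = C1.cl w"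
      using xy unfolding C1.carrier_M by blast
    show ?thesis
      unfolding zw(2,4) C1.add_M[OF zw(1,3)] \<theta>[OF zw(1)] \<theta>[OF zw(3)] \<theta>[OF C1.B_closed(3)[OF zw(1,3)]]
        l(3)[OF zw(1,3)] C2.add_M[OF lB[OF zw(1)] lB[OF zw(3)]] ..
  qed
  have mult: "\<theta> (x \<otimes>\<^bsub>local_algebra X1 L1\<^esub> y) = \<theta> x \<otimes>\<^bsub>local_algebra X2 L2\<^esub> \<theta> y"
    if xy: "x \<in> carrier (local_algebra X1 L1)" "y \<in> carrier (local_algebra X1 L1)" for x y
  proof -
    obtain z w where zw: "z \<in> C1.B" "x = C1.cl z" "w \<in> C1.B" "y = C1.cl w"
      using xy unfolding C1.carrier_M by blast
    show ?thesis
      unfolding zw(2,4) C1.mult_M[OF zw(1,3)] \<theta>[OF zw(1)] \<theta>[OF zw(3)] \<theta>[OF C1.B_closed(4)[OF zw(1,3)]]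
        l(4)[OF zw(1,3)] C2.mult_M[OF lB[OF zw(1)] lB[OF zw(3)]] ..
  qed
  have smult: "\<theta> (a \<odot>\<^bsub>local_algebra X1 L1\<^esub> x) = a \<odot>\<^bsub>local_algebra X2 L2\<^esub> \<theta> x"
    if ax: "a \<in> carrier (local_ring Y)" "x \<in> carrier (local_algebra X1 L1)" for a x
  proof -
    obtain z where z: "z \<in> C1.B" "x = C1.cl z" using ax unfolding C1.carrier_M by blast
    obtain c where c: "a = Y +>\<^bsub>cps_ring\<^esub> c" using ax unfolding carrier_local_ring by blast
    show ?thesis
      unfolding z(2) c C1.smult_M[OF z(1)] \<theta>[OF z(1)] \<theta>[OF C1.B_closed(5)[OF z(1)]]
        l(5)[OF z(1)] C2.smult_M[OF lB[OF z(1)]] ..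
  qed
  have one: "\<theta> \<one>\<^bsub>local_algebra X1 L1\<^esub> = \<one>\<^bsub>local_algebra X2 L2\<^esub>"
    unfolding C1.one_M C2.one_M \<theta>[OF C1.B_closed(1)] l(2) ..
  have "\<theta> \<in> algebra_iso (local_ring Y) (local_algebra X1 L1) (local_algebra X2 L2)"
    unfolding algebra_iso_def module_iso_def ring_iso_def ring_hom_def
    using b add mult smult one bij_betw_apply[OF b] by auto
  then show ?thesis by blast
qed

end

section \<open>The bijection on classes\<close>

lemma curve_projection_exists:
  fixes X :: "('n :: finite) cps set"
  assumes "(X, L) \<in> projected_curves Y" "Y = cgenideal cps_ring F" "F \<noteq> 0"
  shows "\<exists>f i m. curve_projection f X L Y F i m"
proof -
  have L: "L \<in> generic_forms X" "projection_germ L X = Y"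
    using assms(1) by (auto simp: projected_curves_def)
  obtain f i m where "parametrizes f X" "m > 0" "proj_param L f i = fps_X ^ m"
    using generic_projection_normal_form[OF L(1)] .
  then have "curve_projection f X L Y F i m" using L assms by unfold_locales auto
  then show ?thesis by blast
qed

text \<open>Set-valued, because a resolution depends on choices; the theorem's proof shows that all
  members for one curve in \<open>G_set\<close> lie in one orbit.\<close>

definition resolving :: "2 cps \<Rightarrow> ('n :: finite) cps set \<times> (complex ^ 'n ^ 2) \<Rightarrow> 'b :: finite mat_pair set" where
  "resolving F = (\<lambda>(X, L). {(d, h). matrix_factorization F (d, h) \<and>
     (\<exists>p. minimal_free_resolution (cgenideal cps_ring F) X L d p)})"

theorem theorem5p12:
  fixes F :: "2 cps" and Y :: "2 cps set"
  assumes n: "CARD('n :: finite) \<ge> 3"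
    and b: "CARD('b :: finite) \<ge> 2"
    and Y: "curve_singularity Y"
    and F: "irreducible F" "Y = cgenideal cps_ring F"
  shows "\<exists>\<epsilon> :: ('n cps set \<times> (complex ^ 'n ^ 2)) set \<Rightarrow> 'b mat_pair set.
    bij_betw \<epsilon> (G_set Y CARD('b) // G_equiv Y CARD('b)) (gl_orbit ` MatRep TYPE('n) F) \<and>
    (\<forall>(X, L) \<in> G_set Y CARD('b).
       (\<exists>d h p. matrix_factorization F (d, h) \<and> minimal_free_resolution Y X L d p \<and>
          \<epsilon> (G_equiv Y CARD('b) `` {(X, L)}) = gl_orbit (d, h)) \<and>
       (\<forall>d h p. matrix_factorization F (d, h) \<and> minimal_free_resolution Y X L d p \<longrightarrow>
          \<epsilon> (G_equiv Y CARD('b) `` {(X, L)}) = gl_orbit (d, h)))"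
proof -
  let ?G = "G_set Y CARD('b) :: ('n cps set \<times> (complex ^ 'n ^ 2)) set"
  let ?E = "G_equiv Y CARD('b) :: (('n cps set \<times> (complex ^ 'n ^ 2)) \<times> ('n cps set \<times> (complex ^ 'n ^ 2))) set"
  let ?R = "resolving F :: 'n cps set \<times> (complex ^ 'n ^ 2) \<Rightarrow> 'b mat_pair set"
  have F0: "F \<noteq> 0" using F(1) by auto
  have proj: "\<exists>f i m. curve_projection f X L Y F i m" if "(X, L) \<in> projected_curves Y" for X :: "'n cps set" and L
    using curve_projection_exists[OF that F(2) F0] .
  have GP: "(X, L) \<in> projected_curves Y" if "(X, L) \<in> ?G" for X L using that by (simp add: G_set_def)
  have R: "(d, h) \<in> ?R (X, L) \<longleftrightarrow> matrix_factorization F (d, h) \<and> (\<exists>p. minimal_free_resolution Y X L d p)" for X L d h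
    by (simp add: resolving_def F(2))
  have nonempty: "?R x \<noteq> {}" if x: "x \<in> ?G" for x
  proof -
    obtain X L where XL: "x = (X, L)" by fastforce
    obtain f i m where "curve_projection f X L Y F i m" using proj GP x XL by blast
    then interpret curve_projection f X L Y F i m .
    have "generated_by CARD('b)" "\<not> generated_by (CARD('b) - 1)"
      using x XL b min_generators_eq_iff[of "CARD('b)"] by (auto simp: G_set_def)
    then obtain d :: "2 cps ^ 'b ^ 'b" and h P where "is_resolution d P" "matrix_factorization F (d, h)"
      using resolution_exists[where 'b = 'b] by blast
    then show ?thesis using resolution_cl R[of d h X L] XL by blast
  qed
  have iso_orbit: "m2 \<in> gl_orbit m1"
    if xy: "x \<in> ?G" "y \<in> ?G" "m1 \<in> ?R x" "m2 \<in> ?R y"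
      "\<theta> \<in> module_iso (local_ring Y) (local_algebra (fst x) (snd x)) (local_algebra (fst y) (snd y))" for x y m1 m2 \<theta>
  proof -
    obtain X1 L1 X2 L2 d1 h1 d2 h2 where e: "x = (X1, L1)" "y = (X2, L2)" "m1 = (d1, h1)" "m2 = (d2, h2)" by fastforce
    obtain f1 i1 m1 f2 i2 m2 where "curve_projection f1 X1 L1 Y F i1 m1" "curve_projection f2 X2 L2 Y F i2 m2"
      using proj GP xy(1,2) e by metis
    then interpret two_curve_projections f1 X1 L1 f2 X2 L2 Y F i1 m1 i2 m2
      by (simp add: two_curve_projections_def)
    obtain p1 p2 where p: "d1 ** h1 = mat F" "minimal_free_resolution Y X1 L1 d1 p1"
      "d2 ** h2 = mat F" "minimal_free_resolution Y X2 L2 d2 p2"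
      using xy(3,4) unfolding e R matrix_factorization_def by auto
    show ?thesis
      unfolding e using module_iso_imp_same_orbit[OF _ C1.resolution_coset_val[OF p(2)] p(1) C2.resolution_coset_val[OF p(4)] p(3)]
        xy(5) unfolding e by simp
  qed
  have orbit_iso: "algebra_iso (local_ring Y) (local_algebra (fst x) (snd x)) (local_algebra (fst y) (snd y)) \<noteq> {}"
    if xy: "x \<in> ?G" "y \<in> ?G" "m1 \<in> ?R x" "m2 \<in> ?R y" "m2 \<in> gl_orbit m1" for x y m1 m2
  proof -
    obtain X1 L1 X2 L2 d1 h1 d2 h2 where e: "x = (X1, L1)" "y = (X2, L2)" "m1 = (d1, h1)" "m2 = (d2, h2)" by fastforce
    obtain f1 i1 m1 f2 i2 m2 where "curve_projection f1 X1 L1 Y F i1 m1" "curve_projection f2 X2 L2 Y F i2 m2"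
      using proj GP xy(1,2) e by metis
    then interpret two_curve_projections f1 X1 L1 f2 X2 L2 Y F i1 m1 i2 m2
      by (simp add: two_curve_projections_def)
    obtain p1 p2 where p: "minimal_free_resolution Y X1 L1 d1 p1" "minimal_free_resolution Y X2 L2 d2 p2"
      using xy(3,4) unfolding e R by blast
    show ?thesis
      using same_orbit_imp_algebra_iso[OF _ C1.resolution_coset_val[OF p(1)] C2.resolution_coset_val[OF p(2)]]
        xy(5) unfolding e by simp
  qed
  have id_iso: "id \<in> module_iso (local_ring Y) (local_algebra X L) (local_algebra X L)" for X :: "'n cps set" and L
    by (simp add: module_iso_def)
  \<comment> \<open>Two resolutions of the same curve are compared through \<open>id_iso\<close>, so
    the orbit is independent of the choice.\<close>
  define orb where "orb x = gl_orbit (SOME m. m \<in> ?R x)" for x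
  have orb: "orb x = gl_orbit m" if "x \<in> ?G" "m \<in> ?R x" for x m
  proof -
    have "(SOME m. m \<in> ?R x) \<in> ?R x" using that(2) by (rule someI)
    then have "m \<in> gl_orbit (SOME m. m \<in> ?R x)" using iso_orbit[OF that(1,1) _ that(2) id_iso] by blast
    then show ?thesis unfolding orb_def gl_orbit_eq_iff .
  qed
  \<comment> \<open>On \<open>?G\<close> the relation is equality of \<open>orb\<close>, so its
    classes are the fibres of \<open>orb\<close> and injectivity of the induced map is
    immediate.\<close>
  have equiv: "(x, y) \<in> ?E \<longleftrightarrow> orb x = orb y" if xy: "x \<in> ?G" "y \<in> ?G" for x y
  proof -
    obtain m1 m2 where m: "m1 \<in> ?R x" "m2 \<in> ?R y" using nonempty xy by blast
    have "orb x = orb y \<longleftrightarrow> m2 \<in> gl_orbit m1"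
      unfolding orb[OF xy(1) m(1)] orb[OF xy(2) m(2)] by (rule gl_orbit_eq_iff)
    moreover have "(x, y) \<in> ?E \<longleftrightarrow>
        algebra_iso (local_ring Y) (local_algebra (fst x) (snd x)) (local_algebra (fst y) (snd y)) \<noteq> {}"
      using xy by (cases x; cases y) (simp add: G_equiv_def)
    moreover have "m2 \<in> gl_orbit m1"
      if "algebra_iso (local_ring Y) (local_algebra (fst x) (snd x)) (local_algebra (fst y) (snd y)) \<noteq> {}"
      using that iso_orbit[OF xy m] unfolding algebra_iso_def by blast
    ultimately show ?thesis using orbit_iso[OF xy m] by blast
  qed
  have cls: "?E `` {x} = {y \<in> ?G. orb y = orb x}" if x: "x \<in> ?G" for x
  proof -
    have "?E \<subseteq> ?G \<times> ?G" by (auto simp: G_equiv_def)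
    then show ?thesis using equiv[OF x] by auto
  qed
  define \<epsilon> where "\<epsilon> C = orb (SOME x. x \<in> C)" for C
  have \<epsilon>: "\<epsilon> (?E `` {x}) = orb x" if x: "x \<in> ?G" for x
  proof -
    have "(SOME y. y \<in> ?E `` {x}) \<in> ?E `` {x}" by (rule someI[of _ x]) (use x in \<open>simp add: cls\<close>)
    then show ?thesis unfolding \<epsilon>_def using x by (simp add: cls)
  qed
  have "inj_on \<epsilon> (?G // ?E)"
  proof (rule inj_onI)
    fix C D assume "C \<in> ?G // ?E" "D \<in> ?G // ?E" "\<epsilon> C = \<epsilon> D"
    then obtain x y where "x \<in> ?G" "C = ?E `` {x}" "y \<in> ?G" "D = ?E `` {y}" "orb x = orb y"
      by (elim quotientE) (simp add: \<epsilon>)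
    then show "C = D" by (simp add: cls)
  qed
  moreover have "\<epsilon> ` (?G // ?E) = gl_orbit ` MatRep TYPE('n) F"
  proof -
    have "?G // ?E = (\<lambda>x. ?E `` {x}) ` ?G" by (auto simp: quotient_def)
    then have "\<epsilon> ` (?G // ?E) = orb ` ?G" by (simp add: image_image \<epsilon>)
    also have "\<dots> = gl_orbit ` MatRep TYPE('n) F"
    proof
      show "orb ` ?G \<subseteq> gl_orbit ` MatRep TYPE('n) F"
      proof clarify
        fix X L assume x: "(X, L) \<in> ?G"
        obtain d h where dhR: "(d, h) \<in> ?R (X, L)" using nonempty[OF x] by fastforce
        then obtain p where p: "matrix_factorization F (d, h)" "minimal_free_resolution Y X L d p"
          unfolding R by blast
        then have dh: "d ** h = mat F" "h ** d = mat F" by (auto simp: matrix_factorization_def)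
        obtain f i m where "curve_projection f X L Y F i m" using proj GP x by blast
        then interpret curve_projection f X L Y F i m .
        note res = resolution_coset_val[OF p(2)]
        \<comment> \<open>Here \<open>CARD('b) \<ge> 2\<close> enters: O_X is not cyclic, so
          \<open>h\<close> has no unit entries, as \<open>MatRep\<close> demands.\<close>
        have "\<not> generated_by 1"
          using x b unfolding min_generators_le_iff[symmetric] by (auto simp: G_set_def one_enat_def)
        then have "const_matrix h = 0" by (rule cofactor_nonunit[OF res dh(2)])
        moreover have "const_matrix d = 0" using res by (simp add: is_resolution_def)
        ultimately have "(d, h) \<in> MatRep TYPE('n) F"
          unfolding MatRep_def F(2)[symmetric]
          using p(1) coker_iso_of_resolution[OF res dh(1)] bexI[OF _ GP[OF x]]
          by (simp add: const_matrix_eq_0_iff)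
        then show "orb (X, L) \<in> gl_orbit ` MatRep TYPE('n) F" using orb[OF x dhR] by blast
      qed
      show "gl_orbit ` MatRep TYPE('n) F \<subseteq> orb ` ?G"
      proof clarify
        fix d h :: "2 cps ^ 'b ^ 'b" assume "(d, h) \<in> MatRep TYPE('n) F"
        then obtain X :: "'n cps set" and L \<theta> where mr: "matrix_factorization F (d, h)"
          "\<forall>i j. d $ i $ j \<in> xy_ideal" "(X, L) \<in> projected_curves Y"
          "\<theta> \<in> module_iso (local_ring Y) (coker d) (local_algebra X L)"
          by (auto simp: MatRep_def F(2))
        obtain f i m where "curve_projection f X L Y F i m" using proj mr(3) by blast
        then interpret curve_projection f X L Y F i m .
        have dh: "d ** h = mat F" using mr(1) by (simp add: matrix_factorization_def)
        have d0: "const_matrix d = 0" using mr(2) by (simp add: const_matrix_eq_0_iff)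
        note res = resolution_of_coker_iso[OF mr(4) dh d0]
        \<comment> \<open>With all entries of \<open>d\<close> in the maximal ideal, the size of
          \<open>d\<close> is the number of generators, so the curve behind a pair in
          \<open>MatRep\<close> belongs to \<open>?G\<close>.\<close>
        have "min_generators (local_ring Y) (local_algebra X L) = enat CARD('b)"
          using resolution_generators[OF res] b by (simp add: min_generators_eq_iff)
        then have x: "(X, L) \<in> ?G" using mr(3) by (simp add: G_set_def)
        have "(d, h) \<in> ?R (X, L)" unfolding R using mr(1) resolution_cl[OF res] by blast
        then have "gl_orbit (d, h) = orb (X, L)" using orb[OF x] by simp
        then show "gl_orbit (d, h) \<in> orb ` ?G" using x by blast
      qed
    qed
    finally show ?thesis .
  qed
  ultimately have "bij_betw \<epsilon> (?G // ?E) (gl_orbit ` MatRep TYPE('n) F)" by (simp add: bij_betw_def)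
  moreover have "(\<exists>d h p. matrix_factorization F (d, h) \<and> minimal_free_resolution Y X L d p \<and>
          \<epsilon> (?E `` {(X, L)}) = gl_orbit (d, h)) \<and>
       (\<forall>d h p. matrix_factorization F (d, h) \<and> minimal_free_resolution Y X L d p \<longrightarrow>
          \<epsilon> (?E `` {(X, L)}) = gl_orbit (d, h))" if x: "(X, L) \<in> ?G" for X L
  proof -
    have all: "\<epsilon> (?E `` {(X, L)}) = gl_orbit (d, h)"
      if "matrix_factorization F (d, h)" "minimal_free_resolution Y X L d p" for d h p
    proof -
      have "(d, h) \<in> ?R (X, L)" unfolding R using that by blast
      then show ?thesis unfolding \<epsilon>[OF x] by (rule orb[OF x])
    qed
    obtain d h where "(d, h) \<in> ?R (X, L)" using nonempty[OF x] by fastforce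
    then obtain p where "matrix_factorization F (d, h)" "minimal_free_resolution Y X L d p"
      unfolding R by blast
    then show ?thesis using all by blast
  qed
  ultimately show ?thesis by blast
qed

end
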